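(* Let $M,N$ be connected $MC^k$-Fréchet manifolds, let $A$ be a manifold of dimension $n$ (finite), and let $S\subset N$ be a submanifold of finite co-dimension $m$. Let $\varphi:M\times A\to N$ be an $MC^k$-mapping with $k\geq\max\{1,n-m\}$. If $\varphi$ is transversal to $S$, then the set of all points $x\in M$ such that the mapping $\varphi_x:A\to N$, $\varphi_x(\cdot):=\varphi(x,\cdot)$, is transversal to $S$ is residual in $M$.
   Context: Fréchet spaces. Every Fréchet space $F$ is equipped with a fixed translation-invariant metric of the form $\varrho(x,y)=\sup_{n\in\mathbb N}\frac{1}{2^n}\frac{\|x-y\|_{F,n}}{1+\|x-y\|_{F,n}}$, where $\|\cdot\|_{F,n}$ are seminorms generating the topology. For Fréchet spaces $(E,\sigma)$, $(F,\varrho)$, $\mathbb L_{\sigma,\varrho}(E,F)$ is the set of linear maps $L:E\to F$ with $\mathrm{Lip}(L):=\sup_{x\in E\setminus\{0\}}\varrho(L(x),0)/\sigma(x,0)<\infty$, topologized by the metric $(L,H)\mapsto \mathrm{Lip}(L-H)$. $MC^k$-maps. Let $U\subseteq E$ be open and $\varphi:U\to F$ continuous. $\varphi$ is Keller $C^1_c$ if all directional derivatives $D\varphi(x)h=\lim_{t\to0}(\varphi(x+th)-\varphi(x))/t$ exist and $D\varphi:U\to CL(E,F)$ is continuous, where $CL(E,F)$ (continuous linear maps) has the compact-open topology. $\varphi$ is $MC^1$ if it is $C^1_c$, $D\varphi(x)\in\mathbb L_{\sigma,\varrho}(E,F)$ for all $x\in U$, and $\varphi'=D\varphi:U\to\mathbb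 L_{\sigma,\varrho}(E,F)$ is continuous. $MC^k$ for $k>1$ is defined recursively (for connected open $V\subseteq U$ and $x_0\in V$, the map $\varphi'|_V-\varphi'(x_0)$ into the connected component of $0$ in $\mathbb L_{\sigma,\varrho}(E,F)$ is required to be $MC^{k-1}$). Manifolds. An $MC^k$-Fréchet manifold is a Hausdorff second countable space modeled on a Fréchet space with an atlas whose transition maps are $MC^k$; $MC^k$-maps between manifolds are defined via charts. A closed subspace of a Fréchet space splits if it has a closed topological complement. A subset $S\subset N$ is an $MC^k$-submanifold if around each of its points there is a chart $(\mathcal V,\psi)$ of $N$ with $\psi(\mathcal V)=F_1+F_2\subseteq \mathbf F_1\oplus\mathbf F_2$ (a topological direct sum decomposition of the model space, $F_i$ an open neighborhood of $0$ in $\mathbf F_i$) and $\psi(S\cap\mathcal V)=F_1$. All manifolds and submanifolds are of class $MC^k$. Transversality. A map $\varphi:P\to N$ of class $MC^k$, $k\ge1$, is transversal to a submanifold $S\subseteq N$ if either $\varphi^{-1}(S)=\emptyset$, or for each $p\in\varphi^{-1}(S)$: (1) $(T_p\varphi)(T_pP)+T_{\varphi(p)}S=T_{\varphi(p)}N$, and (2) $(T_p\varphi)^{-1}(T_{\varphi(p)}S)$ splits in $T_pP$. A subset is residual if it contains a countable intersection of open dense subsets. *)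

theory Defs
  imports "HOL-Analysis.Analysis" "HOL-Library.Function_Algebras"
begin

instantiation "fun" :: (type, real_vector) real_vector
begin

definition "c *\<^sub>R f = (\<lambda>x. c *\<^sub>R f x)"

instance
  by standard (simp_all add: scaleR_fun_def fun_eq_iff algebra_simps)

end

text \<open>A Frechet space carries a distinguished sequence of seminorms, because its metric is part of
  the data. Completeness is stated for sequences that are Cauchy in every seminorm.\<close>

class frechet_space = real_vector + topological_space +
  fixes fseminorm :: "nat \<Rightarrow> 'a \<Rightarrow> real"
  assumes fseminorm_triangle: "fseminorm n (x + y) \<le> fseminorm n x + fseminorm n y"
    and fseminorm_scaleR: "fseminorm n (c *\<^sub>R x) = \<bar>c\<bar> * fseminorm n x"
    and fseminorm_separating: "(\<forall>n. fseminorm n x = 0) \<Longrightarrow> x = 0"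
    and open_fseminorm:
      "open U \<longleftrightarrow> (\<forall>x\<in>U. \<exists>n. \<exists>e>0. \<forall>y. (\<forall>i\<le>n. fseminorm i (y - x) < e) \<longrightarrow> y \<in> U)"
    and fseminorm_complete:
      "(\<forall>n. \<forall>e>0. \<exists>K. \<forall>i\<ge>K. \<forall>j\<ge>K. fseminorm n (X i - X j) < e)
        \<Longrightarrow> \<exists>x. \<forall>n. (\<lambda>i. fseminorm n (X i - x)) \<longlonglongrightarrow> 0"

definition frechet_dist :: "'a::frechet_space \<Rightarrow> 'a \<Rightarrow> real" where
  "frechet_dist x y = (SUP n. 1 / 2 ^ n * (fseminorm n (x - y) / (1 + fseminorm n (x - y))))"

lemma fseminorm_zero [simp]: "fseminorm n (0::'a::frechet_space) = 0"
  using fseminorm_scaleR[of n 0 "0::'a"] by simp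

lemma fseminorm_minus: "fseminorm n (- x) = fseminorm n (x::'a::frechet_space)"
  using fseminorm_scaleR[of n "-1" x] by simp

lemma fseminorm_nonneg [simp]: "0 \<le> fseminorm n (x::'a::frechet_space)"
  using fseminorm_triangle[of n x "- x"] by (simp add: fseminorm_minus)

lemma open_fseminormD:
  fixes U :: "'a::frechet_space set"
  assumes "open U" "x \<in> U"
  shows "\<exists>n. \<exists>e>0. \<forall>y. (\<forall>i\<le>n. fseminorm i (y - x) < e) \<longrightarrow> y \<in> U"
  using assms(1)[unfolded open_fseminorm] assms(2) by (rule bspec)

text \<open>The product of two Frechet spaces carries the maximum of the seminorms, so that its metric is
  the maximum of the two metrics.\<close>

instantiation prod :: (frechet_space, frechet_space) frechet_space
begin

definition "fseminorm n z = max (fseminorm n (fst z)) (fseminorm n (snd z))"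

instance
proof
  fix n :: nat and x y :: "'a \<times> 'b" and c :: real
  show "fseminorm n (x + y) \<le> fseminorm n x + fseminorm n y"
    using fseminorm_triangle[of n "fst x" "fst y"] fseminorm_triangle[of n "snd x" "snd y"]
    unfolding fseminorm_prod_def fst_add snd_add by linarith
  show "fseminorm n (c *\<^sub>R x) = \<bar>c\<bar> * fseminorm n x"
    by (simp add: fseminorm_prod_def fseminorm_scaleR max_mult_distrib_left)
next
  fix x :: "'a \<times> 'b"
  assume *: "\<forall>n. fseminorm n x = 0"
  have "fseminorm n (fst x) = 0 \<and> fseminorm n (snd x) = 0" for n
    using *[rule_format, of n] fseminorm_nonneg[of n "fst x"] fseminorm_nonneg[of n "snd x"]
    unfolding fseminorm_prod_def by linarith
  then show "x = 0"
    using fseminorm_separating[of "fst x"] fseminorm_separating[of "snd x"] by (simp add: prod_eq_iff)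
next
  fix U :: "('a \<times> 'b) set"
  show "open U \<longleftrightarrow> (\<forall>x\<in>U. \<exists>n. \<exists>e>0. \<forall>y. (\<forall>i\<le>n. fseminorm i (y - x) < e) \<longrightarrow> y \<in> U)"
    (is "_ = ?R")
  proof
    assume U: "open U"
    show ?R
    proof
      fix x assume "x \<in> U"
      then obtain A B where AB: "open A" "open B" "x \<in> A \<times> B" "A \<times> B \<subseteq> U"
        using U[unfolded open_prod_def, rule_format, of x] by auto
      obtain n d where nd: "d > 0" "\<forall>y. (\<forall>i\<le>n. fseminorm i (y - fst x) < d) \<longrightarrow> y \<in> A"
        using open_fseminormD[OF AB(1), of "fst x"] AB(3) by (auto simp: mem_Times_iff)
      obtain m e where me: "e > 0" "\<forall>y. (\<forall>i\<le>m. fseminorm i (y - snd x) < e) \<longrightarrow> y \<in> B"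
        using open_fseminormD[OF AB(2), of "snd x"] AB(3) by (auto simp: mem_Times_iff)
      have "y \<in> U" if y: "\<forall>i\<le>max n m. fseminorm i (y - x) < min d e" for y
      proof -
        have "fst y \<in> A"
          by (rule nd(2)[rule_format]) (use y in \<open>auto simp: fseminorm_prod_def\<close>)
        moreover have "snd y \<in> B"
          by (rule me(2)[rule_format]) (use y in \<open>auto simp: fseminorm_prod_def\<close>)
        ultimately show ?thesis
          using AB(4) by (auto simp: mem_Times_iff)
      qed
      then show "\<exists>n. \<exists>e>0. \<forall>y. (\<forall>i\<le>n. fseminorm i (y - x) < e) \<longrightarrow> y \<in> U"
        using nd(1) me(1) by (intro exI[of _ "max n m"] exI[of _ "min d e"]) auto
    qed
  next
    assume R: ?R
    have op: "open {y::'c::frechet_space. \<forall>i\<le>n. fseminorm i (y - x) < e}" for n x e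
      unfolding open_fseminorm
    proof
      fix y :: 'c assume y: "y \<in> {y. \<forall>i\<le>n. fseminorm i (y - x) < e}"
      define d where "d = Min ((\<lambda>i. e - fseminorm i (y - x)) ` {..n})"
      have d: "d > 0" unfolding d_def using y by (subst Min_gr_iff) auto
      have "fseminorm i (z - x) < e" if "\<forall>i\<le>n. fseminorm i (z - y) < d" "i \<le> n" for z i
      proof -
        have "d \<le> e - fseminorm i (y - x)"
          unfolding d_def using that(2) by (intro Min_le) auto
        then show ?thesis
          using that fseminorm_triangle[of i "z - y" "y - x"] by force
      qed
      then show "\<exists>m. \<exists>d>0. \<forall>z. (\<forall>i\<le>m. fseminorm i (z - y) < d)
          \<longrightarrow> z \<in> {y. \<forall>i\<le>n. fseminorm i (y - x) < e}"
        using d by blast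
    qed
    show "open U"
      unfolding open_prod_def
    proof
      fix x assume "x \<in> U"
      then obtain n e where ne: "e > 0" "\<forall>y. (\<forall>i\<le>n. fseminorm i (y - x) < e) \<longrightarrow> y \<in> U"
        using R[rule_format, of x] by auto
      let ?A = "{y. \<forall>i\<le>n. fseminorm i (y - fst x) < e}"
      let ?B = "{y. \<forall>i\<le>n. fseminorm i (y - snd x) < e}"
      have "?A \<times> ?B \<subseteq> U" "x \<in> ?A \<times> ?B"
        using ne by (auto simp: fseminorm_prod_def mem_Times_iff)
      then show "\<exists>A B. open A \<and> open B \<and> x \<in> A \<times> B \<and> A \<times> B \<subseteq> U"
        by (intro exI[of _ ?A] exI[of _ ?B] conjI op)
    qed
  qed
next
  fix X :: "nat \<Rightarrow> 'a \<times> 'b"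
  assume C: "\<forall>n. \<forall>e>0. \<exists>K. \<forall>i\<ge>K. \<forall>j\<ge>K. fseminorm n (X i - X j) < e"
  have "\<exists>x. \<forall>n. (\<lambda>i. fseminorm n (fst (X i) - x)) \<longlonglongrightarrow> 0"
  proof (intro fseminorm_complete allI impI)
    fix n and e :: real assume "e > 0"
    then obtain K where "\<forall>i\<ge>K. \<forall>j\<ge>K. fseminorm n (X i - X j) < e"
      using C[rule_format, of e n] by auto
    then show "\<exists>K. \<forall>i\<ge>K. \<forall>j\<ge>K. fseminorm n (fst (X i) - fst (X j)) < e"
      by (intro exI[of _ K]) (simp add: fseminorm_prod_def)
  qed
  moreover have "\<exists>x. \<forall>n. (\<lambda>i. fseminorm n (snd (X i) - x)) \<longlonglongrightarrow> 0"
  proof (intro fseminorm_complete allI impI)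
    fix n and e :: real assume "e > 0"
    then obtain K where "\<forall>i\<ge>K. \<forall>j\<ge>K. fseminorm n (X i - X j) < e"
      using C[rule_format, of e n] by auto
    then show "\<exists>K. \<forall>i\<ge>K. \<forall>j\<ge>K. fseminorm n (snd (X i) - snd (X j)) < e"
      by (intro exI[of _ K]) (simp add: fseminorm_prod_def)
  qed
  ultimately obtain x y
    where "\<And>n. (\<lambda>i. fseminorm n (fst (X i) - x)) \<longlonglongrightarrow> 0"
      "\<And>n. (\<lambda>i. fseminorm n (snd (X i) - y)) \<longlonglongrightarrow> 0"
    by blast
  then have "(\<lambda>i. max (fseminorm n (fst (X i) - x)) (fseminorm n (snd (X i) - y))) \<longlonglongrightarrow> max 0 0" for n
    by (intro tendsto_max) auto
  then show "\<exists>x. \<forall>n. (\<lambda>i. fseminorm n (X i - x)) \<longlonglongrightarrow> 0"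
    by (intro exI[of _ "(x, y)"]) (simp add: fseminorm_prod_def)
qed

end

definition has_dimension :: "'v::real_vector set \<Rightarrow> nat \<Rightarrow> bool" where
  "has_dimension W n \<longleftrightarrow> (\<exists>B. finite B \<and> card B = n \<and> independent B \<and> span B = W)"

definition topological_direct_sum ::
    "'v::real_vector topology \<Rightarrow> 'v set \<Rightarrow> 'v set \<Rightarrow> bool" where
  "topological_direct_sum X W Z \<longleftrightarrow>
     subspace W \<and> closedin X W \<and> subspace Z \<and> closedin X Z \<and>
     homeomorphic_map (prod_topology (subtopology X W) (subtopology X Z)) X (\<lambda>(w, z). w + z)"

definition splits_in :: "'v::real_vector topology \<Rightarrow> 'v set \<Rightarrow> bool" where
  "splits_in X W \<longleftrightarrow> (\<exists>Z. topological_direct_sum X W Z)"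

text \<open>The targets of the iterated derivatives are pairs \<open>(C, d)\<close> of a linear subspace \<open>C\<close> of
  some real vector space and a translation invariant metric \<open>d\<close> on it.\<close>

definition CL_maps ::
    "'v::real_vector set \<Rightarrow> ('v \<Rightarrow> 'v \<Rightarrow> real) \<Rightarrow> ('e::frechet_space \<Rightarrow> 'v) set" where
  "CL_maps C d = {L. linear L \<and> continuous_map euclidean (Metric_space.mtopology C d) L}"

definition compact_open_topology ::
    "'v::real_vector set \<Rightarrow> ('v \<Rightarrow> 'v \<Rightarrow> real) \<Rightarrow> ('e::frechet_space \<Rightarrow> 'v) topology" where
  "compact_open_topology C d = topology_generated_by
     {{L \<in> CL_maps C d. L ` K \<subseteq> W} | K W. compact K \<and> openin (Metric_space.mtopology C d) W}"

definition eLip :: "('v::real_vector \<Rightarrow> 'v \<Rightarrow> real) \<Rightarrow> ('e::frechet_space \<Rightarrow> 'v) \<Rightarrow> ennreal" where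
  "eLip d L = (SUP x\<in>- {0}. ennreal (d (L x) 0 / frechet_dist x 0))"

definition Lip :: "('v::real_vector \<Rightarrow> 'v \<Rightarrow> real) \<Rightarrow> ('e::frechet_space \<Rightarrow> 'v) \<Rightarrow> real" where
  "Lip d L = enn2real (eLip d L)"

definition Lip_maps ::
    "'v::real_vector set \<Rightarrow> ('v \<Rightarrow> 'v \<Rightarrow> real) \<Rightarrow> ('e::frechet_space \<Rightarrow> 'v) set" where
  "Lip_maps C d = {L. linear L \<and> range L \<subseteq> C \<and> eLip d L < \<infinity>}"

definition Lip_dist ::
    "('v::real_vector \<Rightarrow> 'v \<Rightarrow> real) \<Rightarrow> ('e::frechet_space \<Rightarrow> 'v) \<Rightarrow> ('e \<Rightarrow> 'v) \<Rightarrow> real" where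
  "Lip_dist d L H = Lip d (L - H)"

definition has_dir_deriv ::
    "'v::real_vector set \<Rightarrow> ('v \<Rightarrow> 'v \<Rightarrow> real) \<Rightarrow> ('e::frechet_space \<Rightarrow> 'v) \<Rightarrow> 'e \<Rightarrow> 'e \<Rightarrow> 'v \<Rightarrow> bool"
  where "has_dir_deriv C d f x h v \<longleftrightarrow>
    limitin (Metric_space.mtopology C d) (\<lambda>t. (1 / t) *\<^sub>R (f (x + t *\<^sub>R h) - f x)) v (at 0)"

definition dir_deriv ::
    "'v::real_vector set \<Rightarrow> ('v \<Rightarrow> 'v \<Rightarrow> real) \<Rightarrow> ('e::frechet_space \<Rightarrow> 'v) \<Rightarrow> 'e \<Rightarrow> 'e \<Rightarrow> 'v"
  where "dir_deriv C d f x h = (THE v. has_dir_deriv C d f x h v)"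

definition Keller_C1 ::
    "'v::real_vector set \<Rightarrow> ('v \<Rightarrow> 'v \<Rightarrow> real) \<Rightarrow> 'e::frechet_space set \<Rightarrow> ('e \<Rightarrow> 'v) \<Rightarrow> bool"
  where "Keller_C1 C d U f \<longleftrightarrow>
    continuous_map (top_of_set U) (Metric_space.mtopology C d) f \<and>
    (\<forall>x\<in>U. \<forall>h. \<exists>v. has_dir_deriv C d f x h v) \<and>
    continuous_map (top_of_set U) (compact_open_topology C d) (dir_deriv C d f)"

definition MC1 ::
    "'v::real_vector set \<Rightarrow> ('v \<Rightarrow> 'v \<Rightarrow> real) \<Rightarrow> 'e::frechet_space set \<Rightarrow> ('e \<Rightarrow> 'v) \<Rightarrow> bool"
  where "MC1 C d U f \<longleftrightarrow>
    Keller_C1 C d U f \<and>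
    (\<forall>x\<in>U. dir_deriv C d f x \<in> Lip_maps C d) \<and>
    continuous_map (top_of_set U) (Metric_space.mtopology (Lip_maps C d) (Lip_dist d))
      (dir_deriv C d f)"

text \<open>The recursive definition passes from the target \<open>F\<close> to \<open>L(E,F)\<close>, \<open>L(E,L(E,F))\<close>, and so on.
  To keep the type fixed, an element \<open>L\<close> of the \<open>j\<close>-th iterated space of linear maps is represented
  by the function \<open>'e list \<Rightarrow> 'f\<close> sending \<open>[h\<^sub>1, ..., h\<^sub>j]\<close> to \<open>L h\<^sub>1 ... h\<^sub>j\<close> and lists of any other
  length to \<open>0\<close>. For a map \<open>L\<close> into the space represented at stage \<open>j\<close>, \<open>push L\<close> is its
  representation at stage \<open>j + 1\<close>; \<open>pull\<close> is the inverse.\<close>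

definition embed :: "'f::zero \<Rightarrow> 'e list \<Rightarrow> 'f" where
  "embed v = (\<lambda>l. if l = [] then v else 0)"

definition push :: "('e \<Rightarrow> 'e list \<Rightarrow> 'f::zero) \<Rightarrow> 'e list \<Rightarrow> 'f" where
  "push L = (\<lambda>l. case l of [] \<Rightarrow> 0 | h # hs \<Rightarrow> L h hs)"

definition pull :: "('e list \<Rightarrow> 'f) \<Rightarrow> 'e \<Rightarrow> 'e list \<Rightarrow> 'f" where
  "pull g = (\<lambda>h hs. g (h # hs))"

definition Lip_component ::
    "('e list \<Rightarrow> 'f) set \<Rightarrow> (('e list \<Rightarrow> 'f) \<Rightarrow> ('e list \<Rightarrow> 'f) \<Rightarrow> real)
      \<Rightarrow> ('e::frechet_space list \<Rightarrow> 'f::real_vector) set" where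
  "Lip_component C d = push `
     connected_component_of_set (Metric_space.mtopology (Lip_maps C d) (Lip_dist d)) 0"

fun MC_tower ::
    "nat \<Rightarrow> ('e list \<Rightarrow> 'f) set \<Rightarrow> (('e list \<Rightarrow> 'f) \<Rightarrow> ('e list \<Rightarrow> 'f) \<Rightarrow> real)
      \<Rightarrow> 'e::frechet_space set \<Rightarrow> ('e \<Rightarrow> 'e list \<Rightarrow> 'f::real_vector) \<Rightarrow> bool" where
  "MC_tower 0 C d U f = continuous_map (top_of_set U) (Metric_space.mtopology C d) f"
| "MC_tower (Suc 0) C d U f = MC1 C d U f"
| "MC_tower (Suc (Suc k)) C d U f =
    (MC1 C d U f \<and>
     (\<forall>V x0. open V \<and> connected V \<and> V \<subseteq> U \<and> x0 \<in> V \<longrightarrow>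
        MC_tower (Suc k) (Lip_component C d) (\<lambda>g h. Lip_dist d (pull g) (pull h)) V
          (\<lambda>x. push (dir_deriv C d f x - dir_deriv C d f x0))))"

definition MC_on ::
    "nat \<Rightarrow> 'e::frechet_space set \<Rightarrow> ('e \<Rightarrow> 'f::frechet_space) \<Rightarrow> bool" where
  "MC_on k U f \<longleftrightarrow> open U \<and>
     MC_tower k (range embed) (\<lambda>g h. frechet_dist (g []) (h [])) U (\<lambda>x. embed (f x))"

type_synonym ('m, 'e) chart = "'m set \<times> ('m \<Rightarrow> 'e)"

definition is_chart :: "('m::topological_space, 'e::frechet_space) chart \<Rightarrow> bool" where
  "is_chart c \<longleftrightarrow> open (fst c) \<and> open (snd c ` fst c) \<and>
     homeomorphism (fst c) (snd c ` fst c) (snd c) (inv_into (fst c) (snd c))"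

text \<open>The domain and the local expression of a map \<open>\<phi>\<close> in the charts \<open>c\<close> and \<open>d\<close>. For \<open>\<phi> = id\<close> it
  is the transition map.\<close>

definition loc_dom :: "('p, 'e) chart \<Rightarrow> ('q, 'f) chart \<Rightarrow> ('p \<Rightarrow> 'q) \<Rightarrow> 'e set" where
  "loc_dom c d \<phi> = snd c ` (fst c \<inter> \<phi> -` fst d)"

definition loc_rep :: "('p, 'e) chart \<Rightarrow> ('q, 'f) chart \<Rightarrow> ('p \<Rightarrow> 'q) \<Rightarrow> 'e \<Rightarrow> 'f" where
  "loc_rep c d \<phi> = snd d \<circ> \<phi> \<circ> inv_into (fst c) (snd c)"

definition MC_manifold ::
    "nat \<Rightarrow> ('m::{t2_space,second_countable_topology}, 'e::frechet_space) chart set \<Rightarrow> bool" where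
  "MC_manifold k \<A> \<longleftrightarrow> (\<forall>c\<in>\<A>. is_chart c) \<and> (\<Union>c\<in>\<A>. fst c) = UNIV \<and>
     (\<forall>c\<in>\<A>. \<forall>d\<in>\<A>. MC_on k (loc_dom c d id) (loc_rep c d id))"

text \<open>The charts of the manifold: the maximal atlas determined by \<open>\<A>\<close>.\<close>

definition charts ::
    "nat \<Rightarrow> ('m::topological_space, 'e::frechet_space) chart set \<Rightarrow> ('m, 'e) chart set" where
  "charts k \<A> = {c. is_chart c \<and> (\<forall>d\<in>\<A>.
     MC_on k (loc_dom c d id) (loc_rep c d id) \<and> MC_on k (loc_dom d c id) (loc_rep d c id))}"

definition charts_at ::
    "nat \<Rightarrow> ('m::topological_space, 'e::frechet_space) chart set \<Rightarrow> 'm \<Rightarrow> ('m, 'e) chart set" where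
  "charts_at k \<A> p = {c \<in> charts k \<A>. p \<in> fst c}"

definition product_atlas ::
    "('m, 'e) chart set \<Rightarrow> ('a, 'b) chart set \<Rightarrow> ('m \<times> 'a, 'e \<times> 'b) chart set" where
  "product_atlas \<A> \<B> = (\<lambda>(c, d). (fst c \<times> fst d, map_prod (snd c) (snd d))) ` (\<A> \<times> \<B>)"

definition MC_map ::
    "nat \<Rightarrow> ('p::topological_space, 'e::frechet_space) chart set
      \<Rightarrow> ('q::topological_space, 'f::frechet_space) chart set \<Rightarrow> ('p \<Rightarrow> 'q) \<Rightarrow> bool" where
  "MC_map k \<A> \<B> \<phi> \<longleftrightarrow> continuous_on UNIV \<phi> \<and>
     (\<forall>c\<in>charts k \<A>. \<forall>d\<in>charts k \<B>. MC_on k (loc_dom c d \<phi>) (loc_rep c d \<phi>))"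

abbreviation fderiv :: "('e::frechet_space \<Rightarrow> 'f::frechet_space) \<Rightarrow> 'e \<Rightarrow> 'e \<Rightarrow> 'f" where
  "fderiv \<equiv> dir_deriv UNIV frechet_dist"

text \<open>A tangent vector at \<open>p\<close> is the family of its representatives in all charts around \<open>p\<close>, related
  by the derivatives of the transition maps (and \<open>0\<close> at the irrelevant charts). Thus the linear
  structure of a tangent space is pointwise, and evaluation at any chart around \<open>p\<close> is to be an
  isomorphism onto the model space.\<close>

definition tangent_space ::
    "nat \<Rightarrow> ('m::topological_space, 'e::frechet_space) chart set \<Rightarrow> 'm \<Rightarrow> (('m, 'e) chart \<Rightarrow> 'e) set"
  where "tangent_space k \<A> p = {\<xi>.
    (\<forall>c. c \<notin> charts_at k \<A> p \<longrightarrow> \<xi> c = 0) \<and>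
    (\<forall>c\<in>charts_at k \<A> p. \<forall>d\<in>charts_at k \<A> p. \<xi> d = fderiv (loc_rep c d id) (snd c p) (\<xi> c))}"

definition tangent_topology ::
    "nat \<Rightarrow> ('m::topological_space, 'e::frechet_space) chart set \<Rightarrow> 'm
      \<Rightarrow> (('m, 'e) chart \<Rightarrow> 'e) topology"
  where "tangent_topology k \<A> p = topology_generated_by
    {{\<xi> \<in> tangent_space k \<A> p. \<xi> c \<in> W} | c W. c \<in> charts_at k \<A> p \<and> open W}"

definition tangent_map ::
    "nat \<Rightarrow> ('p::topological_space, 'e::frechet_space) chart set
      \<Rightarrow> ('q::topological_space, 'f::frechet_space) chart set \<Rightarrow> ('p \<Rightarrow> 'q) \<Rightarrow> 'p
      \<Rightarrow> (('p, 'e) chart \<Rightarrow> 'e) \<Rightarrow> (('q, 'f) chart \<Rightarrow> 'f)"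
  where "tangent_map k \<A> \<B> \<phi> p \<xi> = (THE \<eta>. \<eta> \<in> tangent_space k \<B> (\<phi> p) \<and>
    (\<forall>c\<in>charts_at k \<A> p. \<forall>d\<in>charts_at k \<B> (\<phi> p).
       \<eta> d = fderiv (loc_rep c d \<phi>) (snd c p) (\<xi> c)))"

definition submanifold_chart ::
    "nat \<Rightarrow> ('q::topological_space, 'f::frechet_space) chart set \<Rightarrow> 'q set
      \<Rightarrow> ('q, 'f) chart \<Rightarrow> 'f set \<Rightarrow> 'f set \<Rightarrow> bool"
  where "submanifold_chart k \<B> S c F1 F2 \<longleftrightarrow>
    c \<in> charts k \<B> \<and> topological_direct_sum euclidean F1 F2 \<and>
    (\<exists>G1 G2. openin (top_of_set F1) G1 \<and> 0 \<in> G1 \<and> openin (top_of_set F2) G2 \<and> 0 \<in> G2 \<and>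
       snd c ` fst c = {u + v | u v. u \<in> G1 \<and> v \<in> G2} \<and>
       snd c ` (S \<inter> fst c) = G1)"

definition MC_submanifold ::
    "nat \<Rightarrow> ('q::topological_space, 'f::frechet_space) chart set \<Rightarrow> 'q set \<Rightarrow> bool" where
  "MC_submanifold k \<B> S \<longleftrightarrow>
     (\<forall>p\<in>S. \<exists>c F1 F2. p \<in> fst c \<and> submanifold_chart k \<B> S c F1 F2)"

definition has_codimension ::
    "nat \<Rightarrow> ('q::topological_space, 'f::frechet_space) chart set \<Rightarrow> 'q set \<Rightarrow> nat \<Rightarrow> bool" where
  "has_codimension k \<B> S m \<longleftrightarrow>
     (\<forall>p\<in>S. \<exists>c F1 F2. p \<in> fst c \<and> submanifold_chart k \<B> S c F1 F2 \<and> has_dimension F2 m)"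

definition sub_tangent_space ::
    "nat \<Rightarrow> ('q::topological_space, 'f::frechet_space) chart set \<Rightarrow> 'q set \<Rightarrow> 'q
      \<Rightarrow> (('q, 'f) chart \<Rightarrow> 'f) set"
  where "sub_tangent_space k \<B> S p = {\<xi> \<in> tangent_space k \<B> p.
    \<exists>c F1 F2. p \<in> fst c \<and> submanifold_chart k \<B> S c F1 F2 \<and> \<xi> c \<in> F1}"

definition transversal ::
    "nat \<Rightarrow> ('p::topological_space, 'e::frechet_space) chart set
      \<Rightarrow> ('q::topological_space, 'f::frechet_space) chart set \<Rightarrow> 'q set \<Rightarrow> ('p \<Rightarrow> 'q) \<Rightarrow> bool"
  where "transversal k \<A> \<B> S \<phi> \<longleftrightarrow> MC_map k \<A> \<B> \<phi> \<and>
    (\<phi> -` S = {} \<or>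
     (\<forall>p \<in> \<phi> -` S.
        {\<eta> + \<zeta> | \<eta> \<zeta>. \<eta> \<in> tangent_map k \<A> \<B> \<phi> p ` tangent_space k \<A> p \<and>
                  \<zeta> \<in> sub_tangent_space k \<B> S (\<phi> p)} = tangent_space k \<B> (\<phi> p) \<and>
        splits_in (tangent_topology k \<A> p)
          {\<xi> \<in> tangent_space k \<A> p. tangent_map k \<A> \<B> \<phi> p \<xi> \<in> sub_tangent_space k \<B> S (\<phi> p)}))"

definition residual :: "'m::topological_space set \<Rightarrow> bool" where
  "residual R \<longleftrightarrow> (\<exists>\<G>. countable \<G> \<and> (\<forall>G\<in>\<G>. open G \<and> closure G = UNIV) \<and> \<Inter>\<G> \<subseteq> R)"

end

theory Submission
  imports Defs
begin

text \<open>The metric of a Frechet space is bounded: along a ray \<open>t x\<close> it tends to \<open>2\<^sup>-\<^sup>i\<close>, where \<open>i\<close> is the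
  least index with \<open>\<parallel>x\<parallel>\<^sub>i \<noteq> 0\<close>. Hence a linear map whose Lipschitz constant is below \<open>2\<^sup>-\<^sup>i\<close> takes
  values in the kernel of the \<open>i\<close>-th seminorm, the spaces of Lipschitz linear maps are totally
  disconnected, and a map of class \<open>MC\<^sup>k\<close> with \<open>k \<ge> 1\<close> is the same thing as a locally affine map with
  Lipschitz linear parts. This replaces Sard's theorem: near a point of \<open>\<phi>\<^sup>-\<^sup>1(S)\<close> the map is, in
  charts, \<open>(x, a) \<mapsto> y\<^sub>0 + L x + H a\<close> with \<open>S\<close> equal to a closed subspace \<open>F\<^sub>1\<close>, and either
  \<open>F\<^sub>1 + range H\<close> is everything, so that all partial maps are transversal there, or the partial maps
  can meet \<open>S\<close> only for \<open>x\<close> in the affine subspace \<open>L x \<in> F\<^sub>1 + range H\<close>. The latter is closed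
  because \<open>range H\<close> is finite-dimensional, and by transversality of \<open>\<phi>\<close> it is proper, hence
  nowhere dense. Countably many such neighbourhoods cover \<open>\<phi>\<^sup>-\<^sup>1(S)\<close>.\<close>

subsection \<open>The metric of a Frechet space\<close>

text \<open>Total disconnectedness does not give local affinity at once: continuity of the
  derivative makes it locally constant only modulo the kernel of one seminorm, on a neighbourhood
  that depends on that seminorm. The way out is to restrict to segments. Along a segment inside
  \<open>U\<close>, each seminorm of the variation of the derivative is a locally constant function
  on an interval, hence zero, and the ball swept out by such segments depends on \<open>U\<close>
  alone. Constancy along a segment then integrates to the affine formula.

  In the recursive definition of the higher classes the component of 0 in the first operator space
  is a point, so every later stage concerns the zero map into \<open>{0}\<close>.

  The linear part of an affine germ is the same at all nearby points, so one test at a base point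
  decides about every partial map through a whole box.

  Finite dimension of \<open>A\<close> enters twice: it makes the image of \<open>range H\<close>
  modulo the tangent space of \<open>S\<close> closed, and it makes every subspace of a tangent
  space of \<open>A\<close> split. Both rest on the continuity of coordinate functionals.\<close>

abbreviation frechet_norm :: "'a::frechet_space \<Rightarrow> real" where
  "frechet_norm x \<equiv> frechet_dist x 0"

lemma frechet_dist_translation: "frechet_dist x y = frechet_norm (x - y)"
  by (simp add: frechet_dist_def)

text \<open>The first bound makes the tail of the supremum small whatever the point is; the second
  handles the finitely many terms before it.\<close>

lemma frechet_summand_le:
  fixes p :: real assumes "0 \<le> p"
  shows "1 / 2 ^ n * (p / (1 + p)) \<le> 1 / 2 ^ n" "1 / 2 ^ n * (p / (1 + p)) \<le> p"
proof -
  have 1: "p / (1 + p) \<le> 1" using assms by (simp add: divide_simps)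
  have 2: "p / (1 + p) \<le> p" using assms mult_left_mono[of 0 p p] by (simp add: divide_simps algebra_simps)
  show "1 / 2 ^ n * (p / (1 + p)) \<le> 1 / 2 ^ n"
    using mult_left_mono[OF 1, of "1 / 2 ^ n"] by simp
  have "1 / 2 ^ n * (p / (1 + p)) \<le> 1 * (p / (1 + p))"
    using assms by (intro mult_right_mono) auto
  with 2 show "1 / 2 ^ n * (p / (1 + p)) \<le> p" by simp
qed

lemma frechet_dist_bdd:
  "bdd_above (range (\<lambda>n. 1 / 2 ^ n * (fseminorm n x / (1 + fseminorm n x))))"
proof (rule bdd_aboveI2)
  fix n show "1 / 2 ^ n * (fseminorm n x / (1 + fseminorm n x)) \<le> 1"
    by (rule order_trans[OF frechet_summand_le(1)]) auto
qed

lemma frechet_norm_ge: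
  "1 / 2 ^ n * (fseminorm n x / (1 + fseminorm n x)) \<le> frechet_norm (x::'a::frechet_space)"
  unfolding frechet_dist_def diff_0_right by (rule cSUP_upper[OF _ frechet_dist_bdd]) simp

lemma frechet_norm_leI:
  assumes "\<And>n. 1 / 2 ^ n * (fseminorm n x / (1 + fseminorm n x)) \<le> B"
  shows "frechet_norm (x::'a::frechet_space) \<le> B"
  unfolding frechet_dist_def diff_0_right by (rule cSUP_least) (use assms in auto)

lemma frechet_norm_le_1: "frechet_norm x \<le> 1"
  by (rule frechet_norm_leI, rule order_trans[OF frechet_summand_le(1)]) auto

lemma frechet_norm_nonneg [simp]: "0 \<le> frechet_norm x"
  by (rule order_trans[OF _ frechet_norm_ge[of 0]]) auto

lemma frechet_norm_zero [simp]: "frechet_norm (0::'a::frechet_space) = 0"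
  by (simp add: frechet_dist_def)

lemma frechet_norm_minus [simp]: "frechet_norm (- x) = frechet_norm x"
  by (simp add: frechet_dist_def fseminorm_minus)

lemma frechet_norm_eq_0_iff [simp]: "frechet_norm x = 0 \<longleftrightarrow> x = 0"
proof
  assume 0: "frechet_norm x = 0"
  have "fseminorm n x = 0" for n
  proof (rule ccontr)
    assume "fseminorm n x \<noteq> 0"
    then have "0 < fseminorm n x"
      using fseminorm_nonneg[of n x] by linarith
    then have "0 < 1 / 2 ^ n * (fseminorm n x / (1 + fseminorm n x))"
      by simp
    with frechet_norm_ge[of n x] 0 show False by simp
  qed
  then show "x = 0" by (simp add: fseminorm_separating)
qed simp

text \<open>The function t / (1 + t) is increasing and subadditive for t >= 0, so every single term
  of the supremum obeys the triangle inequality.\<close>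

lemma frechet_norm_triangle: "frechet_norm (x + y) \<le> frechet_norm x + frechet_norm y"
proof (rule frechet_norm_leI)
  fix n
  define a b c where "a = fseminorm n x" and "b = fseminorm n y" and "c = fseminorm n (x + y)"
  have nn: "0 \<le> a" "0 \<le> b" "0 \<le> c" by (simp_all add: a_def b_def c_def)
  have c: "c \<le> a + b" by (simp add: a_def b_def c_def fseminorm_triangle)
  have "c / (1 + c) \<le> (a + b) / (1 + (a + b))"
    using nn c by (simp add: divide_simps algebra_simps)
  also have "\<dots> = a / (1 + (a + b)) + b / (1 + (a + b))" by (simp add: add_divide_distrib)
  also have "\<dots> \<le> a / (1 + a) + b / (1 + b)"
    using nn by (intro add_mono divide_left_mono) auto
  finally have "1 / 2 ^ n * (c / (1 + c)) \<le> 1 / 2 ^ n * (a / (1 + a) + b / (1 + b))"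
    by (intro mult_left_mono) auto
  then have "1 / 2 ^ n * (c / (1 + c)) \<le> 1 / 2 ^ n * (a / (1 + a)) + 1 / 2 ^ n * (b / (1 + b))"
    by (simp only: distrib_left)
  then show "1 / 2 ^ n * (fseminorm n (x + y) / (1 + fseminorm n (x + y)))
      \<le> frechet_norm x + frechet_norm y"
    using frechet_norm_ge[of n x] frechet_norm_ge[of n y] unfolding a_def b_def c_def by linarith
qed

text \<open>Because of the weights, the terms with large index are below e / 2 at every point, so
  only finitely many seminorms need to be controlled.\<close>

lemma frechet_norm_less_if_small:
  fixes e :: real assumes "0 < e"
  obtains n d where "0 < d"
    "\<And>x::'a::frechet_space. (\<And>i. i \<le> n \<Longrightarrow> fseminorm i x < d) \<Longrightarrow> frechet_norm x < e"
proof -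
  obtain n where n: "(1 / 2) ^ n < e / 2"
    using real_arch_pow_inv[of "e / 2" "1 / 2"] assms by auto
  show ?thesis
  proof (rule that[of "e / 2" n])
    fix x :: 'a assume x: "\<And>i. i \<le> n \<Longrightarrow> fseminorm i x < e / 2"
    have "frechet_norm x \<le> e / 2"
    proof (rule frechet_norm_leI)
      fix i show "1 / 2 ^ i * (fseminorm i x / (1 + fseminorm i x)) \<le> e / 2"
      proof (cases "i \<le> n")
        case True
        then show ?thesis
          using x[of i] by (intro order_trans[OF frechet_summand_le(2)]) simp_all
      next
        case False
        then have "(1 / 2 :: real) ^ i \<le> (1 / 2) ^ n" by (intro power_decreasing) auto
        then show ?thesis
          using n by (intro order_trans[OF frechet_summand_le(1)]) (simp_all add: power_divide)
      qed
    qed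
    then show "frechet_norm x < e" using assms by simp
  qed (use assms in simp)
qed

lemma fseminorm_less_if_small:
  fixes e :: real assumes "0 < e"
  obtains d where "0 < d" "\<And>x::'a::frechet_space. frechet_norm x < d \<Longrightarrow> \<forall>i\<le>n. fseminorm i x < e"
\<comment> \<open>The value of the \<open>n\<close>-th term when its seminorm equals
  \<open>e\<close>. The weights decrease with the index, so the same number serves all i <= n, and t
  / (1 + t) can be inverted.\<close>
proof (rule that[of "1 / 2 ^ n * (e / (1 + e))"])
  fix x :: 'a assume x: "frechet_norm x < 1 / 2 ^ n * (e / (1 + e))"
  show "\<forall>i\<le>n. fseminorm i x < e"
  proof (intro allI impI)
    fix i assume i: "i \<le> n"
    have "1 / 2 ^ n * (fseminorm i x / (1 + fseminorm i x)) \<le> 1 / 2 ^ i * (fseminorm i x / (1 + fseminorm i x))"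
      using i by (intro mult_right_mono) (auto simp: frac_le)
    also have "\<dots> < 1 / 2 ^ n * (e / (1 + e))"
      using frechet_norm_ge[of i x] x by simp
    finally have "fseminorm i x / (1 + fseminorm i x) < e / (1 + e)"
      by (subst (asm) mult_less_cancel_left_pos) simp_all
    then show "fseminorm i x < e"
      using assms by (simp add: divide_simps algebra_simps add_pos_nonneg split: if_splits)
  qed
qed (use assms in simp)

interpretation frechet: Metric_space UNIV "frechet_dist :: 'a::frechet_space \<Rightarrow> 'a \<Rightarrow> real"
proof
  fix x y z :: 'a
  show "0 \<le> frechet_dist x y" by (simp add: frechet_dist_translation[of x y])
  show "frechet_dist x y = frechet_dist y x"
    using frechet_norm_minus[of "x - y"]
    by (simp add: frechet_dist_translation[of x y] frechet_dist_translation[of y x])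
  show "frechet_dist x y = 0 \<longleftrightarrow> x = y"
    by (simp add: frechet_dist_translation[of x y])
  show "frechet_dist x z \<le> frechet_dist x y + frechet_dist y z"
    using frechet_norm_triangle[of "x - y" "y - z"]
    by (simp add: frechet_dist_translation[of x y] frechet_dist_translation[of y z] frechet_dist_translation[of x z])
qed

section \<open>The topology in terms of the metric\<close>

lemma open_frechet_dist:
  "open (U::'a::frechet_space set) \<longleftrightarrow> (\<forall>x\<in>U. \<exists>e>0. \<forall>y. frechet_norm (y - x) < e \<longrightarrow> y \<in> U)"
proof
  assume U: "open U"
  show "\<forall>x\<in>U. \<exists>e>0. \<forall>y. frechet_norm (y - x) < e \<longrightarrow> y \<in> U"
  proof
    fix x assume "x \<in> U"
    with U obtain n e where ne: "e > 0" "\<forall>y. (\<forall>i\<le>n. fseminorm i (y - x) < e) \<longrightarrow> y \<in> U"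
      using open_fseminormD by blast
    obtain d where "0 < d" "\<And>x::'a. frechet_norm x < d \<Longrightarrow> \<forall>i\<le>n. fseminorm i x < e"
      using fseminorm_less_if_small[OF ne(1)] by metis
    with ne show "\<exists>e>0. \<forall>y. frechet_norm (y - x) < e \<longrightarrow> y \<in> U" by blast
  qed
next
  assume *: "\<forall>x\<in>U. \<exists>e>0. \<forall>y. frechet_norm (y - x) < e \<longrightarrow> y \<in> U"
  show "open U" unfolding open_fseminorm
  proof
    fix x assume "x \<in> U"
    with * obtain e where e: "e > 0" "\<forall>y. frechet_norm (y - x) < e \<longrightarrow> y \<in> U" by blast
    obtain n d where "0 < d" "\<And>x::'a. (\<And>i. i \<le> n \<Longrightarrow> fseminorm i x < d) \<Longrightarrow> frechet_norm x < e"
      using frechet_norm_less_if_small[OF e(1)] by metis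
    with e show "\<exists>n. \<exists>e>0. \<forall>y. (\<forall>i\<le>n. fseminorm i (y - x) < e) \<longrightarrow> y \<in> U" by blast
  qed
qed

text \<open>As a simp rule it turns \<open>limitin\<close> and \<open>continuous_map\<close> for the
  distinguished metric into ordinary limits and continuity.\<close>

lemma mtopology_frechet [simp]:
  "Metric_space.mtopology UNIV (frechet_dist :: 'a::frechet_space \<Rightarrow> 'a \<Rightarrow> real) = euclidean"
proof -
  have "frechet.mball x r \<subseteq> U \<longleftrightarrow> (\<forall>y. frechet_norm (y - x) < r \<longrightarrow> y \<in> U)" for x :: 'a and r U
    unfolding subset_iff frechet.in_mball frechet.commute[of x] by (subst frechet_dist_translation) simp
  then show ?thesis
    unfolding topology_eq frechet.openin_mtopology open_openin[symmetric] open_frechet_dist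
    by (simp add: Ball_def)
qed

lemma eventually_nhds_frechet:
  "eventually P (nhds (x::'a::frechet_space)) \<longleftrightarrow> (\<exists>e>0. \<forall>y. frechet_norm (y - x) < e \<longrightarrow> P y)"
proof
  assume "eventually P (nhds x)"
  then obtain U where "open U" "x \<in> U" "\<forall>y\<in>U. P y" by (auto simp: eventually_nhds)
  then show "\<exists>e>0. \<forall>y. frechet_norm (y - x) < e \<longrightarrow> P y" by (metis open_frechet_dist)
next
  assume "\<exists>e>0. \<forall>y. frechet_norm (y - x) < e \<longrightarrow> P y"
  then obtain e where e: "e > 0" "\<forall>y. frechet_norm (y - x) < e \<longrightarrow> P y" by blast
  have "open {y. frechet_norm (y - x) < e}"
  proof -
    have "\<exists>d>0. \<forall>z. frechet_norm (z - y) < d \<longrightarrow> frechet_norm (z - x) < e"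
      if "frechet_norm (y - x) < e" for y
    proof (intro exI[of _ "e - frechet_norm (y - x)"] conjI allI impI)
      fix z assume "frechet_norm (z - y) < e - frechet_norm (y - x)"
      then show "frechet_norm (z - x) < e"
        using frechet_norm_triangle[of "z - y" "y - x"] by simp
    qed (use that in simp)
    then show ?thesis by (simp add: open_frechet_dist)
  qed
  with e show "eventually P (nhds x)"
    unfolding eventually_nhds by (intro exI[of _ "{y. frechet_norm (y - x) < e}"]) simp
qed

lemma tendsto_frechet_norm_iff:
  "(f \<longlongrightarrow> (l::'a::frechet_space)) F \<longleftrightarrow> ((\<lambda>x. frechet_norm (f x - l)) \<longlongrightarrow> 0) F"
  (is "?A \<longleftrightarrow> ?B")
proof -
  have "?A \<longleftrightarrow> limitin frechet.mtopology f l F" by simp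
  also have "\<dots> \<longleftrightarrow> (\<forall>e>0. \<forall>\<^sub>F x in F. frechet_norm (f x - l) < e)"
    by (subst frechet.limitin_metric) (simp add: frechet_dist_translation[of _ l])
  also have "\<dots> \<longleftrightarrow> ?B"
    by (simp add: tendsto_iff)
  finally show ?thesis .
qed

lemma tendsto_fseminorm_iff:
  "(f \<longlongrightarrow> (l::'a::frechet_space)) F \<longleftrightarrow> (\<forall>n. ((\<lambda>x. fseminorm n (f x - l)) \<longlongrightarrow> 0) F)"
proof
  assume f: "(f \<longlongrightarrow> l) F"
  show "\<forall>n. ((\<lambda>x. fseminorm n (f x - l)) \<longlongrightarrow> 0) F"
  proof (intro allI tendstoI)
    fix n and e :: real assume "e > 0"
    then obtain d where d: "0 < d" "\<And>x::'a. frechet_norm x < d \<Longrightarrow> \<forall>i\<le>n. fseminorm i x < e"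
      using fseminorm_less_if_small by metis
    have "\<forall>\<^sub>F x in F. frechet_norm (f x - l) < d"
      using f[unfolded tendsto_frechet_norm_iff, THEN tendstoD, OF d(1)] by simp
    then show "\<forall>\<^sub>F x in F. dist (fseminorm n (f x - l)) 0 < e"
      by eventually_elim (use d(2) in auto)
  qed
next
  assume f: "\<forall>n. ((\<lambda>x. fseminorm n (f x - l)) \<longlongrightarrow> 0) F"
  show "(f \<longlongrightarrow> l) F" unfolding tendsto_frechet_norm_iff
  proof (rule tendstoI)
    fix e :: real assume "e > 0"
    then obtain n d where d: "0 < d" "\<And>x::'a. (\<And>i. i \<le> n \<Longrightarrow> fseminorm i x < d) \<Longrightarrow> frechet_norm x < e"
      using frechet_norm_less_if_small by metis
    have "\<forall>\<^sub>F x in F. fseminorm i (f x - l) < d" for i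
      using f[rule_format, THEN tendstoD, OF d(1)] by simp
    then have "\<forall>\<^sub>F x in F. \<forall>i\<in>{..n}. fseminorm i (f x - l) < d"
      by (intro eventually_ball_finite) auto
    then show "\<forall>\<^sub>F x in F. dist (frechet_norm (f x - l)) 0 < e"
      by eventually_elim (use d(2) in auto)
  qed
qed

text \<open>Hausdorff separation makes limits, and hence directional derivatives, unique.\<close>

instance frechet_space \<subseteq> t2_space
proof
  fix x y :: 'a assume "x \<noteq> y"
  then show "\<exists>U V. open U \<and> open V \<and> x \<in> U \<and> y \<in> V \<and> U \<inter> V = {}"
    using frechet.Hausdorff_space_mtopology[unfolded mtopology_frechet Hausdorff_space_def]
    by (auto simp: disjnt_def)
qed

section \<open>Limits of sums and multiples, and the metric of a product\<close>

lemma tendsto_add_frechet: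
  fixes f g :: "'b \<Rightarrow> 'a::frechet_space"
  assumes "(f \<longlongrightarrow> a) F" "(g \<longlongrightarrow> b) F"
  shows "((\<lambda>x. f x + g x) \<longlongrightarrow> a + b) F"
  unfolding tendsto_frechet_norm_iff
proof (rule Lim_null_comparison)
  show "((\<lambda>x. frechet_norm (f x - a) + frechet_norm (g x - b)) \<longlongrightarrow> 0) F"
    using tendsto_add[OF assms[unfolded tendsto_frechet_norm_iff]] by simp
  show "\<forall>\<^sub>F x in F. norm (frechet_norm (f x + g x - (a + b))) \<le> frechet_norm (f x - a) + frechet_norm (g x - b)"
  proof (rule always_eventually, rule allI)
    fix x
    show "norm (frechet_norm (f x + g x - (a + b))) \<le> frechet_norm (f x - a) + frechet_norm (g x - b)"
      using frechet_norm_triangle[of "f x - a" "g x - b"] by (simp add: algebra_simps)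
  qed
qed

lemma tendsto_minus_frechet:
  fixes f :: "'b \<Rightarrow> 'a::frechet_space"
  assumes "(f \<longlongrightarrow> a) F"
  shows "((\<lambda>x. - f x) \<longlongrightarrow> - a) F"
proof -
  have "frechet_norm (- f x - - a) = frechet_norm (f x - a)" for x
    using frechet_norm_minus[of "f x - a"] by (simp add: algebra_simps)
  then show ?thesis
    using assms by (simp add: tendsto_frechet_norm_iff)
qed

lemma tendsto_diff_frechet:
  fixes f g :: "'b \<Rightarrow> 'a::frechet_space"
  assumes "(f \<longlongrightarrow> a) F" "(g \<longlongrightarrow> b) F"
  shows "((\<lambda>x. f x - g x) \<longlongrightarrow> a - b) F"
  using tendsto_add_frechet[OF assms(1) tendsto_minus_frechet[OF assms(2)]] by simp

lemma tendsto_scaleR_frechet: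
  fixes h :: "'a::frechet_space"
  assumes "(t \<longlongrightarrow> s) F"
  shows "((\<lambda>x. t x *\<^sub>R h) \<longlongrightarrow> s *\<^sub>R h) F"
  unfolding tendsto_fseminorm_iff
proof
  fix n
  have "((\<lambda>x. \<bar>t x - s\<bar> * fseminorm n h) \<longlongrightarrow> \<bar>s - s\<bar> * fseminorm n h) F"
    by (intro tendsto_intros assms)
  then show "((\<lambda>x. fseminorm n (t x *\<^sub>R h - s *\<^sub>R h)) \<longlongrightarrow> 0) F"
    by (simp add: scaleR_left_diff_distrib[symmetric] fseminorm_scaleR)
qed

text \<open>Each seminorm of a pair is the seminorm of one of its components, and t / (1 + t) is
  increasing, so the supremum of maxima is the maximum of the suprema.\<close>

lemma frechet_norm_Pair:
  "frechet_norm ((x, y)::'a::frechet_space \<times> 'b::frechet_space) = max (frechet_norm x) (frechet_norm y)"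
proof (rule antisym)
  show "frechet_norm (x, y) \<le> max (frechet_norm x) (frechet_norm y)"
  proof (rule frechet_norm_leI)
    fix n
    have "fseminorm n (x, y) = fseminorm n x \<or> fseminorm n (x, y) = fseminorm n y"
      by (auto simp: fseminorm_prod_def max_def)
    then show "1 / 2 ^ n * (fseminorm n (x, y) / (1 + fseminorm n (x, y))) \<le> max (frechet_norm x) (frechet_norm y)"
      using frechet_norm_ge[of n x] frechet_norm_ge[of n y]
      by (metis max.coboundedI1 max.coboundedI2)
  qed
  have mono: "p / (1 + p) \<le> q / (1 + q)" if "0 \<le> p" "p \<le> q" for p q :: real
    using that by (simp add: frac_le_eq divide_le_0_iff algebra_simps)
  have le: "frechet_norm u \<le> frechet_norm v" if "\<And>n. fseminorm n u \<le> fseminorm n v"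
    for u :: "'u::frechet_space" and v :: "'v::frechet_space"
  proof (rule frechet_norm_leI)
    fix n
    have "1 / 2 ^ n * (fseminorm n u / (1 + fseminorm n u)) \<le> 1 / 2 ^ n * (fseminorm n v / (1 + fseminorm n v))"
      by (intro mult_left_mono mono that) simp_all
    also have "\<dots> \<le> frechet_norm v" by (rule frechet_norm_ge)
    finally show "1 / 2 ^ n * (fseminorm n u / (1 + fseminorm n u)) \<le> frechet_norm v" .
  qed
  have "frechet_norm x \<le> frechet_norm (x, y)" "frechet_norm y \<le> frechet_norm (x, y)"
    by (rule le, simp add: fseminorm_prod_def)+
  then show "max (frechet_norm x) (frechet_norm y) \<le> frechet_norm (x, y)" by simp
qed

lemma fseminorm_eq_0_if_bounded_multiples:
  assumes "\<And>t. frechet_norm (t *\<^sub>R x) \<le> K" "K < 1 / 2 ^ n"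
  shows "fseminorm n (x::'a::frechet_space) = 0"
proof (rule ccontr)
  assume "fseminorm n x \<noteq> 0"
  then have p: "0 < fseminorm n x" using fseminorm_nonneg[of n x] by linarith
  define c where "c = K * 2 ^ n"
  have c: "c < 1" using assms(2) by (simp add: c_def pos_less_divide_eq)
  have scale: "r \<le> c" if "1 / 2 ^ n * r \<le> K" for r
    using that by (simp add: c_def pos_divide_le_eq)
  \<comment> \<open>With this multiple the \<open>n\<close>-th seminorm is q = 1 / (1 - c), for
    which q / (1 + q) = 1 / (2 - c). This exceeds c because (1 - c)^2 > 0.\<close>
  define t where "t = (1 / (1 - c)) / fseminorm n x"
  define q where "q = fseminorm n (t *\<^sub>R x)"
  have "t * fseminorm n x = 1 / (1 - c)" "0 \<le> t" using p c by (simp_all add: t_def)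
  then have q: "q = 1 / (1 - c)" by (simp add: q_def fseminorm_scaleR)
  then have q0: "0 \<le> q" "q * (1 - c) = 1" using c by simp_all
  have "1 / 2 ^ n * (q / (1 + q)) \<le> K"
    unfolding q_def using order_trans[OF frechet_norm_ge assms(1)] .
  then have "q / (1 + q) \<le> c"
    using scale[of "q / (1 + q)"] by simp
  then have "q \<le> c * (1 + q)" using q0 by (simp add: pos_divide_le_eq)
  then show False using q0 c by (simp add: algebra_simps)
qed

subsection \<open>Lipschitz linear maps\<close>

text \<open>The notion of \<open>Lip_maps\<close> for the undecorated target space, with an explicit
  real constant in place of an extended real supremum.\<close>

definition Lip_linear :: "('e::frechet_space \<Rightarrow> 'f::frechet_space) \<Rightarrow> bool" where
  "Lip_linear L \<longleftrightarrow> linear L \<and> (\<exists>K. \<forall>x. frechet_norm (L x) \<le> K * frechet_norm x)"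

lemma Lip_linear_linear: "Lip_linear L \<Longrightarrow> linear L"
  by (simp add: Lip_linear_def)

lemma Lip_linearE:
  assumes "Lip_linear L"
  obtains K where "0 \<le> K" "\<And>x. frechet_norm (L x) \<le> K * frechet_norm x"
proof -
  obtain K where K: "\<And>x. frechet_norm (L x) \<le> K * frechet_norm x"
    using assms by (auto simp: Lip_linear_def)
  have "frechet_norm (L x) \<le> \<bar>K\<bar> * frechet_norm x" for x
    using K[of x] mult_right_mono[OF abs_ge_self[of K] frechet_norm_nonneg[of x]] by linarith
  then show ?thesis using that[of "\<bar>K\<bar>"] by simp
qed

lemma Lip_linear_ident: "Lip_linear (\<lambda>x. x)"
  unfolding Lip_linear_def by (intro conjI linear_ident exI[of _ 1]) simp

lemma Lip_linear_compose:
  assumes "Lip_linear L" "Lip_linear H"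
  shows "Lip_linear (H \<circ> L)"
proof -
  obtain K where K: "0 \<le> K" "\<And>x. frechet_norm (L x) \<le> K * frechet_norm x"
    using Lip_linearE[OF assms(1)] by metis
  obtain K' where K': "0 \<le> K'" "\<And>x. frechet_norm (H x) \<le> K' * frechet_norm x"
    using Lip_linearE[OF assms(2)] by metis
  have "frechet_norm (H (L x)) \<le> K' * K * frechet_norm x" for x
    using K'(2)[of "L x"] mult_left_mono[OF K(2)[of x] K'(1)] by simp
  then show ?thesis
    using linear_compose[of L H] assms by (auto simp: Lip_linear_def)
qed

lemma Lip_linear_map_prod:
  assumes "Lip_linear L" "Lip_linear H"
  shows "Lip_linear (map_prod L H)"
proof -
  obtain K where K: "0 \<le> K" "\<And>x. frechet_norm (L x) \<le> K * frechet_norm x"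
    using Lip_linearE[OF assms(1)] by metis
  obtain K' where K': "0 \<le> K'" "\<And>x. frechet_norm (H x) \<le> K' * frechet_norm x"
    using Lip_linearE[OF assms(2)] by metis
  interpret L: linear L using assms(1) by (simp add: Lip_linear_def)
  interpret H: linear H using assms(2) by (simp add: Lip_linear_def)
  have lin: "linear (map_prod L H)"
    by (rule linearI) (auto simp: L.add H.add L.scaleR H.scaleR)
  have le: "frechet_norm (map_prod L H z) \<le> max K K' * frechet_norm z" for z
  proof -
    obtain x y where z: "z = (x, y)" by (cases z)
    have "K * frechet_norm x \<le> max K K' * max (frechet_norm x) (frechet_norm y)"
      "K' * frechet_norm y \<le> max K K' * max (frechet_norm x) (frechet_norm y)"
      using K(1) K'(1) by (auto intro!: mult_mono simp: le_max_iff_disj)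
    then show ?thesis
      using K(2)[of x] K'(2)[of y] by (simp add: z frechet_norm_Pair)
  qed
  show ?thesis unfolding Lip_linear_def
    by (rule conjI[OF lin], rule exI, rule allI, rule le)
qed

lemma Lip_linear_Pair_zero: "Lip_linear (\<lambda>y. (0, y))"
  unfolding Lip_linear_def
  by (intro conjI linearI exI[of _ 1]) (auto simp: frechet_norm_Pair)

lemma Lip_linear_tendsto:
  assumes L: "Lip_linear L" and f: "(f \<longlongrightarrow> l) F"
  shows "((\<lambda>x. L (f x)) \<longlongrightarrow> L l) F"
proof -
  obtain K where K: "0 \<le> K" "\<And>x. frechet_norm (L x) \<le> K * frechet_norm x"
    using Lip_linearE[OF L] by metis
  interpret L: linear L using L by (simp add: Lip_linear_def)
  show ?thesis
    unfolding tendsto_frechet_norm_iff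
  proof (rule Lim_null_comparison)
    show "((\<lambda>x. K * frechet_norm (f x - l)) \<longlongrightarrow> 0) F"
      using f unfolding tendsto_frechet_norm_iff by (rule tendsto_mult_right_zero)
    show "\<forall>\<^sub>F x in F. norm (frechet_norm (L (f x) - L l)) \<le> K * frechet_norm (f x - l)"
      using K(2) by (simp add: L.diff[symmetric])
  qed
qed

lemma Lip_linear_continuous_on: "Lip_linear L \<Longrightarrow> continuous_on S L"
  unfolding continuous_on_def using Lip_linear_tendsto[OF _ tendsto_ident_at] by blast

text \<open>The common setting for the targets in the derivative recursion. It is instantiated by
  \<open>range embed\<close> with the original metric and, from the second stage on, by
  \<open>{0}\<close>. Invariance is demanded on the whole type, so it applies without membership
  conditions.\<close>

locale invariant_metric = Metric_space C d
  for C :: "'v::real_vector set" and d :: "'v \<Rightarrow> 'v \<Rightarrow> real" +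
  assumes subspace_C: "subspace C" and translation: "d x y = d (x - y) 0"
begin

lemma d_zero [simp]: "d 0 0 = 0"
  using subspace_0[OF subspace_C] by simp

lemma d_minus: "d (- x) 0 = d x 0"
  using translation[of 0 x] commute[of 0 x] by simp

lemma Lip_leI:
  fixes L :: "'e::frechet_space \<Rightarrow> 'v"
  assumes "\<And>x. d (L x) 0 \<le> K * frechet_norm x" "0 \<le> K"
  shows "eLip d L \<le> ennreal K"
  unfolding eLip_def
proof (rule SUP_least)
  fix x :: 'e assume "x \<in> - {0}"
  then have "0 < frechet_norm x"
    using frechet_norm_nonneg[of x] by (simp add: less_le)
  then show "ennreal (d (L x) 0 / frechet_norm x) \<le> ennreal K"
    using assms by (simp add: divide_le_eq ennreal_leI)
qed

text \<open>The supremum omits the point 0, so the bound there comes from L 0 = 0.\<close>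

lemma Lip_bound:
  fixes L :: "'e::frechet_space \<Rightarrow> 'v"
  assumes "eLip d L < \<infinity>" "L 0 = 0"
  shows "d (L x) 0 \<le> Lip d L * frechet_norm x"
proof (cases "x = 0")
  case False
  then have N: "0 < frechet_norm x"
    using frechet_norm_nonneg[of x] by (simp add: less_le)
  have "ennreal (d (L x) 0 / frechet_norm x) \<le> eLip d L"
    unfolding eLip_def using False by (intro SUP_upper) simp
  also have "\<dots> = ennreal (Lip d L)"
    using assms by (simp add: Lip_def less_top)
  finally have "d (L x) 0 / frechet_norm x \<le> Lip d L"
    by (simp add: Lip_def)
  with N show ?thesis by (simp add: divide_le_eq)
qed (simp add: assms)

lemma Lip_nonneg: "0 \<le> Lip d L"
  by (simp add: Lip_def)

lemma Lip_maps_diff: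
  fixes L H :: "'e::frechet_space \<Rightarrow> 'v"
  assumes "L \<in> Lip_maps C d" "H \<in> Lip_maps C d"
  shows "L - H \<in> Lip_maps C d" "Lip d (L - H) \<le> Lip d L + Lip d H"
proof -
  have lin: "linear L" "linear H" and fin: "eLip d L < \<infinity>" "eLip d H < \<infinity>"
    and C: "L x \<in> C" "H x \<in> C" for x
    using assms by (auto simp: Lip_maps_def)
  have "d ((L - H) x) 0 \<le> (Lip d L + Lip d H) * frechet_norm x" for x
  proof -
    have "d ((L - H) x) 0 = d (L x) (H x)" by (simp add: translation[of "L x" "H x"])
    also have "\<dots> \<le> d (L x) 0 + d 0 (H x)"
      using C subspace_0[OF subspace_C] by (intro triangle) auto
    also have "d 0 (H x) = d (H x) 0" by (rule commute)
    finally show ?thesis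
      using Lip_bound[OF fin(1), of x] Lip_bound[OF fin(2), of x] lin
      by (simp add: linear_0 distrib_right)
  qed
  then have le: "eLip d (L - H) \<le> ennreal (Lip d L + Lip d H)"
    by (intro Lip_leI) (auto simp: Lip_nonneg)
  then have "eLip d (L - H) < \<infinity>"
    by (rule order_le_less_trans) simp
  moreover have "linear (L - H)"
    using linear_compose_sub[OF lin] by (simp add: fun_diff_def)
  ultimately show "L - H \<in> Lip_maps C d"
    using C by (auto simp: Lip_maps_def intro!: subspace_diff subspace_C)
  show "Lip d (L - H) \<le> Lip d L + Lip d H"
    using enn2real_leI[OF _ le] Lip_nonneg[of L] Lip_nonneg[of H] by (simp add: Lip_def)
qed

lemma Lip_eq_0:
  assumes "L \<in> Lip_maps C d" "Lip d L = 0"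
  shows "L = (0 :: 'e::frechet_space \<Rightarrow> 'v)"
proof
  fix x
  have "d (L x) 0 = 0"
    using Lip_bound[of L x] assms nonneg[of "L x" 0] by (auto simp: Lip_maps_def linear_0)
  then show "L x = 0 x"
    using assms(1) zero[of "L x" 0] subspace_0[OF subspace_C] by (auto simp: Lip_maps_def)
qed

lemma Lip_zero [simp]: "Lip d (0 :: 'e::frechet_space \<Rightarrow> 'v) = 0" "eLip d (0 :: 'e \<Rightarrow> 'v) = 0"
proof -
  show "eLip d (0 :: 'e \<Rightarrow> 'v) = 0"
    using Lip_leI[of "0 :: 'e \<Rightarrow> 'v" 0] by simp
  then show "Lip d (0 :: 'e \<Rightarrow> 'v) = 0" by (simp add: Lip_def)
qed

lemma zero_in_Lip_maps: "(0 :: 'e::frechet_space \<Rightarrow> 'v) \<in> Lip_maps C d"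
proof -
  have "linear (0 :: 'e \<Rightarrow> 'v)" by (rule linearI) simp_all
  then show ?thesis using subspace_0[OF subspace_C] by (auto simp: Lip_maps_def)
qed

lemma Lip_minus: "Lip d (- L) = Lip d L"
  unfolding Lip_def eLip_def by (simp add: d_minus)

lemma Metric_space_Lip:
  "Metric_space (Lip_maps C d :: ('e::frechet_space \<Rightarrow> 'v) set) (Lip_dist d)"
proof (rule Metric_space.intro)
  fix L H J :: "'e \<Rightarrow> 'v"
  show "0 \<le> Lip_dist d L H" by (simp add: Lip_dist_def Lip_nonneg)
  show "Lip_dist d L H = Lip_dist d H L"
    using Lip_minus[of "L - H"] by (simp add: Lip_dist_def)
  assume L: "L \<in> Lip_maps C d" and H: "H \<in> Lip_maps C d"
  show "Lip_dist d L H = 0 \<longleftrightarrow> L = H"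
    using Lip_eq_0[OF Lip_maps_diff(1)[OF L H]] by (auto simp: Lip_dist_def)
  assume J: "J \<in> Lip_maps C d"
  \<comment> \<open>The closure of \<open>Lip_maps\<close> is available for differences, so L - J is
    written as a difference of differences.\<close>
  have "H - J - (H - L) = L - J" by simp
  then show "Lip_dist d L J \<le> Lip_dist d L H + Lip_dist d H J"
    using Lip_maps_diff(2)[OF Lip_maps_diff(1)[OF H J] Lip_maps_diff(1)[OF H L]] Lip_minus[of "L - H"]
    by (simp add: Lip_dist_def)
qed

lemma has_dir_deriv_unique:
  assumes "has_dir_deriv C d f x h v" "has_dir_deriv C d f x h w"
  shows "v = w"
  using limitin_metric_unique[OF assms[unfolded has_dir_deriv_def]] by simp

lemma dir_deriv_eq: "has_dir_deriv C d f x h v \<Longrightarrow> dir_deriv C d f x h = v"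
  unfolding dir_deriv_def by (rule the_equality) (auto intro: has_dir_deriv_unique)

end

subsection \<open>Maps of class MC^k are locally affine\<close>

text \<open>The Lipschitz bound belongs to the notion because the derivative of an
  \<open>MC1\<close> map has to lie in \<open>Lip_maps\<close>.\<close>

definition affine_germ ::
    "('e::frechet_space \<Rightarrow> 'f::frechet_space) \<Rightarrow> 'e \<Rightarrow> ('e \<Rightarrow> 'f) \<Rightarrow> bool" where
  "affine_germ f x L \<longleftrightarrow> Lip_linear L \<and> (\<forall>\<^sub>F y in nhds x. f y = f x + L (y - x))"

abbreviation embed_dist ::
    "('e list \<Rightarrow> 'f::frechet_space) \<Rightarrow> ('e list \<Rightarrow> 'f) \<Rightarrow> real" where
  "embed_dist g h \<equiv> frechet_dist (g []) (h [])"

lemma embed_Nil [simp]: "embed v [] = v"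
  by (simp add: embed_def)

lemma embed_add: "embed (v + w) = embed v + (embed w :: 'e list \<Rightarrow> 'f::real_vector)"
  by (auto simp: embed_def fun_eq_iff)

lemma embed_diff: "embed (v - w) = embed v - (embed w :: 'e list \<Rightarrow> 'f::real_vector)"
  by (auto simp: embed_def fun_eq_iff)

lemma embed_scaleR: "embed (c *\<^sub>R v) = c *\<^sub>R (embed v :: 'e list \<Rightarrow> 'f::real_vector)"
  by (auto simp: embed_def fun_eq_iff scaleR_fun_def)

lemma embed_zero: "embed 0 = (0 :: 'e list \<Rightarrow> 'f::real_vector)"
  by (auto simp: embed_def fun_eq_iff)

lemma invariant_metric_embed:
  "invariant_metric (range embed :: ('e list \<Rightarrow> 'f::frechet_space) set) embed_dist"
proof (rule invariant_metric.intro)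
  show "Metric_space (range embed :: ('e list \<Rightarrow> 'f::frechet_space) set) embed_dist"
  proof (rule Metric_space.intro)
    fix g h j :: "'e list \<Rightarrow> 'f"
    show "0 \<le> embed_dist g h" by (rule frechet.nonneg)
    show "embed_dist g h = embed_dist h g" by (rule frechet.commute)
    show "embed_dist g j \<le> embed_dist g h + embed_dist h j"
      by (rule frechet.triangle) auto
    show "g \<in> range embed \<Longrightarrow> h \<in> range embed \<Longrightarrow> embed_dist g h = 0 \<longleftrightarrow> g = h"
      by auto
  qed
  show "invariant_metric_axioms (range embed :: ('e list \<Rightarrow> 'f::frechet_space) set) embed_dist"
  proof (rule invariant_metric_axioms.intro)
    fix g h :: "'e list \<Rightarrow> 'f"
    show "embed_dist g h = embed_dist (g - h) 0"
      using frechet_dist_translation[of "g []" "h []"] by simp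
    have "embed v + embed w \<in> range (embed :: 'f \<Rightarrow> 'e list \<Rightarrow> 'f)" "c *\<^sub>R embed v \<in> range (embed :: 'f \<Rightarrow> 'e list \<Rightarrow> 'f)"
      for v w c
      by (metis embed_add rangeI, metis embed_scaleR rangeI)
    moreover have "0 \<in> range (embed :: 'f \<Rightarrow> 'e list \<Rightarrow> 'f)"
      by (metis embed_zero rangeI)
    ultimately show "subspace (range embed :: ('e list \<Rightarrow> 'f) set)"
      by (auto simp: subspace_def)
  qed
qed

interpretation embed: invariant_metric "range embed :: ('e list \<Rightarrow> 'f::frechet_space) set" embed_dist
  by (rule invariant_metric_embed)

interpretation embed_Lip: Metric_space
  "Lip_maps (range embed) embed_dist :: ('e::frechet_space \<Rightarrow> 'e list \<Rightarrow> 'f::frechet_space) set"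
  "Lip_dist embed_dist"
  by (rule embed.Metric_space_Lip)

lemma limitin_embed:
  "limitin (Metric_space.mtopology (range embed) embed_dist) (\<lambda>t. embed (f t)) (embed v) F
    \<longleftrightarrow> (f \<longlongrightarrow> (v::'f::frechet_space)) F"
proof -
  have "(f \<longlongrightarrow> v) F \<longleftrightarrow> limitin frechet.mtopology f v F" by simp
  then show ?thesis
    unfolding embed.limitin_metric frechet.limitin_metric by simp
qed

lemma has_dir_deriv_frechet:
  "has_dir_deriv UNIV frechet_dist f x h v
    \<longleftrightarrow> ((\<lambda>t. (1 / t) *\<^sub>R (f (x + t *\<^sub>R h) - f x)) \<longlongrightarrow> v) (at 0)"
  by (simp add: has_dir_deriv_def)

text \<open>Since \<open>embed\<close> is linear and isometric, the derivative in the recursion and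
  the derivative \<open>fderiv\<close> of the tangent spaces carry the same information.\<close>

lemma has_dir_deriv_embed:
  "has_dir_deriv (range embed) embed_dist (\<lambda>x. embed (f x)) x h (embed v)
    \<longleftrightarrow> has_dir_deriv UNIV frechet_dist f x h v"
  unfolding has_dir_deriv_frechet
  by (simp add: has_dir_deriv_def embed_diff[symmetric] embed_scaleR[symmetric] limitin_embed)

lemma has_dir_deriv_UNIV_unique:
  "has_dir_deriv UNIV frechet_dist f x h v \<Longrightarrow> has_dir_deriv UNIV frechet_dist f x h w \<Longrightarrow> v = w"
  unfolding has_dir_deriv_frechet by (rule tendsto_unique[rotated]) auto

lemma fderiv_eq: "has_dir_deriv UNIV frechet_dist f x h v \<Longrightarrow> fderiv f x h = v"
  unfolding dir_deriv_def by (rule the_equality) (auto intro: has_dir_deriv_UNIV_unique)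

lemma tendsto_line: "((\<lambda>t. x + t *\<^sub>R h) \<longlongrightarrow> x + s *\<^sub>R (h::'a::frechet_space)) (at s within T)"
  by (intro tendsto_add_frechet tendsto_scaleR_frechet tendsto_const tendsto_ident_at)

text \<open>Used in two ways: at s = 0 for difference quotients, and within [0, 1] for local
  constancy along a segment.\<close>

lemma eventually_line:
  assumes "eventually P (nhds (x + s *\<^sub>R (h::'a::frechet_space)))"
  shows "\<forall>\<^sub>F t in at s within T. P (x + t *\<^sub>R h)"
  using tendsto_line assms unfolding filterlim_iff by blast

lemma affine_germ_has_dir_deriv:
  assumes "affine_germ f x L"
  shows "has_dir_deriv UNIV frechet_dist f x h (L h)"
  unfolding has_dir_deriv_frechet
proof (rule Lim_transform_eventually)
  interpret L: linear L using assms by (simp add: affine_germ_def Lip_linear_def)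
  have "\<forall>\<^sub>F t in at 0. f (x + t *\<^sub>R h) = f x + L ((x + t *\<^sub>R h) - x)"
    using assms by (intro eventually_line) (simp add: affine_germ_def)
  moreover have "\<forall>\<^sub>F t in at (0::real). t \<noteq> 0" by (simp add: eventually_at_filter)
  ultimately show "\<forall>\<^sub>F t in at 0. L h = (1 / t) *\<^sub>R (f (x + t *\<^sub>R h) - f x)"
    by eventually_elim (simp add: L.scaleR)
qed simp

lemma affine_germ_fderiv: "affine_germ f x L \<Longrightarrow> fderiv f x = L"
  by (rule ext, rule fderiv_eq, rule affine_germ_has_dir_deriv)

lemma affine_germ_unique: "affine_germ f x L \<Longrightarrow> affine_germ f x H \<Longrightarrow> L = H"
  using affine_germ_fderiv by metis

section \<open>Lipschitz maps in the encoding by lists\<close>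

lemma Lip_maps_embedD:
  assumes "L \<in> Lip_maps (range embed) embed_dist"
  shows "linear (\<lambda>h. L h [])" "L h = embed (L h [])"
    "frechet_norm (L h []) \<le> Lip embed_dist L * frechet_norm (h::'e::frechet_space)"
proof -
  have lin: "linear L" and fin: "eLip embed_dist L < \<infinity>" and "L h \<in> range embed"
    using assms by (auto simp: Lip_maps_def)
  then show "L h = embed (L h [])" by auto
  show "frechet_norm (L h []) \<le> Lip embed_dist L * frechet_norm h"
    using embed.Lip_bound[OF fin, of h] lin by (simp add: linear_0)
  show "linear (\<lambda>h. L h [])"
    by (rule linearI) (simp_all add: linear_add[OF lin] linear_scale[OF lin] scaleR_fun_def)
qed

lemma Lip_maps_embedI:
  assumes "Lip_linear L"
  shows "(\<lambda>h. embed (L h)) \<in> Lip_maps (range embed) embed_dist"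
proof -
  interpret L: linear L using assms by (rule Lip_linear_linear)
  obtain K where "0 \<le> K" "\<And>x. frechet_norm (L x) \<le> K * frechet_norm x"
    using Lip_linearE[OF assms] by metis
  then have "eLip embed_dist (\<lambda>h. embed (L h)) \<le> ennreal K"
    by (intro embed.Lip_leI) auto
  then have "eLip embed_dist (\<lambda>h. embed (L h)) < \<infinity>"
    by (rule order_le_less_trans) simp
  moreover have "linear (\<lambda>h. embed (L h))"
    by (rule linearI) (simp_all add: embed_add embed_scaleR L.add L.scaleR)
  ultimately show ?thesis by (auto simp: Lip_maps_def)
qed

text \<open>The metric of the domain is at most 1, so the bound on L (t h) = t (L h) does not grow
  with t: all multiples of L h stay within the Lipschitz constant of 0.\<close>

lemma fseminorm_eq_0_if_Lip_small:
  assumes L: "L \<in> Lip_maps (range embed) embed_dist" and "Lip embed_dist L < 1 / 2 ^ i"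
  shows "fseminorm i (L h []) = 0"
proof (rule fseminorm_eq_0_if_bounded_multiples)
  show "frechet_norm (t *\<^sub>R L h []) \<le> Lip embed_dist L" for t
  proof -
    have "frechet_norm (t *\<^sub>R L h []) = frechet_norm (L (t *\<^sub>R h) [])"
      using linear_scale[OF Lip_maps_embedD(1)[OF L]] by simp
    also have "\<dots> \<le> Lip embed_dist L * frechet_norm (t *\<^sub>R h)"
      by (rule Lip_maps_embedD(3)[OF L])
    also have "\<dots> \<le> Lip embed_dist L * 1"
      by (intro mult_left_mono frechet_norm_le_1 embed.Lip_nonneg)
    finally show ?thesis by simp
  qed
qed (rule assms)

lemma fseminorm_eq_if_diff:
  assumes "fseminorm i (a - b) = 0"
  shows "fseminorm i (a - c) = fseminorm i (b - (c::'a::frechet_space))"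
  using fseminorm_triangle[of i "a - b" "b - c"] fseminorm_triangle[of i "b - a" "a - c"] assms
    fseminorm_minus[of i "a - b"] by simp

text \<open>For fixed i and h, two maps at distance below 2^-i have the same i-th seminorm at h.
  Hence the maps H with \<open>fseminorm i (H h []) = 0\<close> form a clopen set containing 0, and
  the component of 0 lies in all of these sets.\<close>

lemma connected_component_Lip_maps_embed:
  "connected_component_of_set (Metric_space.mtopology (Lip_maps (range embed) embed_dist) (Lip_dist embed_dist)) 0
    = {0 :: 'e::frechet_space \<Rightarrow> 'e list \<Rightarrow> 'f::frechet_space}"
  (is "connected_component_of_set ?X 0 = _")
proof -
  let ?C = "connected_component_of_set ?X (0 :: 'e \<Rightarrow> 'e list \<Rightarrow> 'f)"
  have conn: "connectedin ?X ?C" by (rule connectedin_connected_component_of)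
  have "L = 0" if L: "L \<in> ?C" for L
  proof -
    have zero: "0 \<in> ?C"
      using embed.zero_in_Lip_maps by (simp add: connected_component_of_refl)
    have sub: "?C \<subseteq> Lip_maps (range embed) embed_dist"
      using connectedin_subset_topspace[OF conn] by simp
    have "fseminorm i (L h []) = 0" for i h
    proof -
      define A where "A = {H :: 'e \<Rightarrow> 'e list \<Rightarrow> 'f. H \<in> Lip_maps (range embed) embed_dist \<and> fseminorm i (H h []) = 0}"
      define B where "B = {H :: 'e \<Rightarrow> 'e list \<Rightarrow> 'f. H \<in> Lip_maps (range embed) embed_dist \<and> fseminorm i (H h []) \<noteq> (0::real)}"
      have small: "fseminorm i (H h []) = fseminorm i (J h [])"
        if "H \<in> Lip_maps (range embed) embed_dist" "J \<in> embed_Lip.mball H (1 / 2 ^ i)"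
        for H J :: "'e \<Rightarrow> 'e list \<Rightarrow> 'f"
      proof -
        have "H - J \<in> Lip_maps (range embed) embed_dist" "Lip embed_dist (H - J) < 1 / 2 ^ i"
          using that embed.Lip_maps_diff(1)[of H J] by (auto simp: Lip_dist_def)
        then have "fseminorm i ((H - J) h []) = 0"
          by (rule fseminorm_eq_0_if_Lip_small)
        then show ?thesis using fseminorm_eq_if_diff[of i "H h []" "J h []" 0] by simp
      qed
      have "openin ?X A"
        unfolding embed_Lip.openin_mtopology A_def
        using small by (auto intro!: exI[of _ "1 / 2 ^ i"])
      moreover have "openin ?X B"
        unfolding embed_Lip.openin_mtopology B_def
        using small by (auto intro!: exI[of _ "1 / 2 ^ i"])
      moreover have "?C \<subseteq> A \<union> B" "A \<inter> B \<inter> ?C = {}" "A \<inter> ?C \<noteq> {}"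
        using sub zero embed.zero_in_Lip_maps by (auto simp: A_def B_def)
      ultimately have "B \<inter> ?C = {}"
        using conn unfolding connectedin by blast
      then show ?thesis using L sub by (auto simp: B_def)
    qed
    then have "L h [] = 0" for h by (intro fseminorm_separating) simp
    moreover have "L h = embed (L h [])" for h using Lip_maps_embedD(2) L sub by blast
    ultimately show "L = 0" by (metis (full_types) embed_zero ext zero_fun_apply)
  qed
  moreover have "0 \<in> ?C"
    using embed.zero_in_Lip_maps by (simp add: connected_component_of_refl)
  ultimately show ?thesis by blast
qed

section \<open>From a continuous derivative to an affine germ\<close>

lemma embed_Lip_continuous_mapD:
  assumes "continuous_map (top_of_set U) (Metric_space.mtopology (Lip_maps (range embed) embed_dist) (Lip_dist embed_dist)) D"
    and "y \<in> U" "open U" "0 < e"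
  shows "\<exists>W. open W \<and> y \<in> W \<and> W \<subseteq> U \<and>
    (\<forall>z\<in>W. D y \<in> Lip_maps (range embed) embed_dist \<and> D z \<in> Lip_maps (range embed) embed_dist
      \<and> Lip embed_dist (D z - (D y :: 'e::frechet_space \<Rightarrow> 'e list \<Rightarrow> 'f::frechet_space)) < e)"
proof -
  obtain W where W: "openin (top_of_set U) W" "y \<in> W" "\<forall>z\<in>W. D z \<in> embed_Lip.mball (D y) e"
    using assms(1)[unfolded embed_Lip.continuous_map_to_metric topspace_euclidean_subtopology] assms(2,4)
    by blast
  then have "open W" "W \<subseteq> U" using assms(3) openin_open_eq by blast+
  moreover have "D y \<in> Lip_maps (range embed) embed_dist \<and> D z \<in> Lip_maps (range embed) embed_dist
      \<and> Lip embed_dist (D z - D y) < e" if "z \<in> W" for z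
    using W(3)[rule_format, OF that] embed_Lip.commute[of "D y" "D z"] by (auto simp: Lip_dist_def)
  ultimately show ?thesis using W(2) by blast
qed

lemma fseminorm_triangle_reverse:
  "\<bar>fseminorm i a - fseminorm i b\<bar> \<le> fseminorm i (a - (b::'a::frechet_space))"
  using fseminorm_triangle[of i "a - b" b] fseminorm_triangle[of i "b - a" a]
    fseminorm_minus[of i "a - b"] by simp

text \<open>A mean value argument for one seminorm at a time. By the reverse triangle inequality the
  difference quotients of \<open>q\<close> are bounded by the i-th seminorm of the difference
  quotient of f along h minus v. So \<open>q\<close> has derivative 0 on [0, 1], and q 1 = q 0 =
  0.\<close>

lemma affine_on_segment:
  fixes f :: "'e::frechet_space \<Rightarrow> 'f::frechet_space"
  assumes deriv: "\<And>s. s \<in> {0..1::real} \<Longrightarrow> has_dir_deriv UNIV frechet_dist f (x + s *\<^sub>R h) h v"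
  shows "f (x + h) = f x + v"
proof -
  have "fseminorm i (f (x + h) - f x - v) = 0" for i
  proof -
    define q where "q s = fseminorm i (f (x + s *\<^sub>R h) - f x - s *\<^sub>R v)" for s
    have "(q has_field_derivative 0) (at s within {0..1})" if s: "s \<in> {0..1}" for s
    proof -
      define Q where "Q y = fseminorm i ((1 / (y - s)) *\<^sub>R (f (x + s *\<^sub>R h + (y - s) *\<^sub>R h) - f (x + s *\<^sub>R h)) - v)" for y
      have "((\<lambda>r. Q (s + r)) \<longlongrightarrow> 0) (at 0)"
        using deriv[OF s] unfolding has_dir_deriv_frechet tendsto_fseminorm_iff by (simp add: Q_def)
      then have "(Q \<longlongrightarrow> 0) (at s)" by (rule LIM_offset_zero_cancel)
      then have Q: "(Q \<longlongrightarrow> 0) (at s within {0..1})" by (rule tendsto_within_subset) simp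
      show ?thesis
        unfolding has_field_derivative_iff
      proof (rule Lim_null_comparison[OF _ Q])
        have bound: "norm ((q y - q s) / (y - s)) \<le> Q y" if "y \<noteq> s" for y
        proof -
          let ?a = "f (x + y *\<^sub>R h) - f x - y *\<^sub>R v" and ?b = "f (x + s *\<^sub>R h) - f x - s *\<^sub>R v"
          have "\<bar>q y - q s\<bar> \<le> fseminorm i (?a - ?b)"
            unfolding q_def by (rule fseminorm_triangle_reverse)
          also have "?a - ?b = (y - s) *\<^sub>R ((1 / (y - s)) *\<^sub>R (f (x + s *\<^sub>R h + (y - s) *\<^sub>R h) - f (x + s *\<^sub>R h)) - v)"
            using that by (simp add: algebra_simps)
          finally have "\<bar>q y - q s\<bar> \<le> \<bar>y - s\<bar> * Q y"
            by (simp only: fseminorm_scaleR Q_def)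
          then show ?thesis using that by (simp add: abs_divide divide_le_eq mult.commute)
        qed
        show "\<forall>\<^sub>F y in at s within {0..1}. norm ((q y - q s) / (y - s)) \<le> Q y"
          unfolding eventually_at_filter using bound by (intro always_eventually) blast
      qed
    qed
    then obtain c where "\<And>s. s \<in> {0..1} \<Longrightarrow> q s = c"
      using has_field_derivative_zero_constant[of "{0..1}" q] by (metis convex_real_interval(5))
    then have "q 1 = q 0" by auto
    then show ?thesis by (simp add: q_def)
  qed
  then have "f (x + h) - f x - v = 0" by (rule fseminorm_separating[rule_format])
  then show ?thesis by (simp add: algebra_simps)
qed

lemma MC1_imp_affine_germ:
  fixes f :: "'e::frechet_space \<Rightarrow> 'f::frechet_space"
  assumes MC1: "MC1 (range embed) embed_dist U (\<lambda>x. embed (f x) :: 'e list \<Rightarrow> 'f)"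
    and U: "open U" and x: "x \<in> U"
  shows "\<exists>L. affine_germ f x L"
proof -
  define D where "D = dir_deriv (range embed) embed_dist (\<lambda>x. embed (f x) :: 'e list \<Rightarrow> 'f)"
  define D0 where "D0 y h = D y h []" for y h
  have D: "D y \<in> Lip_maps (range embed) embed_dist" if "y \<in> U" for y
    using MC1 that by (simp add: MC1_def D_def)
  have D0: "D y h = embed (D0 y h)" if "y \<in> U" for y h
    using Lip_maps_embedD(2)[OF D[OF that]] by (simp add: D0_def)
  have deriv: "has_dir_deriv UNIV frechet_dist f y h (D0 y h)" if y: "y \<in> U" for y h
  proof -
    obtain v where v: "has_dir_deriv (range embed) embed_dist (\<lambda>x. embed (f x) :: 'e list \<Rightarrow> 'f) y h v"
      using MC1 y unfolding MC1_def Keller_C1_def by metis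
    then have "D y h = v" unfolding D_def by (rule embed.dir_deriv_eq)
    then have "v = embed (D0 y h)" using D0[OF y, of h] by simp
    with v show ?thesis by (simp only: has_dir_deriv_embed)
  qed
  \<comment> \<open>Closeness within 2^-i becomes equality modulo the kernel of the i-th seminorm.
    The neighbourhood depends on i, so this does not yet make the derivative locally
    constant.\<close>
  have loc: "\<exists>W. open W \<and> y \<in> W \<and> W \<subseteq> U \<and> (\<forall>z\<in>W. \<forall>h. fseminorm i (D0 z h - D0 y h) = 0)"
    if y: "y \<in> U" for y i
  proof -
    have "continuous_map (top_of_set U) (Metric_space.mtopology (Lip_maps (range embed) embed_dist) (Lip_dist embed_dist)) D"
      using MC1 by (simp add: MC1_def D_def)
    from embed_Lip_continuous_mapD[OF this y U, of "1 / 2 ^ i"]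
    obtain W where W: "open W" "y \<in> W" "W \<subseteq> U"
      "\<forall>z\<in>W. D y \<in> Lip_maps (range embed) embed_dist \<and> D z \<in> Lip_maps (range embed) embed_dist
        \<and> Lip embed_dist (D z - D y) < 1 / 2 ^ i"
      by auto
    have "fseminorm i (D0 z h - D0 y h) = 0" if "z \<in> W" for z h
      using fseminorm_eq_0_if_Lip_small[OF embed.Lip_maps_diff(1), of "D z" "D y" i h] bspec[OF W(4) that]
      by (simp add: D0_def)
    with W show ?thesis by blast
  qed
  obtain n e where ne: "e > 0" "\<And>y. (\<forall>i\<le>n. fseminorm i (y - x) < e) \<Longrightarrow> y \<in> U"
    using open_fseminormD[OF U x] by blast
  \<comment> \<open>The ball is fixed by \<open>U\<close> alone. Segments from x to its points stay
    inside \<open>U\<close>, and along them each i can be treated on its own.\<close>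
  have aff: "f y = f x + D0 x (y - x)" if y: "\<forall>i\<le>n. fseminorm i (y - x) < e" for y
  proof -
    define h where "h = y - x"
    have seg: "x + s *\<^sub>R h \<in> U" if s: "s \<in> {0..1}" for s
    proof (rule ne(2), intro allI impI)
      fix i assume "i \<le> n"
      then have "fseminorm i h < e" using y by (simp add: h_def)
      moreover have "s * fseminorm i h \<le> 1 * fseminorm i h" using s by (intro mult_right_mono) auto
      ultimately show "fseminorm i (x + s *\<^sub>R h - x) < e"
        using s by (simp add: fseminorm_scaleR)
    qed
    have const: "D0 (x + s *\<^sub>R h) h = D0 x h" if s: "s \<in> {0..1}" for s
    proof -
      have "fseminorm i (D0 (x + s *\<^sub>R h) h - D0 x h) = 0" for i
      proof -
        have "fseminorm i (D0 (x + s *\<^sub>R h) h - D0 x h) = fseminorm i (D0 (x + 0 *\<^sub>R h) h - D0 x h)"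
        \<comment> \<open>Locally constant in s by \<open>loc\<close>, hence constant on the
          interval, and 0 at s = 0.\<close>
        proof (rule connected_local_const[where A = "{0..1::real}" and f = "\<lambda>s. fseminorm i (D0 (x + s *\<^sub>R h) h - D0 x h)"])
          show "\<forall>s\<in>{0..1}. \<forall>\<^sub>F t in at s within {0..1}.
            fseminorm i (D0 (x + s *\<^sub>R h) h - D0 x h) = fseminorm i (D0 (x + t *\<^sub>R h) h - D0 x h)"
          proof
            fix s :: real assume "s \<in> {0..1}"
            then obtain W where W: "open W" "x + s *\<^sub>R h \<in> W"
              "\<forall>z\<in>W. \<forall>k. fseminorm i (D0 z k - D0 (x + s *\<^sub>R h) k) = 0"
              using loc[OF seg] by blast
            have "\<forall>\<^sub>F t in at s within {0..1}. x + t *\<^sub>R h \<in> W"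
              using W(1,2) by (intro eventually_line) (auto simp: eventually_nhds)
            then show "\<forall>\<^sub>F t in at s within {0..1}.
              fseminorm i (D0 (x + s *\<^sub>R h) h - D0 x h) = fseminorm i (D0 (x + t *\<^sub>R h) h - D0 x h)"
              by eventually_elim (use W(3) fseminorm_eq_if_diff in metis)
          qed
        qed (use s in auto)
        then show ?thesis by simp
      qed
      then have "D0 (x + s *\<^sub>R h) h - D0 x h = 0" by (intro fseminorm_separating) simp
      then show ?thesis by simp
    qed
    have "f (x + h) = f x + D0 x h"
      by (rule affine_on_segment) (metis const deriv seg)
    then show ?thesis by (simp add: h_def)
  qed
  have "Lip_linear (D0 x)"
    using Lip_maps_embedD[OF D[OF x]] unfolding Lip_linear_def D0_def by blast
  moreover have "\<forall>\<^sub>F y in nhds x. f y = f x + D0 x (y - x)"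
  proof -
    obtain d where "0 < d" "\<And>z::'e. frechet_norm z < d \<Longrightarrow> \<forall>i\<le>n. fseminorm i z < e"
      using fseminorm_less_if_small[OF ne(1)] by metis
    with aff show ?thesis unfolding eventually_nhds_frechet by blast
  qed
  ultimately show ?thesis by (auto simp: affine_germ_def)
qed

text \<open>An affine formula can be rebased at any nearby point without changing its linear part;
  \<open>eventually_eventually\<close> supplies the neighbourhood of the new point. This is the
  source of all local constancy of derivatives below.\<close>

lemma affine_germ_eventually:
  assumes "affine_germ f x L"
  shows "\<forall>\<^sub>F y in nhds x. affine_germ f y L"
proof -
  interpret L: linear L using assms by (simp add: affine_germ_def Lip_linear_def)
  have "\<forall>\<^sub>F y in nhds x. f y = f x + L (y - x)"
    using assms by (simp add: affine_germ_def)
  then have "\<forall>\<^sub>F y in nhds x. f y = f x + L (y - x) \<and> (\<forall>\<^sub>F z in nhds y. f z = f x + L (z - x))"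
    by (intro eventually_conj) (simp_all add: eventually_eventually)
  then show ?thesis
  proof eventually_elim
    case (elim y)
    then have "\<forall>\<^sub>F z in nhds y. f z = f x + L (z - x)" by blast
    then have "\<forall>\<^sub>F z in nhds y. f z = f y + L (z - y)"
      by eventually_elim (use elim in \<open>simp add: L.diff\<close>)
    with assms show ?case by (simp add: affine_germ_def)
  qed
qed

lemma affine_germ_tendsto:
  assumes "affine_germ f x L"
  shows "(f \<longlongrightarrow> f x) (nhds x)"
proof (rule Lim_transform_eventually)
  have L: "Lip_linear L" using assms by (simp add: affine_germ_def)
  interpret L: linear L using L by (rule Lip_linear_linear)
  have "((\<lambda>y. f x + L (y - x)) \<longlongrightarrow> f x + L (x - x)) (nhds x)"
    by (intro tendsto_add_frechet tendsto_const Lip_linear_tendsto[OF L] tendsto_diff_frechet filterlim_ident)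
  then show "((\<lambda>y. f x + L (y - x)) \<longlongrightarrow> f x) (nhds x)" by (simp add: L.zero)
  show "\<forall>\<^sub>F y in nhds x. f x + L (y - x) = f y"
    using assms unfolding affine_germ_def by (auto elim: eventually_mono)
qed

text \<open>Valid for every target topology, so the compact-open and the Lipschitz topology on the
  operator space are handled alike.\<close>

lemma continuous_map_locally_constant:
  assumes "\<And>x. x \<in> topspace X \<Longrightarrow> g x \<in> topspace Y"
    and "\<And>x. x \<in> topspace X \<Longrightarrow> \<exists>W. openin X W \<and> x \<in> W \<and> (\<forall>y\<in>W. g y = g x)"
  shows "continuous_map X Y g"
  unfolding continuous_map_def
proof (intro conjI allI impI)
  show "g \<in> topspace X \<rightarrow> topspace Y" using assms(1) by blast
  fix V assume "openin Y V"
  show "openin X {x \<in> topspace X. g x \<in> V}"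
  proof (subst openin_subopen, rule ballI)
    fix x assume x: "x \<in> {x \<in> topspace X. g x \<in> V}"
    then obtain W where W: "openin X W" "x \<in> W" "\<forall>y\<in>W. g y = g x" using assms(2)[of x] by auto
    have "W \<subseteq> {x \<in> topspace X. g x \<in> V}"
    proof
      fix y assume "y \<in> W"
      then show "y \<in> {x \<in> topspace X. g x \<in> V}"
        using subsetD[OF openin_subset[OF W(1)]] bspec[OF W(3)] x by simp
    qed
    with W show "\<exists>T. openin X T \<and> x \<in> T \<and> T \<subseteq> {x \<in> topspace X. g x \<in> V}" by blast
  qed
qed

lemma CL_maps_subset_compact_open:
  "(CL_maps C d :: ('e::frechet_space \<Rightarrow> 'v::real_vector) set) \<subseteq> topspace (compact_open_topology C d)"
proof
  fix L :: "'e \<Rightarrow> 'v" assume L: "L \<in> CL_maps C d"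
  \<comment> \<open>The choice K = {} and W = {} gives all of \<open>CL_maps\<close> as a subbasic
    set.\<close>
  have "{L \<in> CL_maps C d. L ` {} \<subseteq> {}} \<in> {{L \<in> CL_maps C d. L ` K \<subseteq> W} |K W.
      compact (K :: 'e set) \<and> openin (Metric_space.mtopology C d) W}"
    using compact_empty openin_empty by blast
  moreover have "L \<in> {L \<in> CL_maps C d. L ` {} \<subseteq> {}}" using L by simp
  ultimately show "L \<in> topspace (compact_open_topology C d)"
    unfolding compact_open_topology_def topology_generated_by_topspace by (rule UnionI)
qed

lemma continuous_map_embed:
  "continuous_map euclidean (Metric_space.mtopology (range embed) embed_dist)
    (embed :: 'f::frechet_space \<Rightarrow> 'e list \<Rightarrow> 'f)"
  unfolding embed.continuous_map_to_metric
proof (intro ballI allI impI)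
  fix x :: 'f and e :: real assume "0 < e"
  have "openin euclidean (frechet.mball x e)"
    using frechet.openin_mball by simp
  with \<open>0 < e\<close> show "\<exists>U. openin euclidean U \<and> x \<in> U \<and> (\<forall>y\<in>U. embed y \<in> embed.mball (embed x) e)"
    by (intro exI[of _ "frechet.mball x e"]) simp
qed

lemma Lip_maps_subset_CL_maps:
  assumes "L \<in> Lip_maps (range embed) embed_dist"
  shows "L \<in> CL_maps (range embed) (embed_dist :: ('e::frechet_space list \<Rightarrow> 'f::frechet_space) \<Rightarrow> _)"
proof -
  have lin: "linear L" using assms by (simp add: Lip_maps_def)
  have "Lip_linear (\<lambda>h. L h [])"
    using Lip_maps_embedD[OF assms] unfolding Lip_linear_def by blast
  then have "continuous_on UNIV (\<lambda>h. L h [])" by (rule Lip_linear_continuous_on)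
  then have "continuous_map euclidean euclidean (\<lambda>h. L h [])" by simp
  then have "continuous_map euclidean (Metric_space.mtopology (range embed) embed_dist) (embed \<circ> (\<lambda>h. L h []) :: _ \<Rightarrow> 'e list \<Rightarrow> 'f)"
    by (rule continuous_map_compose) (rule continuous_map_embed)
  moreover have "embed \<circ> (\<lambda>h. L h []) = L" by (rule ext) (simp only: comp_apply Lip_maps_embedD(2)[OF assms, symmetric])
  ultimately have "continuous_map euclidean (Metric_space.mtopology (range embed) embed_dist) L"
    by (simp only:)
  with lin show ?thesis by (simp add: CL_maps_def)
qed

section \<open>The stages after the first derivative\<close>

lemma push_zero: "push 0 = (0 :: 'e list \<Rightarrow> 'f::real_vector)"
  by (auto simp: push_def fun_eq_iff split: list.split)

lemma pull_zero: "pull 0 = (0 :: 'e \<Rightarrow> 'e list \<Rightarrow> 'f::real_vector)"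
  by (auto simp: pull_def fun_eq_iff)

lemma pull_diff: "pull (g - h) = pull g - (pull h :: 'e \<Rightarrow> 'e list \<Rightarrow> 'f::real_vector)"
  by (auto simp: pull_def fun_eq_iff)

text \<open>Once the component of 0 is a point, the next stage has the target \<open>{0}\<close>, on
  which the pulled back Lipschitz distance is again an invariant metric;
  \<open>MC_tower_zero\<close> can then take over.\<close>

lemma Lip_component_trivial:
  fixes C :: "('e::frechet_space list \<Rightarrow> 'f::real_vector) set"
  assumes C: "invariant_metric C d"
    and comp: "connected_component_of_set (Metric_space.mtopology (Lip_maps C d) (Lip_dist d)) (0 :: 'e \<Rightarrow> 'e list \<Rightarrow> 'f) = {0}"
  shows "Lip_component C d = {0}"
    and "invariant_metric {0 :: 'e list \<Rightarrow> 'f} (\<lambda>g h. Lip_dist d (pull g) (pull h))"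
proof -
  interpret C: invariant_metric C d by (rule C)
  interpret L: Metric_space "Lip_maps C d :: ('e \<Rightarrow> 'e list \<Rightarrow> 'f) set" "Lip_dist d"
    by (rule C.Metric_space_Lip)
  show "Lip_component C d = {0}"
    unfolding Lip_component_def comp by (simp add: push_zero)
  show "invariant_metric {0 :: 'e list \<Rightarrow> 'f} (\<lambda>g h. Lip_dist d (pull g) (pull h))"
  proof (rule invariant_metric.intro)
    have 0: "Lip_dist d (pull (0 :: 'e list \<Rightarrow> 'f)) (pull 0) = 0"
      by (simp add: pull_zero Lip_dist_def C.Lip_zero)
    show "Metric_space {0 :: 'e list \<Rightarrow> 'f} (\<lambda>g h. Lip_dist d (pull g) (pull h))"
      by (rule Metric_space.intro) (use 0 in \<open>auto intro: L.commute\<close>)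
    show "invariant_metric_axioms {0 :: 'e list \<Rightarrow> 'f} (\<lambda>g h. Lip_dist d (pull g) (pull h))"
      by (rule invariant_metric_axioms.intro)
        (auto simp: subspace_def Lip_dist_def pull_diff pull_zero)
  qed
qed

text \<open>The map is arbitrary outside \<open>U\<close>. Openness of \<open>U\<close> makes the
  difference quotients vanish for small t, and a constant is continuous for every topology
  involved.\<close>

lemma MC1_zero:
  fixes d :: "'v::real_vector \<Rightarrow> 'v \<Rightarrow> real" and f :: "'e::frechet_space \<Rightarrow> 'v"
  assumes d: "invariant_metric {0} d" and U: "open U" and f: "\<And>x. x \<in> U \<Longrightarrow> f x = 0"
  shows "MC1 {0} d U f" "x \<in> U \<Longrightarrow> dir_deriv {0} d f x = 0"
proof -
  interpret d: invariant_metric "{0}" d by (rule d)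
  interpret L: Metric_space "Lip_maps {0} d :: ('e \<Rightarrow> 'v) set" "Lip_dist d"
    by (rule d.Metric_space_Lip)
  have deriv: "has_dir_deriv {0} d f x h 0" if x: "x \<in> U" for x h
    unfolding has_dir_deriv_def
  proof (rule limitin_eventually)
    have "\<forall>\<^sub>F y in nhds (x + 0 *\<^sub>R h). f y = 0"
      using U x f by (auto simp: eventually_nhds)
    then have "\<forall>\<^sub>F t in at 0. f (x + t *\<^sub>R h) = 0"
      by (rule eventually_line)
    then show "\<forall>\<^sub>F t in at 0. (1 / t) *\<^sub>R (f (x + t *\<^sub>R h) - f x) = 0"
      by eventually_elim (simp add: f[OF x])
  qed simp
  then show D: "dir_deriv {0} d f x = 0" if "x \<in> U" for x
    using d.dir_deriv_eq[OF deriv[OF that]] by (simp add: fun_eq_iff)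
  have lin: "linear (0 :: 'e \<Rightarrow> 'v)" by (rule linearI) simp_all
  have "continuous_map euclidean d.mtopology (0 :: 'e \<Rightarrow> 'v)"
    by (simp add: zero_fun_def)
  with lin have CL: "(0 :: 'e \<Rightarrow> 'v) \<in> CL_maps {0} d" by (simp add: CL_maps_def)
  have Lip: "(0 :: 'e \<Rightarrow> 'v) \<in> Lip_maps {0} d" by (rule d.zero_in_Lip_maps)
  have loc: "continuous_map (top_of_set U) Y g" if "c \<in> topspace Y" "\<And>x. x \<in> U \<Longrightarrow> g x = c" for Y g and c :: 'z
    by (rule continuous_map_locally_constant) (use that U in \<open>auto intro!: exI[of _ U] simp: openin_open_eq\<close>)
  have "continuous_map (top_of_set U) d.mtopology f" by (rule loc[of 0]) (auto simp: f)
  moreover have "continuous_map (top_of_set U) (compact_open_topology {0} d) (dir_deriv {0} d f)"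
    using CL CL_maps_subset_compact_open by (intro loc[of 0] D) auto
  moreover have "continuous_map (top_of_set U) L.mtopology (dir_deriv {0} d f)"
    using Lip by (intro loc[of 0] D) auto
  ultimately show "MC1 {0} d U f"
    unfolding MC1_def Keller_C1_def using deriv D Lip by auto
qed

text \<open>Values in \<open>{0}\<close> leave only the zero map, so the whole operator space is a
  point.\<close>

lemma connected_component_Lip_maps_zero:
  assumes "invariant_metric {0} d"
  shows "connected_component_of_set (Metric_space.mtopology (Lip_maps {0} d) (Lip_dist d)) 0
    = {0 :: 'e::frechet_space \<Rightarrow> 'v::real_vector}"
proof -
  interpret d: invariant_metric "{0}" d by (rule assms)
  interpret L: Metric_space "Lip_maps {0} d :: ('e \<Rightarrow> 'v) set" "Lip_dist d"
    by (rule d.Metric_space_Lip)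
  have "connected_component_of_set L.mtopology 0 \<subseteq> Lip_maps {0} d"
    using connected_component_of_subset_topspace[of L.mtopology 0] by simp
  moreover have "(Lip_maps {0} d :: ('e \<Rightarrow> 'v) set) \<subseteq> {0}"
    by (auto simp: Lip_maps_def fun_eq_iff image_subset_iff)
  moreover have "0 \<in> connected_component_of_set L.mtopology 0"
    using d.zero_in_Lip_maps by (simp add: connected_component_of_refl)
  ultimately show ?thesis by blast
qed

lemma MC_tower_zero:
  fixes f :: "'e::frechet_space \<Rightarrow> 'e list \<Rightarrow> 'f::real_vector"
  assumes "invariant_metric {0} d" "open U" "\<And>x. x \<in> U \<Longrightarrow> f x = 0"
  shows "MC_tower k {0} d U f"
  using assms
\<comment> \<open>Each stage replaces the metric, the domain and the map, so all three are
  generalised; \<open>induct_nat_012\<close> follows the three equations of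
  \<open>MC_tower\<close>.\<close>
proof (induction k arbitrary: d U f rule: induct_nat_012)
  case 0
  have "MC1 {0} d U f" by (rule MC1_zero(1)) (fact 0)+
  then show ?case unfolding MC_tower.simps MC1_def Keller_C1_def by (elim conjE)
next
  case 1
  then show ?case unfolding MC_tower.simps by (rule MC1_zero(1))
next
  case (ge2 k)
  have "MC_tower (Suc k) (Lip_component {0} d) (\<lambda>g h. Lip_dist d (pull g) (pull h)) V
      (\<lambda>x. push (dir_deriv {0} d f x - dir_deriv {0} d f x0))"
    if V: "open V" "connected V" "V \<subseteq> U" "x0 \<in> V" for V x0
  proof -
    note triv = Lip_component_trivial[OF ge2.prems(1) connected_component_Lip_maps_zero[OF ge2.prems(1)]]
    have D: "dir_deriv {0} d f x = 0" if "x \<in> V" for x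
      by (rule MC1_zero(2)[of d U f]) (fact ge2.prems | use V(3) that in blast)+
    show ?thesis
      unfolding triv(1)
      by (rule ge2.IH(2)[OF triv(2) V(1)]) (use V(4) D in \<open>simp add: push_zero\<close>)
  qed
  moreover have "MC1 {0} d U f" by (rule MC1_zero(1)) (fact ge2.prems)+
  ultimately show ?case unfolding MC_tower.simps by blast
qed

definition locally_affine :: "'e::frechet_space set \<Rightarrow> ('e \<Rightarrow> 'f::frechet_space) \<Rightarrow> bool" where
  "locally_affine U f \<longleftrightarrow> open U \<and> (\<forall>x\<in>U. \<exists>L. affine_germ f x L)"

text \<open>Near each point the derivative has a constant value, so it is continuous for every
  topology on the operator space. The second claim keeps this constancy for the higher
  stages.\<close>

lemma MC1_locally_affine:
  fixes f :: "'e::frechet_space \<Rightarrow> 'f::frechet_space"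
  assumes f: "locally_affine U f"
  defines "D \<equiv> dir_deriv (range embed) embed_dist (\<lambda>x. embed (f x) :: 'e list \<Rightarrow> 'f)"
  shows "MC1 (range embed) embed_dist U (\<lambda>x. embed (f x) :: 'e list \<Rightarrow> 'f)"
    and "x \<in> U \<Longrightarrow> \<exists>W. open W \<and> x \<in> W \<and> W \<subseteq> U \<and> (\<forall>y\<in>W. D y = D x)"
proof -
  have U: "open U" using f by (simp add: locally_affine_def)
  have deriv: "has_dir_deriv (range embed) embed_dist (\<lambda>x. embed (f x) :: 'e list \<Rightarrow> 'f) x h (embed (L h))"
    if "affine_germ f x L" for x h L
    using affine_germ_has_dir_deriv[OF that] by (simp only: has_dir_deriv_embed)
  have D: "D x = (\<lambda>h. embed (L h))" if "affine_germ f x L" for x L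
    unfolding D_def using embed.dir_deriv_eq[OF deriv[OF that]] by auto
  have DL: "D x \<in> Lip_maps (range embed) embed_dist" if x: "x \<in> U" for x
  proof -
    obtain L where L: "affine_germ f x L" using f x by (auto simp: locally_affine_def)
    then show ?thesis unfolding D[OF L] by (intro Lip_maps_embedI) (simp add: affine_germ_def)
  qed
  show W: "\<exists>W. open W \<and> x \<in> W \<and> W \<subseteq> U \<and> (\<forall>y\<in>W. D y = D x)" if x: "x \<in> U" for x
  proof -
    obtain L where L: "affine_germ f x L" using f x by (auto simp: locally_affine_def)
    obtain W where W: "open W" "x \<in> W" "\<forall>y\<in>W. affine_germ f y L"
      using affine_germ_eventually[OF L] by (auto simp: eventually_nhds)
    then have "\<forall>y\<in>W \<inter> U. D y = D x" using D[OF L] D by (metis IntD1)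
    moreover have "open (W \<inter> U)" "x \<in> W \<inter> U" "W \<inter> U \<subseteq> U"
      using W(1,2) x U by auto
    ultimately show ?thesis by blast
  qed
  have loc: "continuous_map (top_of_set U) Y D" if "\<And>x. x \<in> U \<Longrightarrow> D x \<in> topspace Y" for Y
  proof (rule continuous_map_locally_constant)
    show "\<exists>W. openin (top_of_set U) W \<and> x \<in> W \<and> (\<forall>y\<in>W. D y = D x)" if "x \<in> topspace (top_of_set U)" for x
      using W[of x] that U openin_open_eq[OF U] by (metis topspace_euclidean_subtopology)
  qed (use that in simp)
  have "continuous_map (top_of_set U) euclidean f"
    unfolding continuous_map_iff_continuous continuous_on_def
  proof
    fix x assume "x \<in> U"
    then obtain L where "affine_germ f x L" using f by (auto simp: locally_affine_def)
    then have "(f \<longlongrightarrow> f x) (nhds x)" by (rule affine_germ_tendsto)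
    then show "(f \<longlongrightarrow> f x) (at x within U)"
      by (rule tendsto_mono[rotated]) (simp add: at_within_def)
  qed
  then have "continuous_map (top_of_set U) (Metric_space.mtopology (range embed) embed_dist) (embed \<circ> f :: 'e \<Rightarrow> 'e list \<Rightarrow> 'f)"
    by (rule continuous_map_compose) (rule continuous_map_embed)
  moreover have "continuous_map (top_of_set U) (compact_open_topology (range embed) embed_dist) D"
    by (rule loc) (use DL Lip_maps_subset_CL_maps CL_maps_subset_compact_open in blast)
  moreover have "continuous_map (top_of_set U) (Metric_space.mtopology (Lip_maps (range embed) embed_dist) (Lip_dist embed_dist)) D"
    by (rule loc) (use DL in simp)
  moreover have "\<exists>v. has_dir_deriv (range embed) embed_dist (\<lambda>x. embed (f x) :: 'e list \<Rightarrow> 'f) x h v" if "x \<in> U" for x h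
    using f that deriv unfolding locally_affine_def by metis
  ultimately show "MC1 (range embed) embed_dist U (\<lambda>x. embed (f x) :: 'e list \<Rightarrow> 'f)"
    using DL unfolding MC1_def Keller_C1_def D_def comp_def by blast
qed

text \<open>Every class with k >= 1 includes \<open>MC1\<close>, which gives one direction. For the
  other, a locally constant derivative is constant on each connected \<open>V\<close>, so the second
  stage is already about the zero map. In particular the class is the same for all k >= 1.\<close>

theorem MC_on_iff_locally_affine:
  fixes f :: "'e::frechet_space \<Rightarrow> 'f::frechet_space"
  assumes "1 \<le> k"
  shows "MC_on k U f \<longleftrightarrow> locally_affine U f"
proof
  assume MC: "MC_on k U f"
  then have "MC1 (range embed) embed_dist U (\<lambda>x. embed (f x) :: 'e list \<Rightarrow> 'f)"
    using assms by (cases k rule: nat.exhaust; cases "k - 1") (auto simp: MC_on_def)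
  then show "locally_affine U f"
    using MC1_imp_affine_germ MC by (auto simp: locally_affine_def MC_on_def)
next
  assume f: "locally_affine U f"
  define D where "D = dir_deriv (range embed) embed_dist (\<lambda>x. embed (f x) :: 'e list \<Rightarrow> 'f)"
  note MC1 = MC1_locally_affine[OF f, folded D_def]
  note triv = Lip_component_trivial[OF invariant_metric_embed connected_component_Lip_maps_embed]
  have tower: "MC_tower (Suc j) (Lip_component (range embed) embed_dist) (\<lambda>g h. Lip_dist embed_dist (pull g) (pull h)) V
      (\<lambda>x. push (D x - D x0) :: 'e list \<Rightarrow> 'f)"
    if V: "open V" "connected V" "V \<subseteq> U" "x0 \<in> V" for V x0 j
  proof -
    have "D x = D x0" if "x \<in> V" for x
    proof (rule connected_local_const[OF V(2) that V(4)])
      show "\<forall>a\<in>V. \<forall>\<^sub>F b in at a within V. D a = D b"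
      proof
        fix a assume "a \<in> V"
        then obtain W where "open W" "a \<in> W" "\<forall>y\<in>W. D y = D a" using MC1(2) V(3) by blast
        then show "\<forall>\<^sub>F b in at a within V. D a = D b"
          unfolding eventually_at_filter eventually_nhds by metis
      qed
    qed
    then show ?thesis
      unfolding triv(1) by (intro MC_tower_zero triv(2) V(1)) (simp add: push_zero)
  qed
  have "MC_tower k (range embed) embed_dist U (\<lambda>x. embed (f x) :: 'e list \<Rightarrow> 'f)"
  proof (cases k)
    case (Suc j)
    then show ?thesis using MC1(1) tower by (cases j) (auto simp: D_def)
  qed (use assms in simp)
  then show "MC_on k U f" using f by (simp add: MC_on_def locally_affine_def)
qed

subsection \<open>Calculus of affine germs\<close>

lemma affine_germ_Lip_linear: "affine_germ f x L \<Longrightarrow> Lip_linear L"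
  by (simp add: affine_germ_def)

lemma affine_germ_linear: "affine_germ f x L \<Longrightarrow> linear L"
  by (simp add: affine_germ_def Lip_linear_def)

lemma affine_germ_cong:
  assumes "affine_germ f x L" "\<forall>\<^sub>F y in nhds x. f y = g y"
  shows "affine_germ g x L"
proof -
  have "f x = g x" using assms(2) by (rule eventually_nhds_x_imp_x)
  have "\<forall>\<^sub>F y in nhds x. f y = f x + L (y - x)" using assms(1) by (simp add: affine_germ_def)
  with assms(2) have "\<forall>\<^sub>F y in nhds x. g y = g x + L (y - x)"
    unfolding \<open>f x = g x\<close> by eventually_elim simp
  with assms(1) show ?thesis by (simp add: affine_germ_def)
qed

lemma affine_germ_ident: "affine_germ (\<lambda>x. x) x (\<lambda>x. x)"
  by (simp add: affine_germ_def Lip_linear_ident)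

lemma affine_germ_compose:
  assumes f: "affine_germ f x L" and g: "affine_germ g (f x) H"
  shows "affine_germ (g \<circ> f) x (H \<circ> L)"
proof -
  have "\<forall>\<^sub>F y in nhds x. f y = f x + L (y - x)" using f by (simp add: affine_germ_def)
  moreover have "\<forall>\<^sub>F y in nhds x. g (f y) = g (f x) + H (f y - f x)"
    using g affine_germ_tendsto[OF f] by (auto simp: affine_germ_def filterlim_iff)
  ultimately have "\<forall>\<^sub>F y in nhds x. (g \<circ> f) y = (g \<circ> f) x + (H \<circ> L) (y - x)"
    by eventually_elim simp
  then show ?thesis
    using f g by (simp add: affine_germ_def Lip_linear_compose)
qed

lemma affine_germ_map_prod:
  assumes "affine_germ f x L" "affine_germ g y H"
  shows "affine_germ (map_prod f g) (x, y) (map_prod L H)"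
proof -
  have "\<forall>\<^sub>F z in nhds (x, y). f (fst z) = f x + L (fst z - x)"
    unfolding nhds_prod by (rule eventually_compose_filterlim[OF _ filterlim_fst]) (use assms in \<open>simp add: affine_germ_def\<close>)
  moreover have "\<forall>\<^sub>F z in nhds (x, y). g (snd z) = g y + H (snd z - y)"
    unfolding nhds_prod by (rule eventually_compose_filterlim[OF _ filterlim_snd]) (use assms in \<open>simp add: affine_germ_def\<close>)
  ultimately have "\<forall>\<^sub>F z in nhds (x, y). map_prod f g z = map_prod f g (x, y) + map_prod L H (z - (x, y))"
    by eventually_elim (simp add: prod_eq_iff)
  then show ?thesis using assms by (simp add: affine_germ_def Lip_linear_map_prod)
qed

text \<open>The chain rule for the affine insertion of y at fixed x, whose linear part is k -> (0,
  k).\<close>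

lemma affine_germ_slice:
  assumes "affine_germ f (x, y) L"
  shows "affine_germ (\<lambda>z. f (x, z)) y (\<lambda>k. L (0, k))"
proof -
  have "affine_germ (\<lambda>z. (x, z)) y (\<lambda>k. (0, k))"
    by (simp add: affine_germ_def Lip_linear_Pair_zero)
  from affine_germ_compose[OF this assms] show ?thesis by (simp add: comp_def)
qed

subsection \<open>Charts\<close>

abbreviation chart_inv :: "('m, 'e) chart \<Rightarrow> 'e \<Rightarrow> 'm" where
  "chart_inv c \<equiv> inv_into (fst c) (snd c)"

lemma continuous_on_open_tendsto_nhds:
  assumes "open S" "continuous_on S f" "x \<in> S"
  shows "(f \<longlongrightarrow> f x) (nhds x)"
proof (rule topological_tendstoI)
  fix T assume T: "open T" "f x \<in> T"
  have "open (f -` T \<inter> S)"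
    using assms T continuous_on_open_vimage by blast
  with assms T show "\<forall>\<^sub>F y in nhds x. f y \<in> T"
    unfolding eventually_nhds by (intro exI[of _ "f -` T \<inter> S"]) auto
qed

lemma is_chart_inj_on: "is_chart c \<Longrightarrow> inj_on (snd c) (fst c)"
  unfolding is_chart_def homeomorphism_def by (metis inj_on_inverseI)

lemma chart_inv_chart: "is_chart c \<Longrightarrow> p \<in> fst c \<Longrightarrow> chart_inv c (snd c p) = p"
  by (rule inv_into_f_f[OF is_chart_inj_on])

lemma is_chart_tendsto:
  assumes "is_chart c" "p \<in> fst c"
  shows "(snd c \<longlongrightarrow> snd c p) (nhds p)" "(chart_inv c \<longlongrightarrow> p) (nhds (snd c p))"
proof -
  have "continuous_on (fst c) (snd c)" "continuous_on (snd c ` fst c) (chart_inv c)"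
    "open (fst c)" "open (snd c ` fst c)"
    using assms(1) by (auto simp: is_chart_def homeomorphism_def)
  then show "(snd c \<longlongrightarrow> snd c p) (nhds p)" "(chart_inv c \<longlongrightarrow> p) (nhds (snd c p))"
    using continuous_on_open_tendsto_nhds[of "fst c" "snd c" p] assms(2)
      continuous_on_open_tendsto_nhds[of "snd c ` fst c" "chart_inv c" "snd c p"]
    by (simp_all add: chart_inv_chart[OF assms])
qed

lemma is_chart_eventually:
  assumes "is_chart c" "p \<in> fst c"
  shows "\<forall>\<^sub>F q in nhds p. q \<in> fst c" "\<forall>\<^sub>F u in nhds (snd c p). u \<in> snd c ` fst c"
  using assms by (auto simp: is_chart_def intro!: eventually_nhds_in_open)

lemma chart_chart_inv: "u \<in> snd c ` fst c \<Longrightarrow> snd c (chart_inv c u) = u"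
  by (rule f_inv_into_f)

lemma chart_inv_in: "u \<in> snd c ` fst c \<Longrightarrow> chart_inv c u \<in> fst c"
  by (rule inv_into_into)

lemma is_chart_open_image:
  assumes "is_chart c" "open T"
  shows "open (snd c ` (fst c \<inter> T))"
proof -
  have "snd c ` (fst c \<inter> T) = snd c ` fst c \<inter> chart_inv c -` T"
    using chart_inv_chart[OF assms(1)] by auto
  moreover have "open (snd c ` fst c \<inter> chart_inv c -` T)"
    using assms by (intro continuous_open_preimage) (auto simp: is_chart_def homeomorphism_def)
  ultimately show ?thesis by simp
qed

lemma loc_dom_mem: "p \<in> fst c \<Longrightarrow> \<phi> p \<in> fst d \<Longrightarrow> snd c p \<in> loc_dom c d \<phi>"
  by (auto simp: loc_dom_def)

lemma loc_rep_apply: "is_chart c \<Longrightarrow> p \<in> fst c \<Longrightarrow> loc_rep c d \<phi> (snd c p) = snd d (\<phi> p)"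
  by (simp add: loc_rep_def chart_inv_chart)

lemma open_loc_dom:
  assumes "is_chart c" "is_chart d" "continuous_on UNIV \<phi>"
  shows "open (loc_dom c d \<phi>)"
  unfolding loc_dom_def
  by (rule is_chart_open_image[OF assms(1)]) (use assms in \<open>auto simp: is_chart_def intro: open_vimage\<close>)

text \<open>The chain rule through an intermediate chart. Local expressions are total functions, and
  they compose correctly only where \<phi> takes values in the domain of \<open>d\<close>;
  continuity of \<phi> at p secures this near p.\<close>

lemma loc_rep_germ_compose:
  assumes c: "is_chart c" "p \<in> fst c" and d: "is_chart d" "\<phi> p \<in> fst d"
    and \<phi>: "(\<phi> \<longlongrightarrow> \<phi> p) (nhds p)"
    and L: "affine_germ (loc_rep c d \<phi>) (snd c p) L"
    and H: "affine_germ (loc_rep d e \<theta>) (snd d (\<phi> p)) H"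
  shows "affine_germ (loc_rep c e (\<theta> \<circ> \<phi>)) (snd c p) (H \<circ> L)"
proof -
  have "affine_germ (loc_rep d e \<theta> \<circ> loc_rep c d \<phi>) (snd c p) (H \<circ> L)"
    using L H by (intro affine_germ_compose) (simp_all add: loc_rep_apply[OF c])
  moreover have "\<forall>\<^sub>F u in nhds (snd c p). \<phi> (chart_inv c u) \<in> fst d"
  proof -
    have "\<forall>\<^sub>F q in nhds p. \<phi> q \<in> fst d"
      using \<phi> is_chart_eventually(1)[OF d] by (auto simp: filterlim_iff)
    then show ?thesis using is_chart_tendsto(2)[OF c] by (auto simp: filterlim_iff)
  qed
  then have "\<forall>\<^sub>F u in nhds (snd c p). (loc_rep d e \<theta> \<circ> loc_rep c d \<phi>) u = loc_rep c e (\<theta> \<circ> \<phi>) u"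
    by eventually_elim (simp add: loc_rep_def chart_inv_chart[OF d(1)])
  ultimately show ?thesis by (rule affine_germ_cong)
qed

lemma tendsto_id_nhds: "(id \<longlongrightarrow> id p) (nhds p)"
  by (simp add: id_def filterlim_ident)

lemma loc_rep_germ_self:
  assumes "is_chart c" "p \<in> fst c"
  shows "affine_germ (loc_rep c c id) (snd c p) (\<lambda>x. x)"
proof (rule affine_germ_cong[OF affine_germ_ident])
  show "\<forall>\<^sub>F u in nhds (snd c p). u = loc_rep c c id u"
    using is_chart_eventually(2)[OF assms] by eventually_elim (simp add: loc_rep_def chart_chart_inv)
qed

lemma charts_at_is_chart: "c \<in> charts_at k \<A> p \<Longrightarrow> is_chart c \<and> p \<in> fst c"
  by (simp add: charts_at_def charts_def)

lemma MC_on_germ: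
  "MC_on k U f \<Longrightarrow> 1 \<le> k \<Longrightarrow> x \<in> U \<Longrightarrow> \<exists>L. affine_germ f x L"
  by (simp add: MC_on_iff_locally_affine locally_affine_def)

lemma MC_manifold_charts: "MC_manifold k \<A> \<Longrightarrow> \<A> \<subseteq> charts k \<A>"
  by (auto simp: MC_manifold_def charts_def)

lemma MC_manifold_chart_at:
  assumes "MC_manifold k \<A>"
  obtains c where "c \<in> \<A>" "p \<in> fst c" "c \<in> charts_at k \<A> p"
proof -
  have "p \<in> (\<Union>c\<in>\<A>. fst c)" using assms by (simp add: MC_manifold_def)
  then obtain c where "c \<in> \<A>" "p \<in> fst c" by blast
  then show ?thesis using that[of c] subsetD[OF MC_manifold_charts[OF assms], of c] by (simp add: charts_at_def)
qed

text \<open>Membership in the maximal atlas gives compatibility with the charts of the given atlas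
  only. So the change from \<open>c\<close> to \<open>d\<close> passes through a chart
  \<open>e\<close> of that atlas around p.\<close>

lemma transition_germ_ex:
  assumes A: "MC_manifold k \<A>" and k: "1 \<le> k"
    and c: "c \<in> charts_at k \<A> p" and d: "d \<in> charts_at k \<A> p"
  shows "\<exists>L. affine_germ (loc_rep c d id) (snd c p) L"
proof -
  obtain e where e: "e \<in> \<A>" "p \<in> fst e" "e \<in> charts_at k \<A> p" using MC_manifold_chart_at[OF A] .
  have "MC_on k (loc_dom c e id) (loc_rep c e id)" "MC_on k (loc_dom e d id) (loc_rep e d id)"
    using c d e(1) by (auto simp: charts_at_def charts_def)
  moreover have "snd c p \<in> loc_dom c e id" "snd e p \<in> loc_dom e d id"
    using c d e by (auto intro!: loc_dom_mem simp: charts_at_def)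
  ultimately obtain L H where "affine_germ (loc_rep c e id) (snd c p) L" "affine_germ (loc_rep e d id) (snd e p) H"
    using MC_on_germ[OF _ k] by blast
  then have "affine_germ (loc_rep c d (id \<circ> id)) (snd c p) (H \<circ> L)"
    using charts_at_is_chart[OF c] charts_at_is_chart[OF e(3)]
    by (intro loc_rep_germ_compose[where d = e, OF _ _ _ _ tendsto_id_nhds]) simp_all
  then show ?thesis by auto
qed

section \<open>Derivatives of chart changes\<close>

definition transition ::
    "('m, 'e::frechet_space) chart \<Rightarrow> ('m, 'e) chart \<Rightarrow> 'm \<Rightarrow> 'e \<Rightarrow> 'e" where
  "transition c d p = fderiv (loc_rep c d id) (snd c p)"

lemma transition_germ:
  assumes "MC_manifold k \<A>" "1 \<le> k" "c \<in> charts_at k \<A> p" "d \<in> charts_at k \<A> p"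
  shows "affine_germ (loc_rep c d id) (snd c p) (transition c d p)"
  using transition_germ_ex[OF assms] affine_germ_fderiv unfolding transition_def by metis

lemma transition_linear:
  assumes "MC_manifold k \<A>" "1 \<le> k" "c \<in> charts_at k \<A> p" "d \<in> charts_at k \<A> p"
  shows "linear (transition c d p)"
  using affine_germ_linear[OF transition_germ[OF assms]] .

lemma transition_self:
  assumes "c \<in> charts_at k \<A> p"
  shows "transition c c p = (\<lambda>x. x)"
  unfolding transition_def
  using affine_germ_fderiv[OF loc_rep_germ_self] charts_at_is_chart[OF assms] by blast

text \<open>The cocycle rule: both sides are the linear part of one and the same germ.\<close>

lemma transition_transition:
  assumes A: "MC_manifold k \<A>" "1 \<le> k"
    and c: "c \<in> charts_at k \<A> p" and d: "d \<in> charts_at k \<A> p" and e: "e \<in> charts_at k \<A> p"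
  shows "transition d e p (transition c d p v) = transition c e p v"
proof -
  have "affine_germ (loc_rep c e (id \<circ> id)) (snd c p) (transition d e p \<circ> transition c d p)"
    using charts_at_is_chart[OF c] charts_at_is_chart[OF d] transition_germ[OF A c d] transition_germ[OF A d e]
    by (intro loc_rep_germ_compose[where d = d, OF _ _ _ _ tendsto_id_nhds]) simp_all
  then have "affine_germ (loc_rep c e id) (snd c p) (transition d e p \<circ> transition c d p)"
    by simp
  from affine_germ_unique[OF this transition_germ[OF A c e]] show ?thesis
    by (metis comp_apply)
qed

subsection \<open>Tangent spaces\<close>

lemma tangent_space_iff:
  "\<xi> \<in> tangent_space k \<A> p \<longleftrightarrow> (\<forall>c. c \<notin> charts_at k \<A> p \<longrightarrow> \<xi> c = 0) \<and>
    (\<forall>c\<in>charts_at k \<A> p. \<forall>d\<in>charts_at k \<A> p. \<xi> d = transition c d p (\<xi> c))"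
  by (simp add: tangent_space_def transition_def)

text \<open>The inverse of evaluation at the chart \<open>c\<close>. The value 0 away from the
  charts around p follows the convention of \<open>tangent_space\<close>.\<close>

definition tangent_lift ::
    "nat \<Rightarrow> ('m::topological_space, 'e::frechet_space) chart set \<Rightarrow> 'm \<Rightarrow> ('m, 'e) chart \<Rightarrow> 'e \<Rightarrow> ('m, 'e) chart \<Rightarrow> 'e"
  where "tangent_lift k \<A> p c v = (\<lambda>d. if d \<in> charts_at k \<A> p then transition c d p v else 0)"

lemma tangent_lift_in:
  assumes "MC_manifold k \<A>" "1 \<le> k" "c \<in> charts_at k \<A> p"
  shows "tangent_lift k \<A> p c v \<in> tangent_space k \<A> p"
  using transition_transition[OF assms(1,2,3)] by (simp add: tangent_space_iff tangent_lift_def)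

lemma tangent_lift_apply: "c \<in> charts_at k \<A> p \<Longrightarrow> tangent_lift k \<A> p c v c = v"
  by (simp add: tangent_lift_def transition_self)

lemma tangent_lift_eval:
  assumes "\<xi> \<in> tangent_space k \<A> p" "c \<in> charts_at k \<A> p"
  shows "tangent_lift k \<A> p c (\<xi> c) = \<xi>"
proof
  fix d
  show "tangent_lift k \<A> p c (\<xi> c) d = \<xi> d"
    using assms unfolding tangent_space_iff tangent_lift_def by (metis (full_types))
qed

lemma tangent_space_eqI:
  assumes "\<xi> \<in> tangent_space k \<A> p" "\<eta> \<in> tangent_space k \<A> p" "c \<in> charts_at k \<A> p" "\<xi> c = \<eta> c"
  shows "\<xi> = \<eta>"
  using tangent_lift_eval assms by metis

lemma linear_tangent_lift:
  assumes "MC_manifold k \<A>" "1 \<le> k" "c \<in> charts_at k \<A> p"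
  shows "linear (tangent_lift k \<A> p c)"
proof (rule linearI)
  fix v w and r :: real
  show "tangent_lift k \<A> p c (v + w) = tangent_lift k \<A> p c v + tangent_lift k \<A> p c w"
    using linear_add[OF transition_linear[OF assms]] by (auto simp: tangent_lift_def fun_eq_iff)
  show "tangent_lift k \<A> p c (r *\<^sub>R v) = r *\<^sub>R tangent_lift k \<A> p c v"
    using linear_scale[OF transition_linear[OF assms]]
    by (auto simp: tangent_lift_def fun_eq_iff scaleR_fun_def)
qed

lemma tangent_space_eq_range:
  assumes "MC_manifold k \<A>" "1 \<le> k" "c \<in> charts_at k \<A> p"
  shows "tangent_space k \<A> p = range (tangent_lift k \<A> p c)"
proof
  show "tangent_space k \<A> p \<subseteq> range (tangent_lift k \<A> p c)"
    using tangent_lift_eval[OF _ assms(3)] by (metis rangeI subsetI)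
  show "range (tangent_lift k \<A> p c) \<subseteq> tangent_space k \<A> p"
    using tangent_lift_in[OF assms] by blast
qed

lemma subspace_tangent_space:
  assumes "MC_manifold k \<A>" "1 \<le> k"
  shows "subspace (tangent_space k \<A> p)"
proof -
  obtain c where c: "c \<in> charts_at k \<A> p" using MC_manifold_chart_at[OF assms(1)] by metis
  show ?thesis
    unfolding tangent_space_eq_range[OF assms c]
    by (rule linear_subspace_image[OF linear_tangent_lift[OF assms c] subspace_UNIV])
qed

lemma eventually_line_zero:
  "eventually P (nhds (x::'a::frechet_space)) \<Longrightarrow> \<forall>\<^sub>F t in at 0. P (x + t *\<^sub>R h)"
  using eventually_line[of P x 0 h] by simp

subsection \<open>Tangent maps and transversality in charts\<close>

lemma MC_map_germ:
  assumes "MC_map k \<A> \<B> \<phi>" "1 \<le> k" "c \<in> charts_at k \<A> p" "d \<in> charts_at k \<B> (\<phi> p)"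
  shows "affine_germ (loc_rep c d \<phi>) (snd c p) (fderiv (loc_rep c d \<phi>) (snd c p))"
proof -
  have "MC_on k (loc_dom c d \<phi>) (loc_rep c d \<phi>)"
    using assms by (simp add: MC_map_def charts_at_def)
  moreover have "snd c p \<in> loc_dom c d \<phi>"
    using assms by (auto intro: loc_dom_mem simp: charts_at_def)
  ultimately obtain L where "affine_germ (loc_rep c d \<phi>) (snd c p) L"
    using MC_on_germ assms(2) by blast
  then show ?thesis using affine_germ_fderiv by metis
qed

lemma MC_map_tendsto: "MC_map k \<A> \<B> \<phi> \<Longrightarrow> (\<phi> \<longlongrightarrow> \<phi> p) (nhds p)"
  unfolding MC_map_def using continuous_on_open_tendsto_nhds[OF open_UNIV] by blast

text \<open>Independence of the source chart. Together with \<open>MC_map_chain_right\<close> for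
  the target chart it makes the condition that defines \<open>tangent_map\<close> consistent over
  all pairs of charts.\<close>

lemma MC_map_chain_left:
  assumes A: "MC_manifold k \<A>" and k: "1 \<le> k" and \<phi>: "MC_map k \<A> \<B> \<phi>"
    and c: "c \<in> charts_at k \<A> p" and c': "c' \<in> charts_at k \<A> p" and d: "d \<in> charts_at k \<B> (\<phi> p)"
  shows "fderiv (loc_rep c' d \<phi>) (snd c' p) (transition c c' p v) = fderiv (loc_rep c d \<phi>) (snd c p) v"
proof -
  have "affine_germ (loc_rep c d (\<phi> \<circ> id)) (snd c p)
      (fderiv (loc_rep c' d \<phi>) (snd c' p) \<circ> transition c c' p)"
    using charts_at_is_chart[OF c] charts_at_is_chart[OF c'] transition_germ[OF A k c c'] MC_map_germ[OF \<phi> k c' d]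
    by (intro loc_rep_germ_compose[where d = c', OF _ _ _ _ tendsto_id_nhds]) simp_all
  then have "affine_germ (loc_rep c d \<phi>) (snd c p)
      (fderiv (loc_rep c' d \<phi>) (snd c' p) \<circ> transition c c' p)" by simp
  then show ?thesis using affine_germ_fderiv by fastforce
qed

lemma MC_map_chain_right:
  assumes B: "MC_manifold k \<B>" and k: "1 \<le> k" and \<phi>: "MC_map k \<A> \<B> \<phi>"
    and c: "c \<in> charts_at k \<A> p" and d: "d \<in> charts_at k \<B> (\<phi> p)" and d': "d' \<in> charts_at k \<B> (\<phi> p)"
  shows "transition d d' (\<phi> p) (fderiv (loc_rep c d \<phi>) (snd c p) v) = fderiv (loc_rep c d' \<phi>) (snd c p) v"
proof -
  have "affine_germ (loc_rep c d' (id \<circ> \<phi>)) (snd c p)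
      (transition d d' (\<phi> p) \<circ> fderiv (loc_rep c d \<phi>) (snd c p))"
    using charts_at_is_chart[OF c] charts_at_is_chart[OF d] transition_germ[OF B k d d'] MC_map_germ[OF \<phi> k c d]
    by (intro loc_rep_germ_compose[where d = d, OF _ _ _ _ MC_map_tendsto[OF \<phi>]]) simp_all
  then have "affine_germ (loc_rep c d' \<phi>) (snd c p)
      (transition d d' (\<phi> p) \<circ> fderiv (loc_rep c d \<phi>) (snd c p))" by simp
  then show ?thesis using affine_germ_fderiv by fastforce
qed

text \<open>This justifies the definite description in \<open>tangent_map\<close>. The derivative in
  one pair of charts, lifted to a compatible family, satisfies the condition for all pairs by the
  two chain rules. It is the only solution because a tangent vector is determined by its value in a
  single chart.\<close>

lemma tangent_map_props:
  assumes A: "MC_manifold k \<A>" and B: "MC_manifold k \<B>" and k: "1 \<le> k" and \<phi>: "MC_map k \<A> \<B> \<phi>"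
    and c: "c \<in> charts_at k \<A> p" and d: "d \<in> charts_at k \<B> (\<phi> p)" and \<xi>: "\<xi> \<in> tangent_space k \<A> p"
  shows "tangent_map k \<A> \<B> \<phi> p \<xi> \<in> tangent_space k \<B> (\<phi> p)"
    and "tangent_map k \<A> \<B> \<phi> p \<xi> d = fderiv (loc_rep c d \<phi>) (snd c p) (\<xi> c)"
proof -
  define \<eta> where "\<eta> = tangent_lift k \<B> (\<phi> p) d (fderiv (loc_rep c d \<phi>) (snd c p) (\<xi> c))"
  define P where "P = (\<lambda>\<eta>. \<eta> \<in> tangent_space k \<B> (\<phi> p) \<and>
    (\<forall>c\<in>charts_at k \<A> p. \<forall>d\<in>charts_at k \<B> (\<phi> p). \<eta> d = fderiv (loc_rep c d \<phi>) (snd c p) (\<xi> c)))"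
  have \<eta>: "\<eta> \<in> tangent_space k \<B> (\<phi> p)"
    unfolding \<eta>_def by (rule tangent_lift_in[OF B k d])
  have "\<eta> d' = fderiv (loc_rep c' d' \<phi>) (snd c' p) (\<xi> c')"
    if c': "c' \<in> charts_at k \<A> p" and d': "d' \<in> charts_at k \<B> (\<phi> p)" for c' d'
  proof -
    have "\<eta> d' = transition d d' (\<phi> p) (fderiv (loc_rep c d \<phi>) (snd c p) (\<xi> c))"
      using d' by (simp add: \<eta>_def tangent_lift_def)
    also have "\<dots> = fderiv (loc_rep c d' \<phi>) (snd c p) (\<xi> c)"
      by (rule MC_map_chain_right[OF B k \<phi> c d d'])
    also have "\<dots> = fderiv (loc_rep c' d' \<phi>) (snd c' p) (transition c c' p (\<xi> c))"
      by (rule MC_map_chain_left[OF A k \<phi> c c' d', symmetric])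
    also have "transition c c' p (\<xi> c) = \<xi> c'"
      using \<xi> c c' unfolding tangent_space_iff by metis
    finally show ?thesis .
  qed
  with \<eta> have P: "P \<eta>" unfolding P_def by blast
  moreover have "\<eta>' = \<eta>" if "P \<eta>'" for \<eta>'
  proof (rule tangent_space_eqI[OF _ \<eta> d])
    show "\<eta>' \<in> tangent_space k \<B> (\<phi> p)" using that by (simp add: P_def)
    show "\<eta>' d = \<eta> d" using that P c d unfolding P_def by metis
  qed
  ultimately have "tangent_map k \<A> \<B> \<phi> p \<xi> = \<eta>"
    unfolding tangent_map_def P_def[symmetric] by (rule the_equality)
  with P c d show "tangent_map k \<A> \<B> \<phi> p \<xi> \<in> tangent_space k \<B> (\<phi> p)"
    "tangent_map k \<A> \<B> \<phi> p \<xi> d = fderiv (loc_rep c d \<phi>) (snd c p) (\<xi> c)"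
    unfolding P_def by blast+
qed

section \<open>The tangent space of the submanifold\<close>

lemma submanifold_chart_charts_at:
  "submanifold_chart k \<B> S c F1 F2 \<Longrightarrow> q \<in> fst c \<Longrightarrow> c \<in> charts_at k \<B> q"
  by (simp add: submanifold_chart_def charts_at_def)

lemma submanifold_chart_subspace: "submanifold_chart k \<B> S c F1 F2 \<Longrightarrow> subspace F1"
  by (simp add: submanifold_chart_def topological_direct_sum_def)

lemma submanifold_chart_mem:
  assumes "submanifold_chart k \<B> S c F1 F2" "q \<in> S" "q \<in> fst c"
  shows "snd c q \<in> F1"
proof -
  obtain G1 where "openin (top_of_set F1) G1" "snd c ` (S \<inter> fst c) = G1"
    using assms(1) by (auto simp: submanifold_chart_def)
  then show ?thesis using assms(2,3) openin_imp_subset by blast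
qed

text \<open>From q one can move a short way along v in \<open>F1\<close> without leaving S, since
  the image of S in the chart is open in \<open>F1\<close>. The chart \<open>d\<close> sends both
  end points into \<open>H1\<close>, and as the transition map is affine near q, their difference is
  exactly t times the image of v; no limit is taken.\<close>

lemma transition_submanifold:
  fixes \<B> :: "('q::{t2_space,second_countable_topology}, 'f::frechet_space) chart set"
  assumes B: "MC_manifold k \<B>" and k: "1 \<le> k"
    and c: "submanifold_chart k \<B> S c F1 F2" "q \<in> fst c"
    and d: "submanifold_chart k \<B> S d H1 H2" "q \<in> fst d"
    and q: "q \<in> S" and v: "v \<in> F1"
  shows "transition c d q v \<in> H1"
proof -
  note c_at = submanifold_chart_charts_at[OF c] and d_at = submanifold_chart_charts_at[OF d]
  note cc = charts_at_is_chart[OF c_at, THEN conjunct1]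
  note F1 = submanifold_chart_subspace[OF c(1)] and H1 = submanifold_chart_subspace[OF d(1)]
  let ?T = "transition c d q"
  have T: "affine_germ (loc_rep c d id) (snd c q) ?T" by (rule transition_germ[OF B k c_at d_at])
  interpret T: linear ?T by (rule affine_germ_linear[OF T])
  obtain G1 where G1: "openin (top_of_set F1) G1" "snd c ` (S \<inter> fst c) = G1"
    using c(1) by (auto simp: submanifold_chart_def)
  then obtain U where U: "open U" "G1 = F1 \<inter> U" by (auto simp: openin_open)
  have cq: "snd c q \<in> G1" using G1(2) q c(2) by blast
  have "\<forall>\<^sub>F u in nhds (snd c q). u \<in> U \<and> chart_inv c u \<in> fst d \<and>
      loc_rep c d id u = loc_rep c d id (snd c q) + ?T (u - snd c q)"
  proof (intro eventually_conj)
    show "\<forall>\<^sub>F u in nhds (snd c q). u \<in> U"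
      using U cq by (auto intro: eventually_nhds_in_open)
    show "\<forall>\<^sub>F u in nhds (snd c q). chart_inv c u \<in> fst d"
      by (rule eventually_compose_filterlim[OF is_chart_eventually(1) is_chart_tendsto(2)])
        (use cc c(2) charts_at_is_chart[OF d_at] in auto)
    show "\<forall>\<^sub>F u in nhds (snd c q). loc_rep c d id u = loc_rep c d id (snd c q) + ?T (u - snd c q)"
      using T by (simp add: affine_germ_def)
  qed
  then have "\<forall>\<^sub>F t in at 0. snd c q + t *\<^sub>R v \<in> U \<and> chart_inv c (snd c q + t *\<^sub>R v) \<in> fst d \<and>
      loc_rep c d id (snd c q + t *\<^sub>R v) = loc_rep c d id (snd c q) + ?T (snd c q + t *\<^sub>R v - snd c q)"
    by (rule eventually_line_zero)
  moreover have "\<forall>\<^sub>F t in at (0::real). t \<noteq> 0" by (simp add: eventually_at_filter)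
  ultimately have "\<forall>\<^sub>F t in at (0::real). t \<noteq> 0 \<and> snd c q + t *\<^sub>R v \<in> U \<and> chart_inv c (snd c q + t *\<^sub>R v) \<in> fst d \<and>
      loc_rep c d id (snd c q + t *\<^sub>R v) = loc_rep c d id (snd c q) + ?T (snd c q + t *\<^sub>R v - snd c q)"
    by eventually_elim blast
  then obtain t where t: "t \<noteq> 0" "snd c q + t *\<^sub>R v \<in> U" "chart_inv c (snd c q + t *\<^sub>R v) \<in> fst d"
      "loc_rep c d id (snd c q + t *\<^sub>R v) = loc_rep c d id (snd c q) + ?T (snd c q + t *\<^sub>R v - snd c q)"
    using eventually_happens'[OF at_neq_bot] by blast
  have "snd c q + t *\<^sub>R v \<in> G1"
    using t(2) cq U(2) F1 v by (auto intro: subspace_add subspace_scale)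
  then obtain s where s: "s \<in> S" "s \<in> fst c" "snd c q + t *\<^sub>R v = snd c s"
    using G1(2) by auto
  have sd: "s \<in> fst d" using t(3) s chart_inv_chart[OF cc] by simp
  have "loc_rep c d id (snd c s) = snd d s" "loc_rep c d id (snd c q) = snd d q"
    using loc_rep_apply[OF cc s(2), of d id] loc_rep_apply[OF cc c(2), of d id] by (simp_all only: id_apply)
  moreover have "?T (snd c q + t *\<^sub>R v - snd c q) = t *\<^sub>R ?T v"
    by (simp only: add_diff_cancel_left' T.scaleR)
  ultimately have "snd d s = snd d q + t *\<^sub>R ?T v"
    using t(4) unfolding s(3)[symmetric] by (metis s(3))
  moreover have "snd d s \<in> H1" "snd d q \<in> H1"
    using submanifold_chart_mem[OF d(1)] s sd q d(2) by auto
  ultimately have "t *\<^sub>R ?T v \<in> H1"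
    using subspace_diff[OF H1, of "snd d s" "snd d q"] by simp
  then have "(1 / t) *\<^sub>R (t *\<^sub>R ?T v) \<in> H1" by (rule subspace_scale[OF H1])
  then show ?thesis using t(1) by simp
qed

text \<open>The definition asks for some submanifold chart; \<open>transition_submanifold\<close>
  carries the condition from that chart to any other.\<close>

lemma sub_tangent_space_eq:
  fixes \<B> :: "('q::{t2_space,second_countable_topology}, 'f::frechet_space) chart set"
  assumes B: "MC_manifold k \<B>" and k: "1 \<le> k"
    and d: "submanifold_chart k \<B> S d F1 F2" "q \<in> fst d" and q: "q \<in> S"
  shows "sub_tangent_space k \<B> S q = {\<xi> \<in> tangent_space k \<B> q. \<xi> d \<in> F1}"
proof (intro set_eqI iffI)
  fix \<xi> assume "\<xi> \<in> sub_tangent_space k \<B> S q"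
  then obtain c H1 H2 where \<xi>: "\<xi> \<in> tangent_space k \<B> q" and c: "q \<in> fst c" "submanifold_chart k \<B> S c H1 H2" "\<xi> c \<in> H1"
    by (auto simp: sub_tangent_space_def)
  have "\<xi> d = transition c d q (\<xi> c)"
    using \<xi> submanifold_chart_charts_at[OF c(2,1)] submanifold_chart_charts_at[OF d]
    unfolding tangent_space_iff by blast
  then have "\<xi> d \<in> F1" using transition_submanifold[OF B k c(2,1) d q c(3)] by simp
  with \<xi> show "\<xi> \<in> {\<xi> \<in> tangent_space k \<B> q. \<xi> d \<in> F1}" by simp
next
  fix \<xi> assume "\<xi> \<in> {\<xi> \<in> tangent_space k \<B> q. \<xi> d \<in> F1}"
  then show "\<xi> \<in> sub_tangent_space k \<B> S q"
    using d unfolding sub_tangent_space_def by blast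
qed

text \<open>The right-hand side expresses that \<open>F1\<close> and the range of the chart
  derivative together span the model space. To split a tangent vector, v is lifted from the chart;
  the remainder is tangent to S because this depends only on its value at \<open>d\<close>.\<close>

lemma tangent_sum_eq_iff:
  fixes \<B> :: "('q::{t2_space,second_countable_topology}, 'f::frechet_space) chart set"
    and \<A> :: "('p::{t2_space,second_countable_topology}, 'e::frechet_space) chart set"
  assumes A: "MC_manifold k \<A>" and B: "MC_manifold k \<B>" and k: "1 \<le> k" and \<phi>: "MC_map k \<A> \<B> \<phi>"
    and c: "c \<in> charts_at k \<A> p"
    and d: "submanifold_chart k \<B> S d F1 F2" "\<phi> p \<in> fst d" and q: "\<phi> p \<in> S"
  shows "{\<eta> + \<zeta> | \<eta> \<zeta>. \<eta> \<in> tangent_map k \<A> \<B> \<phi> p ` tangent_space k \<A> p \<and>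
        \<zeta> \<in> sub_tangent_space k \<B> S (\<phi> p)} = tangent_space k \<B> (\<phi> p)
    \<longleftrightarrow> (\<forall>y. \<exists>v. y - fderiv (loc_rep c d \<phi>) (snd c p) v \<in> F1)" (is "?L = ?T \<longleftrightarrow> (\<forall>y. \<exists>v. y - ?D v \<in> F1)")
proof
  note d_at = submanifold_chart_charts_at[OF d]
  note sub = sub_tangent_space_eq[OF B k d q]
  note tm = tangent_map_props[OF A B k \<phi> c d_at]
  note T = subspace_tangent_space[OF B k, of "\<phi> p"]
  {
    assume eq: "?L = ?T"
    show "\<forall>y. \<exists>v. y - ?D v \<in> F1"
    proof
      fix y
      have "tangent_lift k \<B> (\<phi> p) d y \<in> ?L"
        unfolding eq by (rule tangent_lift_in[OF B k d_at])
      then obtain \<xi> \<zeta> where *: "tangent_lift k \<B> (\<phi> p) d y = tangent_map k \<A> \<B> \<phi> p \<xi> + \<zeta>"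
        "\<xi> \<in> tangent_space k \<A> p" "\<zeta> \<in> sub_tangent_space k \<B> S (\<phi> p)" by auto
      have "y = tangent_lift k \<B> (\<phi> p) d y d" by (simp add: tangent_lift_apply[OF d_at])
      also have "\<dots> = ?D (\<xi> c) + \<zeta> d" unfolding *(1) using tm(2)[OF *(2)] by simp
      finally have "y - ?D (\<xi> c) = \<zeta> d" by simp
      also have "\<dots> \<in> F1" using *(3) sub by simp
      finally show "\<exists>v. y - ?D v \<in> F1" by blast
    qed
  next
    assume *: "\<forall>y. \<exists>v. y - ?D v \<in> F1"
    show "?L = ?T"
    proof
      show "?L \<subseteq> ?T"
        using tm(1) sub subspace_add[OF T] by auto
      show "?T \<subseteq> ?L"
      proof
        fix \<eta> assume \<eta>: "\<eta> \<in> ?T"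
        obtain v where v: "\<eta> d - ?D v \<in> F1" using * by blast
        define \<xi> where "\<xi> = tangent_lift k \<A> p c v"
        have \<xi>: "\<xi> \<in> tangent_space k \<A> p" "\<xi> c = v"
          unfolding \<xi>_def using tangent_lift_in[OF A k c] tangent_lift_apply[OF c] by auto
        define \<zeta> where "\<zeta> = \<eta> - tangent_map k \<A> \<B> \<phi> p \<xi>"
        have "\<zeta> \<in> ?T" unfolding \<zeta>_def by (rule subspace_diff[OF T \<eta> tm(1)[OF \<xi>(1)]])
        moreover have "\<zeta> d \<in> F1" using v tm(2)[OF \<xi>(1)] by (simp add: \<zeta>_def \<xi>(2))
        ultimately have "\<zeta> \<in> sub_tangent_space k \<B> S (\<phi> p)" using sub by simp
        moreover have "\<eta> = tangent_map k \<A> \<B> \<phi> p \<xi> + \<zeta>" by (simp add: \<zeta>_def)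
        ultimately show "\<eta> \<in> ?L" using \<xi>(1) by blast
      qed
    qed
  }
qed

subsection \<open>Finite-dimensional subspaces\<close>

text \<open>These sums increase with \<open>N\<close> and dominate all seminorms of index up to
  \<open>N\<close>, so one number replaces a finite family of conditions.\<close>

definition fseminorm_sum :: "nat \<Rightarrow> 'a::frechet_space \<Rightarrow> real" where
  "fseminorm_sum N x = (\<Sum>i\<le>N. fseminorm i x)"

lemma fseminorm_sum_nonneg: "0 \<le> fseminorm_sum N x"
  by (simp add: fseminorm_sum_def sum_nonneg)

lemma fseminorm_sum_triangle: "fseminorm_sum N (x + y) \<le> fseminorm_sum N x + fseminorm_sum N y"
  unfolding fseminorm_sum_def sum.distrib[symmetric] by (intro sum_mono fseminorm_triangle)

lemma fseminorm_sum_scaleR: "fseminorm_sum N (c *\<^sub>R x) = \<bar>c\<bar> * fseminorm_sum N x"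
  by (simp add: fseminorm_sum_def fseminorm_scaleR sum_distrib_left)

lemma fseminorm_sum_minus: "fseminorm_sum N (x - y) = fseminorm_sum N (y - x)"
  unfolding fseminorm_sum_def using fseminorm_minus[of _ "x - y"] by simp

lemma fseminorm_sum_mono: "N \<le> M \<Longrightarrow> fseminorm_sum N x \<le> fseminorm_sum M x"
  unfolding fseminorm_sum_def by (intro sum_mono2) auto

lemma fseminorm_le_sum: "i \<le> N \<Longrightarrow> fseminorm i x \<le> fseminorm_sum N x"
  unfolding fseminorm_sum_def by (intro member_le_sum) auto

lemma fseminorm_of_sum_le:
  assumes "finite B"
  shows "fseminorm i (\<Sum>b\<in>B. g b) \<le> (\<Sum>b\<in>B. fseminorm i (g b :: 'a::frechet_space))"
  using assms
proof (induction B rule: finite_induct)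
  case (insert b B)
  then show ?case using fseminorm_triangle[of i "g b" "\<Sum>b\<in>B. g b"] by simp
qed simp

text \<open>Continuity of the coordinate functionals on the span of a finite \<open>B\<close>, with
  one seminorm for all of them. It forces \<open>B\<close> to be independent, since a vanishing
  combination has vanishing coefficients.\<close>

definition coordinates_bounded :: "'a::frechet_space set \<Rightarrow> bool" where
  "coordinates_bounded B \<longleftrightarrow> (\<exists>N K. 0 \<le> K \<and>
    (\<forall>u. \<forall>b\<in>B. \<bar>u b\<bar> \<le> K * fseminorm_sum N (\<Sum>b\<in>B. u b *\<^sub>R b)))"

lemma span_finite_sum:
  assumes "finite B" "w \<in> span B"
  shows "\<exists>u. w = (\<Sum>b\<in>B. u b *\<^sub>R b)"
  using assms by (auto simp: span_finite)

text \<open>Otherwise combinations of B would approach a in every seminorm. Bounded coordinates make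
  their coefficients Cauchy sequences of reals, and the combination with the limit coefficients
  would equal a.\<close>

lemma separated_from_span:
  fixes a :: "'a::frechet_space"
  assumes B: "finite B" "coordinates_bounded B" and a: "a \<notin> span B"
  shows "\<exists>M \<delta>. 0 < \<delta> \<and> (\<forall>w\<in>span B. \<delta> \<le> fseminorm_sum M (a - w))"
proof (rule ccontr)
  assume neg: "\<not> ?thesis"
  obtain N K where K: "0 \<le> K" "\<And>u b. b \<in> B \<Longrightarrow> \<bar>u b\<bar> \<le> K * fseminorm_sum N (\<Sum>b\<in>B. u b *\<^sub>R b)"
    using B(2) unfolding coordinates_bounded_def by metis
  \<comment> \<open>Index and accuracy grow together: the M-th combination is within 1 / (M + 1) of
    a for the M-th sum, hence for every earlier one.\<close>
  have "\<exists>u. fseminorm_sum M (a - (\<Sum>b\<in>B. u b *\<^sub>R b)) < inverse (real (Suc M))" for M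
  proof -
    have "\<exists>w\<in>span B. fseminorm_sum M (a - w) < inverse (real (Suc M))"
      using neg by (metis not_le inverse_positive_iff_positive of_nat_0_less_iff zero_less_Suc)
    then show ?thesis using span_finite_sum[OF B(1)] by metis
  qed
  then obtain u where u: "\<And>M. fseminorm_sum M (a - (\<Sum>b\<in>B. u M b *\<^sub>R b)) < inverse (real (Suc M))"
    by metis
  define w where "w M = (\<Sum>b\<in>B. u M b *\<^sub>R b)" for M
  note u = u[folded w_def]
  have "Cauchy (\<lambda>M. u M b)" if b: "b \<in> B" for b
  proof (rule metric_CauchyI)
    fix e :: real assume e: "0 < e"
    \<comment> \<open>One half for each of the two approximants that are compared, and K + 1 because
      K may be 0.\<close>
    obtain L where L: "inverse (real (Suc L)) < e / (K + 1) / 2"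
      using reals_Archimedean[of "e / (K + 1) / 2"] e K(1) by auto
    have small: "fseminorm_sum N (a - w M) < e / (K + 1) / 2" if "max L N \<le> M" for M
    proof -
      have "fseminorm_sum N (a - w M) \<le> fseminorm_sum M (a - w M)"
        using that by (intro fseminorm_sum_mono) simp
      also have "\<dots> < inverse (real (Suc M))" by (rule u)
      also have "\<dots> \<le> inverse (real (Suc L))" using that by (intro le_imp_inverse_le) auto
      finally show ?thesis using L by simp
    qed
    show "\<exists>L. \<forall>m\<ge>L. \<forall>n\<ge>L. dist (u m b) (u n b) < e"
    proof (intro exI[of _ "max L N"] allI impI)
      fix m n assume mn: "max L N \<le> m" "max L N \<le> n"
      have "fseminorm_sum N (w m - w n) \<le> fseminorm_sum N (w m - a) + fseminorm_sum N (a - w n)"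
        using fseminorm_sum_triangle[of N "w m - a" "a - w n"] by simp
      also have "\<dots> < e / (K + 1) / 2 + e / (K + 1) / 2"
        using small[OF mn(1)] small[OF mn(2)] by (simp add: fseminorm_sum_minus[of N "w m"])
      also have "\<dots> = e / (K + 1)" by (rule field_sum_of_halves)
      finally have 1: "fseminorm_sum N (w m - w n) < e / (K + 1)" .
      have "w m - w n = (\<Sum>b\<in>B. (u m b - u n b) *\<^sub>R b)"
        by (simp add: w_def scaleR_diff_left sum_subtractf)
      then have "\<bar>u m b - u n b\<bar> \<le> K * fseminorm_sum N (w m - w n)"
        using K(2)[OF b, of "\<lambda>b. u m b - u n b"] by simp
      also have "\<dots> \<le> K * (e / (K + 1))" using 1 K(1) by (intro mult_left_mono) auto
      also have "\<dots> < e" using K(1) e by (simp add: pos_divide_less_eq)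
      finally show "dist (u m b) (u n b) < e" by (simp add: dist_real_def)
    qed
  qed
  note Cauchy_u = this
  define v where "v b = lim (\<lambda>M. u M b)" for b
  have v: "(\<lambda>M. u M b) \<longlonglongrightarrow> v b" if "b \<in> B" for b
    unfolding v_def by (rule convergent_LIMSEQ_iff[THEN iffD1, OF real_Cauchy_convergent[OF Cauchy_u[OF that]]])
  define x where "x = (\<Sum>b\<in>B. v b *\<^sub>R b)"
  have "fseminorm i (a - x) \<le> 0" for i
  proof (rule tendsto_lowerbound)
    show "(\<lambda>M. inverse (real (Suc M)) + (\<Sum>b\<in>B. \<bar>u M b - v b\<bar> * fseminorm i b)) \<longlonglongrightarrow> 0"
    proof -
      have "(\<lambda>M. \<Sum>b\<in>B. \<bar>u M b - v b\<bar> * fseminorm i b) \<longlonglongrightarrow> (\<Sum>b\<in>B. \<bar>v b - v b\<bar> * fseminorm i b)"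
        by (intro tendsto_intros v)
      from tendsto_add[OF LIMSEQ_inverse_real_of_nat this] show ?thesis by simp
    qed
    show "\<forall>\<^sub>F M in sequentially. fseminorm i (a - x) \<le> inverse (real (Suc M)) + (\<Sum>b\<in>B. \<bar>u M b - v b\<bar> * fseminorm i b)"
      unfolding eventually_sequentially
    \<comment> \<open>From M = i on, the i-th seminorm is dominated by the M-th sum, which is what
      \<open>u\<close> controls.\<close>
    proof (intro exI[of _ i] allI impI)
      fix M assume M: "i \<le> M"
      have "w M - x = (\<Sum>b\<in>B. (u M b - v b) *\<^sub>R b)"
        by (simp add: w_def x_def scaleR_diff_left sum_subtractf)
      then have "fseminorm i (w M - x) \<le> (\<Sum>b\<in>B. \<bar>u M b - v b\<bar> * fseminorm i b)"
        using fseminorm_of_sum_le[OF B(1), of i "\<lambda>b. (u M b - v b) *\<^sub>R b"] by (simp add: fseminorm_scaleR)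
      moreover have "fseminorm i (a - w M) \<le> inverse (real (Suc M))"
        using fseminorm_le_sum[OF M, of "a - w M"] u[of M] by linarith
      ultimately show "fseminorm i (a - x) \<le> inverse (real (Suc M)) + (\<Sum>b\<in>B. \<bar>u M b - v b\<bar> * fseminorm i b)"
        using fseminorm_triangle[of i "a - w M" "w M - x"] by simp
    qed
  qed simp
  then have "fseminorm i (a - x) = 0" for i using fseminorm_nonneg[of i "a - x"] by (meson antisym)
  then have "a = x" using fseminorm_separating[of "a - x"] by simp
  moreover have "x \<in> span B" unfolding x_def by (intro span_sum span_scale span_base)
  ultimately show False using a by simp
qed

text \<open>Induction on the basis. The new vector has positive distance from the span of the
  others; this bounds its own coefficient, and after its term is subtracted the induction hypothesis
  bounds the remaining ones.\<close>

lemma coordinates_bounded_independent: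
  assumes "finite B" "independent (B :: 'a::frechet_space set)"
  shows "coordinates_bounded B"
  using assms
proof (induction B rule: finite_induct)
  case empty
  then show ?case by (auto simp: coordinates_bounded_def)
next
  case (insert a B)
  then have IH: "coordinates_bounded B" and a: "a \<notin> span B"
    by (auto simp: independent_insert)
  obtain M \<delta> where \<delta>: "0 < \<delta>" "\<And>w. w \<in> span B \<Longrightarrow> \<delta> \<le> fseminorm_sum M (a - w)"
    using separated_from_span[OF insert.hyps(1) IH a] by metis
  obtain N K where K: "0 \<le> K" "\<And>u b. b \<in> B \<Longrightarrow> \<bar>u b\<bar> \<le> K * fseminorm_sum N (\<Sum>b\<in>B. u b *\<^sub>R b)"
    using IH unfolding coordinates_bounded_def by metis
  define R where "R = max M N"
  \<comment> \<open>The summand 1 / \<delta> serves the coefficient of \<open>a\<close>. The other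
    one serves the old coefficients: they belong to v minus its \<open>a\<close> term, whose
    \<open>N\<close>-th sum is at most (1 + \<open>fseminorm_sum N a\<close> / \<delta>) times
    \<open>fseminorm_sum R v\<close>.\<close>
  define C where "C = 1 / \<delta> + K * (1 + fseminorm_sum N a / \<delta>)"
  have C: "0 \<le> C" "1 / \<delta> \<le> C" "K * (1 + fseminorm_sum N a / \<delta>) \<le> C"
    using \<delta>(1) K(1) fseminorm_sum_nonneg[of N a] by (auto simp: C_def)
  have "\<bar>u b\<bar> \<le> C * fseminorm_sum R (\<Sum>b\<in>insert a B. u b *\<^sub>R b)" if b: "b \<in> insert a B" for u b
  proof -
    define w where "w = (\<Sum>b\<in>B. u b *\<^sub>R b)"
    define v where "v = u a *\<^sub>R a + w"
    have v: "(\<Sum>b\<in>insert a B. u b *\<^sub>R b) = v"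
      using insert.hyps by (simp add: v_def w_def)
    have w: "w \<in> span B" unfolding w_def by (intro span_sum span_scale span_base)
    have ua: "\<bar>u a\<bar> \<le> fseminorm_sum M v / \<delta>"
    proof (cases "u a = 0")
      case True
      then show ?thesis using \<delta>(1) fseminorm_sum_nonneg[of M v] by simp
    next
      case False
      \<comment> \<open>Dividing v by the coefficient of \<open>a\<close> turns it into
        \<open>a\<close> minus an element of the span, to which the distance estimate
        applies.\<close>
      have "\<delta> \<le> fseminorm_sum M (a - (- (1 / u a)) *\<^sub>R w)"
        using w by (intro \<delta>(2) span_scale)
      then have "\<bar>u a\<bar> * \<delta> \<le> fseminorm_sum M (u a *\<^sub>R (a - (- (1 / u a)) *\<^sub>R w))"
        by (simp only: fseminorm_sum_scaleR) (intro mult_left_mono, auto)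
      also have "u a *\<^sub>R (a - (- (1 / u a)) *\<^sub>R w) = v"
        using False by (simp add: v_def algebra_simps)
      finally show ?thesis using \<delta>(1) by (simp add: pos_le_divide_eq)
    qed
    have MR: "fseminorm_sum M v \<le> fseminorm_sum R v" and NR: "fseminorm_sum N v \<le> fseminorm_sum R v"
      by (auto simp: R_def intro: fseminorm_sum_mono)
    show ?thesis
    proof (cases "b = a")
      case True
      have "\<bar>u a\<bar> \<le> 1 / \<delta> * fseminorm_sum R v"
        using order_trans[OF ua divide_right_mono[OF MR, of \<delta>]] \<delta>(1) by simp
      also have "\<dots> \<le> C * fseminorm_sum R v"
        by (intro mult_right_mono C fseminorm_sum_nonneg)
      finally show ?thesis using True v by simp
    next
      case False
      then have "\<bar>u b\<bar> \<le> K * fseminorm_sum N w" using K(2)[of b u] b by (simp add: w_def)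
      also have "fseminorm_sum N w \<le> fseminorm_sum N v + \<bar>u a\<bar> * fseminorm_sum N a"
      proof -
        have "w = v + (- u a) *\<^sub>R a" by (simp add: v_def)
        then show ?thesis using fseminorm_sum_triangle[of N v "(- u a) *\<^sub>R a"]
          by (simp only: fseminorm_sum_scaleR abs_minus_cancel)
      qed
      also have "\<dots> \<le> fseminorm_sum R v + fseminorm_sum R v / \<delta> * fseminorm_sum N a"
        using \<delta>(1) order_trans[OF ua divide_right_mono[OF MR, of \<delta>]] NR
        by (intro add_mono mult_right_mono fseminorm_sum_nonneg) auto
      also have "\<dots> = (1 + fseminorm_sum N a / \<delta>) * fseminorm_sum R v"
        by (simp add: algebra_simps)
      finally have "\<bar>u b\<bar> \<le> K * ((1 + fseminorm_sum N a / \<delta>) * fseminorm_sum R v)"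
        using K(1) by (simp add: mult_left_mono)
      also have "\<dots> = K * (1 + fseminorm_sum N a / \<delta>) * fseminorm_sum R v" by simp
      also have "\<dots> \<le> C * fseminorm_sum R v"
        by (intro mult_right_mono C fseminorm_sum_nonneg)
      finally show ?thesis using v by simp
    qed
  qed
  with C(1) show ?case unfolding coordinates_bounded_def by blast
qed

lemma closed_span_finite:
  assumes "finite (X :: 'a::frechet_space set)"
  shows "closed (span X)"
proof -
  obtain B where B: "B \<subseteq> X" "independent B" "X \<subseteq> span B"
    using maximal_independent_subset[of X] by blast
  then have fin: "finite B" using assms finite_subset by blast
  have span: "span X = span B" using B by (metis span_eq span_superset subset_trans)
  have "open (- span B)"
    unfolding open_fseminorm
  proof
    fix a assume "a \<in> - span B"
    then obtain M \<delta> where \<delta>: "0 < \<delta>" "\<forall>w\<in>span B. \<delta> \<le> fseminorm_sum M (a - w)"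
      using separated_from_span[OF fin coordinates_bounded_independent[OF fin B(2)], of a] by auto
    \<comment> \<open>The sum has M + 1 terms, hence this radius.\<close>
    have "y \<in> - span B" if y: "\<forall>i\<le>M. fseminorm i (y - a) < \<delta> / real (Suc M)" for y
    proof
      assume "y \<in> span B"
      then have "\<delta> \<le> fseminorm_sum M (y - a)" using \<delta>(2) fseminorm_sum_minus[of M a y] by auto
      also have "\<dots> < (\<Sum>i\<le>M. \<delta> / real (Suc M))"
        unfolding fseminorm_sum_def using y by (intro sum_strict_mono) auto
      also have "\<dots> = \<delta>" by simp
      finally show False by simp
    qed
    then show "\<exists>n. \<exists>e>0. \<forall>y. (\<forall>i\<le>n. fseminorm i (y - a) < e) \<longrightarrow> y \<in> - span B"
      using \<delta>(1) by (intro exI[of _ M] exI[of _ "\<delta> / real (Suc M)"]) auto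
  qed
  then show ?thesis unfolding span closed_def .
qed

text \<open>Expanding v in a basis bounds each seminorm of f v by the absolute coordinates of v
  times constants, and the coordinates are bounded by seminorms of v.\<close>

lemma linear_finite_dim_tendsto:
  fixes f :: "'d::frechet_space \<Rightarrow> 'f::frechet_space"
  assumes dim: "has_dimension (UNIV :: 'd set) n" and f: "linear f"
    and g: "(g \<longlongrightarrow> l) F"
  shows "((\<lambda>x. f (g x)) \<longlongrightarrow> f l) F"
proof -
  interpret f: linear f by (rule f)
  obtain B :: "'d set" where B: "finite B" "independent B" "span B = UNIV"
    using dim by (auto simp: has_dimension_def)
  obtain N K where K: "0 \<le> K" "\<And>u b. b \<in> B \<Longrightarrow> \<bar>u b\<bar> \<le> K * fseminorm_sum N (\<Sum>b\<in>B. u b *\<^sub>R b)"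
    using coordinates_bounded_independent[OF B(1,2)] unfolding coordinates_bounded_def by metis
  have bound: "fseminorm i (f v) \<le> (\<Sum>b\<in>B. K * fseminorm_sum N v * fseminorm i (f b))" for i v
  proof -
    obtain u where u: "v = (\<Sum>b\<in>B. u b *\<^sub>R b)" using span_finite_sum[OF B(1), of v] B(3) by auto
    have "fseminorm i (f v) \<le> (\<Sum>b\<in>B. fseminorm i (u b *\<^sub>R f b))"
      unfolding u f.sum f.scaleR by (rule fseminorm_of_sum_le[OF B(1)])
    also have "\<dots> \<le> (\<Sum>b\<in>B. K * fseminorm_sum N v * fseminorm i (f b))"
      unfolding fseminorm_scaleR using K(2)[of _ u] u by (intro sum_mono mult_right_mono) auto
    finally show ?thesis .
  qed
  show ?thesis unfolding tendsto_fseminorm_iff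
  proof
    fix i
    have "((\<lambda>x. fseminorm_sum N (g x - l)) \<longlongrightarrow> (\<Sum>i\<le>N. 0)) F"
      unfolding fseminorm_sum_def using g[unfolded tendsto_fseminorm_iff] by (intro tendsto_sum) blast
    then have "((\<lambda>x. \<Sum>b\<in>B. K * fseminorm_sum N (g x - l) * fseminorm i (f b)) \<longlongrightarrow> (\<Sum>b\<in>B. K * (\<Sum>i\<le>N. 0) * fseminorm i (f b))) F"
      by (intro tendsto_intros)
    then have lim: "((\<lambda>x. \<Sum>b\<in>B. K * fseminorm_sum N (g x - l) * fseminorm i (f b)) \<longlongrightarrow> 0) F" by simp
    show "((\<lambda>x. fseminorm i (f (g x) - f l)) \<longlongrightarrow> 0) F"
    proof (rule Lim_null_comparison[OF _ lim])
      show "\<forall>\<^sub>F x in F. norm (fseminorm i (f (g x) - f l)) \<le> (\<Sum>b\<in>B. K * fseminorm_sum N (g x - l) * fseminorm i (f b))"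
        using bound[of i] by (simp add: f.diff[symmetric])
    qed
  qed
qed

lemma linear_finite_dim_continuous:
  fixes f :: "'d::frechet_space \<Rightarrow> 'f::frechet_space"
  assumes "has_dimension (UNIV :: 'd set) n" "linear f"
  shows "continuous_on S f"
  unfolding continuous_on_def using linear_finite_dim_tendsto[OF assms tendsto_ident_at] by blast

lemma closed_range_finite_dim:
  fixes f :: "'d::frechet_space \<Rightarrow> 'f::frechet_space"
  assumes "has_dimension (UNIV :: 'd set) n" "linear f"
  shows "closed (range f)"
proof -
  obtain B :: "'d set" where B: "finite B" "span B = UNIV"
    using assms(1) by (auto simp: has_dimension_def)
  have "range f = span (f ` B)" using linear_span_image[OF assms(2), of B] B(2) by simp
  then show ?thesis using closed_span_finite[of "f ` B"] B(1) by simp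
qed

section \<open>Splitting of subspaces of a finite-dimensional tangent space\<close>

lemma continuous_map_add_frechet:
  fixes f g :: "'b \<Rightarrow> 'a::frechet_space"
  assumes "continuous_map X euclidean f" "continuous_map X euclidean g"
  shows "continuous_map X euclidean (\<lambda>x. f x + g x)"
proof -
  have "continuous_map X (prod_topology euclidean euclidean) (\<lambda>x. (f x, g x))"
    by (rule continuous_map_pairedI[OF assms])
  moreover have "continuous_on UNIV (\<lambda>z::'a \<times> 'a. fst z + snd z)"
    unfolding continuous_on_def by (intro ballI tendsto_add_frechet tendsto_fst tendsto_snd tendsto_ident_at)
  then have "continuous_map (prod_topology euclidean euclidean) euclidean (\<lambda>z::'a \<times> 'a. fst z + snd z)"
    by simp
  ultimately have "continuous_map X euclidean ((\<lambda>z. fst z + snd z) \<circ> (\<lambda>x. (f x, g x)))"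
    by (rule continuous_map_compose)
  then show ?thesis by (simp add: comp_def)
qed

lemma topspace_tangent_topology:
  assumes "c \<in> charts_at k \<A> p"
  shows "topspace (tangent_topology k \<A> p) = tangent_space k \<A> p"
proof
  show "topspace (tangent_topology k \<A> p) \<subseteq> tangent_space k \<A> p"
    unfolding tangent_topology_def topology_generated_by_topspace by blast
  have "{\<xi> \<in> tangent_space k \<A> p. \<xi> c \<in> UNIV} \<in> {{\<xi> \<in> tangent_space k \<A> p. \<xi> c \<in> W} | c W. c \<in> charts_at k \<A> p \<and> open W}"
    using assms open_UNIV by blast
  then show "tangent_space k \<A> p \<subseteq> topspace (tangent_topology k \<A> p)"
    unfolding tangent_topology_def topology_generated_by_topspace by blast
qed

lemma continuous_map_tangent_eval:
  assumes c: "c \<in> charts_at k \<A> p"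
  shows "continuous_map (tangent_topology k \<A> p) euclidean (\<lambda>\<xi>. \<xi> c)"
  unfolding continuous_map_def
proof (intro conjI allI impI)
  fix W :: "'b set" assume "openin euclidean W"
  then have "{\<xi> \<in> tangent_space k \<A> p. \<xi> c \<in> W} \<in> {{\<xi> \<in> tangent_space k \<A> p. \<xi> c \<in> W} | c W. c \<in> charts_at k \<A> p \<and> open W}"
    using c open_openin by blast
  then have "openin (tangent_topology k \<A> p) {\<xi> \<in> tangent_space k \<A> p. \<xi> c \<in> W}"
    unfolding tangent_topology_def by (rule topology_generated_by_Basis)
  then show "openin (tangent_topology k \<A> p) {\<xi> \<in> topspace (tangent_topology k \<A> p). \<xi> c \<in> W}"
    by (simp add: topspace_tangent_topology[OF c])
qed simp

text \<open>The topology is generated by the evaluations in all charts around p, and evaluating the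
  lift at \<open>d\<close> gives the transition from \<open>c\<close> to \<open>d\<close>, which is
  continuous.\<close>

lemma continuous_map_tangent_lift:
  assumes A: "MC_manifold k \<A>" and k: "1 \<le> k" and c: "c \<in> charts_at k \<A> p"
  shows "continuous_map euclidean (tangent_topology k \<A> p) (tangent_lift k \<A> p c)"
  unfolding tangent_topology_def
proof (rule continuous_on_generated_topo)
  fix U assume "U \<in> {{\<xi> \<in> tangent_space k \<A> p. \<xi> c \<in> W} | c W. c \<in> charts_at k \<A> p \<and> open W}"
  then obtain d W where U: "U = {\<xi> \<in> tangent_space k \<A> p. \<xi> d \<in> W}" "d \<in> charts_at k \<A> p" "open W"
    by blast
  have "tangent_lift k \<A> p c -` U = transition c d p -` W"
    using tangent_lift_in[OF A k c] U(2) by (auto simp: U(1) tangent_lift_def)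
  moreover have "open (transition c d p -` W)"
    by (rule open_vimage[OF U(3)])
      (rule Lip_linear_continuous_on[OF affine_germ_Lip_linear[OF transition_germ[OF A k c U(2)]]])
  ultimately show "openin euclidean (tangent_lift k \<A> p c -` U \<inter> topspace euclidean)" by simp
next
  show "tangent_lift k \<A> p c ` topspace euclidean
      \<subseteq> \<Union> {{\<xi> \<in> tangent_space k \<A> p. \<xi> c \<in> W} | c W. c \<in> charts_at k \<A> p \<and> open W}"
    using tangent_lift_in[OF A k c] topspace_tangent_topology[OF c]
    unfolding tangent_topology_def topology_generated_by_topspace by blast
qed

text \<open>Linear maps on the finite-dimensional model space are continuous, so an algebraic
  projection onto W is a topological one. Evaluation at \<open>c\<close> and the lift transport the
  decomposition to the tangent space.\<close>

lemma splits_in_tangent_space: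
  fixes \<A> :: "('a::{t2_space,second_countable_topology}, 'd::frechet_space) chart set"
  assumes A: "MC_manifold k \<A>" and k: "1 \<le> k" and c: "c \<in> charts_at k \<A> p"
    and dim: "has_dimension (UNIV :: 'd set) n" and W: "subspace W"
  shows "splits_in (tangent_topology k \<A> p) (tangent_lift k \<A> p c ` W)"
proof -
  let ?X = "tangent_topology k \<A> p" and ?l = "tangent_lift k \<A> p c"
  have lin_l: "linear ?l" by (rule linear_tangent_lift[OF A k c])
  interpret l: linear ?l by (rule lin_l)
  have top: "topspace ?X = tangent_space k \<A> p" by (rule topspace_tangent_topology[OF c])
  have lc: "?l v c = v" for v by (rule tangent_lift_apply[OF c])
  have ll: "?l (\<xi> c) = \<xi>" if "\<xi> \<in> tangent_space k \<A> p" for \<xi>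
    by (rule tangent_lift_eval[OF that c])
  have lin: "?l v \<in> tangent_space k \<A> p" for v by (rule tangent_lift_in[OF A k c])
  \<comment> \<open>A linear left inverse of the inclusion of W, that is, a projection onto
    W.\<close>
  obtain \<pi> :: "'d \<Rightarrow> 'd" where \<pi>: "linear \<pi>" "range \<pi> \<subseteq> W" "\<And>v. v \<in> W \<Longrightarrow> \<pi> v = v"
    using linear_exists_left_inverse_on[OF linear_ident W] by auto
  interpret \<pi>: linear \<pi> by (rule \<pi>(1))
  have \<pi>\<pi>: "\<pi> (\<pi> v) = \<pi> v" for v using \<pi>(2,3) by blast
  define Z where "Z = {v. \<pi> v = 0}"
  have Z: "subspace Z" unfolding Z_def by (rule linear_subspace_kernel[OF \<pi>(1)])
  have lin2: "linear (\<lambda>v. v - \<pi> v)" using linear_compose_sub[OF linear_ident \<pi>(1)] .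
  note cont_eval = continuous_map_tangent_eval[OF c]
  note cont_lift = continuous_map_tangent_lift[OF A k c]
  have cont_lin: "continuous_map ?X euclidean (\<lambda>\<xi>. f (\<xi> c))" if "linear f" for f :: "'d \<Rightarrow> 'd"
    using continuous_map_compose[OF cont_eval, of euclidean f] linear_finite_dim_continuous[OF dim that, of UNIV]
    by (simp add: comp_def)
  have closed: "closedin ?X (?l ` {v. f v = 0})" if f: "linear f" for f :: "'d \<Rightarrow> 'd"
  proof -
    have "closedin ?X {\<xi> \<in> topspace ?X. f (\<xi> c) \<in> {0}}"
      by (rule closedin_continuous_map_preimage[OF cont_lin[OF f]]) simp
    also have "{\<xi> \<in> topspace ?X. f (\<xi> c) \<in> {0}} = ?l ` {v. f v = 0}"
      unfolding top using lin lc ll by (auto simp: image_iff) (metis ll)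
    finally show ?thesis .
  qed
  \<comment> \<open>W becomes the kernel of a linear map and is closed for the same reason as
    Z.\<close>
  have "v \<in> W \<longleftrightarrow> v - \<pi> v = 0" for v
    using \<pi>(2,3) by (metis eq_iff_diff_eq_0 rangeI subsetD)
  then have "W = {v. v - \<pi> v = 0}" by blast
  then have closedW: "closedin ?X (?l ` W)" using closed[OF lin2] by simp
  have closedZ: "closedin ?X (?l ` Z)" unfolding Z_def by (rule closed[OF \<pi>(1)])
  let ?P = "prod_topology (subtopology ?X (?l ` W)) (subtopology ?X (?l ` Z))"
  define g where "g \<xi> = (?l (\<pi> (\<xi> c)), ?l (\<xi> c - \<pi> (\<xi> c)))" for \<xi>
  have sum: "w + z = ?l (w c + z c)" if "w \<in> ?l ` W" "z \<in> ?l ` Z" for w z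
    using that by (auto simp: lc l.add)
  have "homeomorphic_maps ?P ?X (\<lambda>(w, z). w + z) g"
    unfolding homeomorphic_maps_def
  proof (intro conjI ballI)
    have topP: "topspace ?P = ?l ` W \<times> ?l ` Z"
      using lin by (auto simp: top)
    have "continuous_map ?P euclidean (\<lambda>x. fst x c + snd x c)"
    proof (rule continuous_map_add_frechet)
      show "continuous_map ?P euclidean (\<lambda>x. fst x c)"
        using continuous_map_compose[OF continuous_map_fst continuous_map_from_subtopology[OF cont_eval]]
        by (simp add: comp_def)
      show "continuous_map ?P euclidean (\<lambda>x. snd x c)"
        using continuous_map_compose[OF continuous_map_snd continuous_map_from_subtopology[OF cont_eval]]
        by (simp add: comp_def)
    qed
    from continuous_map_compose[OF this cont_lift]
    have "continuous_map ?P ?X (\<lambda>x. ?l (fst x c + snd x c))" by (simp add: comp_def)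
    then show "continuous_map ?P ?X (\<lambda>(w, z). w + z)"
      by (rule continuous_map_eq) (auto simp: topP sum[symmetric])
    have "continuous_map ?X (subtopology ?X (?l ` W)) (\<lambda>\<xi>. ?l (\<pi> (\<xi> c)))"
      using continuous_map_compose[OF cont_lin[OF \<pi>(1)] cont_lift] \<pi>(2)
      by (intro continuous_map_into_subtopology) (auto simp: comp_def)
    moreover have "continuous_map ?X (subtopology ?X (?l ` Z)) (\<lambda>\<xi>. ?l (\<xi> c - \<pi> (\<xi> c)))"
      using continuous_map_compose[OF cont_lin[OF lin2] cont_lift]
      by (intro continuous_map_into_subtopology) (auto simp: comp_def Z_def \<pi>.diff \<pi>\<pi>)
    ultimately show "continuous_map ?X ?P g"
      unfolding g_def by (simp add: continuous_map_paired)
    fix x assume "x \<in> topspace ?P"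
    then obtain v z where x: "x = (?l v, ?l z)" "v \<in> W" "z \<in> Z" unfolding topP by auto
    have "\<pi> (v + z) = v" using x \<pi>(3) by (simp add: \<pi>.add Z_def)
    then show "g (case x of (w, z) \<Rightarrow> w + z) = x"
      by (simp add: x(1) g_def lc)
  next
    fix \<xi> assume "\<xi> \<in> topspace ?X"
    then have "\<xi> \<in> tangent_space k \<A> p" by (simp add: top)
    then show "(case g \<xi> of (w, z) \<Rightarrow> w + z) = \<xi>"
      by (simp add: g_def l.add[symmetric] ll)
  qed
  then have "homeomorphic_map ?P ?X (\<lambda>(w, z). w + z)"
    unfolding homeomorphic_map_maps by blast
  then have "topological_direct_sum ?X (?l ` W) (?l ` Z)"
    unfolding topological_direct_sum_def
    using closedW closedZ linear_subspace_image[OF lin_l W] linear_subspace_image[OF lin_l Z] by blast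
  then show ?thesis unfolding splits_in_def by blast
qed

subsection \<open>Product charts and partial maps\<close>

definition prod_chart :: "('m, 'e) chart \<Rightarrow> ('a, 'b) chart \<Rightarrow> ('m \<times> 'a, 'e \<times> 'b) chart" where
  "prod_chart c d = (fst c \<times> fst d, map_prod (snd c) (snd d))"

lemma fst_prod_chart [simp]: "fst (prod_chart c d) = fst c \<times> fst d"
  and snd_prod_chart [simp]: "snd (prod_chart c d) = map_prod (snd c) (snd d)"
  by (simp_all add: prod_chart_def)

lemma product_atlas_iff: "x \<in> product_atlas \<A> \<B> \<longleftrightarrow> (\<exists>c\<in>\<A>. \<exists>d\<in>\<B>. x = prod_chart c d)"
proof -
  have "product_atlas \<A> \<B> = (\<lambda>z. prod_chart (fst z) (snd z)) ` (\<A> \<times> \<B>)"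
    unfolding product_atlas_def prod_chart_def by (intro image_cong) (auto simp: case_prod_beta')
  then show ?thesis by (simp only: image_iff Bex_def mem_Times_iff split_paired_Ex) (metis fst_conv snd_conv)
qed

lemma continuous_on_map_prod_Times:
  assumes "continuous_on S f" "continuous_on T g"
  shows "continuous_on (S \<times> T) (map_prod f g)"
proof -
  have "continuous_on (S \<times> T) (\<lambda>z. (f (fst z), g (snd z)))"
    by (intro continuous_on_Pair continuous_on_compose2[OF assms(1)] continuous_on_compose2[OF assms(2)]
        continuous_on_fst continuous_on_snd continuous_on_id) auto
  then show ?thesis by (simp add: map_prod_def case_prod_beta')
qed

lemma chart_inv_prod:
  assumes "is_chart c" "is_chart d" "u \<in> snd c ` fst c" "w \<in> snd d ` fst d"
  shows "chart_inv (prod_chart c d) (u, w) = (chart_inv c u, chart_inv d w)"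
proof (rule inv_into_f_eq)
  show "inj_on (snd (prod_chart c d)) (fst (prod_chart c d))"
    using is_chart_inj_on[OF assms(1)] is_chart_inj_on[OF assms(2)] by (auto intro: map_prod_inj_on)
qed (use assms in \<open>auto simp: chart_inv_in chart_chart_inv\<close>)

lemma is_chart_prod:
  assumes c: "is_chart c" and d: "is_chart d"
  shows "is_chart (prod_chart c d)"
proof -
  let ?P = "prod_chart c d"
  have img: "snd ?P ` fst ?P = snd c ` fst c \<times> snd d ` fst d" by (auto simp: image_iff)
  have cont: "continuous_on (fst c) (snd c)" "continuous_on (snd c ` fst c) (chart_inv c)"
    "continuous_on (fst d) (snd d)" "continuous_on (snd d ` fst d) (chart_inv d)"
    and op: "open (fst c)" "open (snd c ` fst c)" "open (fst d)" "open (snd d ` fst d)"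
    using c d by (auto simp: is_chart_def homeomorphism_def)
  have inv: "chart_inv ?P z = map_prod (chart_inv c) (chart_inv d) z" if "z \<in> snd c ` fst c \<times> snd d ` fst d" for z
    using chart_inv_prod[OF c d] that by auto
  have "continuous_on (snd c ` fst c \<times> snd d ` fst d) (chart_inv ?P)"
    using continuous_on_map_prod_Times[OF cont(2,4)] by (rule continuous_on_cong[THEN iffD1, rotated 2]) (use inv in auto)
  moreover have "continuous_on (fst c \<times> fst d) (snd ?P)"
    using continuous_on_map_prod_Times[OF cont(1,3)] by simp
  moreover have "chart_inv ?P (snd ?P q) = q" if "q \<in> fst c \<times> fst d" for q
    using that c d chart_inv_prod[OF c d, of "snd c (fst q)" "snd d (snd q)"]
    by (cases q) (auto simp: chart_inv_chart)
  moreover have "snd ?P (chart_inv ?P z) = z" if "z \<in> snd c ` fst c \<times> snd d ` fst d" for z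
    using that unfolding inv[OF that] by (cases z) (auto simp: chart_chart_inv)
  moreover have "chart_inv ?P ` (snd c ` fst c \<times> snd d ` fst d) = fst c \<times> fst d"
  proof -
    have "chart_inv ?P ` (snd c ` fst c \<times> snd d ` fst d) = map_prod (chart_inv c) (chart_inv d) ` (snd c ` fst c \<times> snd d ` fst d)"
      by (rule image_cong[OF refl inv])
    also have "\<dots> = fst c \<times> fst d"
      using chart_inv_chart[OF c] chart_inv_chart[OF d] by (auto simp: image_iff)
    finally show ?thesis .
  qed
  ultimately have "homeomorphism (fst ?P) (snd ?P ` fst ?P) (snd ?P) (chart_inv ?P)"
    unfolding homeomorphism_def img by simp
  moreover have "open (snd ?P ` fst ?P)" unfolding img using op by (simp add: open_Times)
  ultimately show ?thesis unfolding is_chart_def using op by (simp add: open_Times)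
qed

lemma loc_rep_prod_germ:
  assumes c: "is_chart c" "p \<in> fst c" and d: "is_chart d" "q \<in> fst d"
    and L: "affine_germ (loc_rep c c' id) (snd c p) L" and H: "affine_germ (loc_rep d d' id) (snd d q) H"
  shows "affine_germ (loc_rep (prod_chart c d) (prod_chart c' d') id) (snd (prod_chart c d) (p, q)) (map_prod L H)"
proof -
  have "affine_germ (map_prod (loc_rep c c' id) (loc_rep d d' id)) (snd (prod_chart c d) (p, q)) (map_prod L H)"
    using affine_germ_map_prod[OF L H] by simp
  moreover have "\<forall>\<^sub>F z in nhds (snd (prod_chart c d) (p, q)).
      map_prod (loc_rep c c' id) (loc_rep d d' id) z = loc_rep (prod_chart c d) (prod_chart c' d') id z"
  proof -
    have "\<forall>\<^sub>F z in nhds (snd (prod_chart c d) (p, q)). z \<in> snd (prod_chart c d) ` fst (prod_chart c d)"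
      using is_chart_eventually(2)[OF is_chart_prod[OF c(1) d(1)], of "(p, q)"] c d by simp
    then show ?thesis
    proof eventually_elim
      case (elim z)
      then obtain u w where "z = (u, w)" "u \<in> snd c ` fst c" "w \<in> snd d ` fst d" by auto
      then show ?case by (simp add: loc_rep_def chart_inv_prod[unfolded fst_prod_chart snd_prod_chart, OF c(1) d(1)])
    qed
  qed
  ultimately show ?thesis by (rule affine_germ_cong)
qed

text \<open>Through germs, compatibility is checked at one point of the overlap at a time, where the
  linear part is the product of the two linear parts.\<close>

lemma MC_on_prod_charts:
  assumes k: "1 \<le> k" and c: "is_chart c" "is_chart c'" and d: "is_chart d" "is_chart d'"
    and C: "MC_on k (loc_dom c c' id) (loc_rep c c' id)" and D: "MC_on k (loc_dom d d' id) (loc_rep d d' id)"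
  shows "MC_on k (loc_dom (prod_chart c d) (prod_chart c' d') id) (loc_rep (prod_chart c d) (prod_chart c' d') id)"
  unfolding MC_on_iff_locally_affine[OF k] locally_affine_def
proof (intro conjI ballI)
  show "open (loc_dom (prod_chart c d) (prod_chart c' d') id)"
    by (intro open_loc_dom is_chart_prod c d continuous_on_id')
  fix z assume "z \<in> loc_dom (prod_chart c d) (prod_chart c' d') id"
  then obtain p q where z: "z = snd (prod_chart c d) (p, q)" "p \<in> fst c" "q \<in> fst d" "p \<in> fst c'" "q \<in> fst d'"
    by (auto simp: loc_dom_def)
  then have "snd c p \<in> loc_dom c c' id" "snd d q \<in> loc_dom d d' id"
    by (auto simp: loc_dom_def)
  then obtain L H where "affine_germ (loc_rep c c' id) (snd c p) L" "affine_germ (loc_rep d d' id) (snd d q) H"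
    using MC_on_germ[OF C k] MC_on_germ[OF D k] by blast
  then show "\<exists>L. affine_germ (loc_rep (prod_chart c d) (prod_chart c' d') id) z L"
    unfolding z(1) using loc_rep_prod_germ[OF c(1) z(2) d(1) z(3)] by blast
qed

lemma prod_chart_in_charts:
  assumes k: "1 \<le> k" and A: "MC_manifold k \<A>" and B: "MC_manifold k \<B>"
    and c: "c \<in> charts k \<A>" and d: "d \<in> charts k \<B>"
  shows "prod_chart c d \<in> charts k (product_atlas \<A> \<B>)"
  unfolding charts_def
proof (intro CollectI conjI ballI)
  have ch: "is_chart c" "is_chart d" using c d by (auto simp: charts_def)
  show "is_chart (prod_chart c d)" using ch by (rule is_chart_prod)
  fix x assume "x \<in> product_atlas \<A> \<B>"
  then obtain c' d' where x: "x = prod_chart c' d'" "c' \<in> \<A>" "d' \<in> \<B>" unfolding product_atlas_iff by blast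
  then have ch': "is_chart c'" "is_chart d'" using A B by (auto simp: MC_manifold_def)
  have "MC_on k (loc_dom c c' id) (loc_rep c c' id)" "MC_on k (loc_dom c' c id) (loc_rep c' c id)"
    "MC_on k (loc_dom d d' id) (loc_rep d d' id)" "MC_on k (loc_dom d' d id) (loc_rep d' d id)"
    using c d x(2,3) by (auto simp: charts_def)
  then show "MC_on k (loc_dom (prod_chart c d) x id) (loc_rep (prod_chart c d) x id)"
    "MC_on k (loc_dom x (prod_chart c d) id) (loc_rep x (prod_chart c d) id)"
    unfolding x(1) using ch ch' k by (simp_all add: MC_on_prod_charts)
qed

lemma MC_manifold_product:
  assumes k: "1 \<le> k" and A: "MC_manifold k \<A>" and B: "MC_manifold k \<B>"
  shows "MC_manifold k (product_atlas \<A> \<B>)"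
proof -
  have sub: "x \<in> charts k (product_atlas \<A> \<B>)" if "x \<in> product_atlas \<A> \<B>" for x
  proof -
    obtain c d where x: "x = prod_chart c d" "c \<in> \<A>" "d \<in> \<B>" using \<open>x \<in> product_atlas \<A> \<B>\<close> unfolding product_atlas_iff by blast
    then show ?thesis
      using prod_chart_in_charts[OF k A B] subsetD[OF MC_manifold_charts[OF A]] subsetD[OF MC_manifold_charts[OF B]] by simp
  qed
  have "(p, q) \<in> (\<Union>x\<in>product_atlas \<A> \<B>. fst x)" for p q
  proof -
    obtain c where "c \<in> \<A>" "p \<in> fst c" using MC_manifold_chart_at[OF A] by metis
    moreover obtain d where "d \<in> \<B>" "q \<in> fst d" using MC_manifold_chart_at[OF B] by metis
    ultimately have "prod_chart c d \<in> product_atlas \<A> \<B>" "(p, q) \<in> fst (prod_chart c d)"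
      unfolding product_atlas_iff by auto
    then show ?thesis by blast
  qed
  then have cover: "(\<Union>x\<in>product_atlas \<A> \<B>. fst x) = UNIV" by auto
  show ?thesis
    unfolding MC_manifold_def
  proof (intro conjI ballI)
    fix x assume x: "x \<in> product_atlas \<A> \<B>"
    then show "is_chart x" using sub[OF x] by (simp add: charts_def)
    fix y assume "y \<in> product_atlas \<A> \<B>"
    then show "MC_on k (loc_dom x y id) (loc_rep x y id)" using sub[OF x] by (simp add: charts_def)
  qed (rule cover)
qed

lemma prod_chart_in_charts_at:
  assumes k: "1 \<le> k" and A: "MC_manifold k \<A>" and B: "MC_manifold k \<B>"
    and c: "c \<in> charts_at k \<A> p" and d: "d \<in> charts_at k \<B> q"
  shows "prod_chart c d \<in> charts_at k (product_atlas \<A> \<B>) (p, q)"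
  using prod_chart_in_charts[OF k A B] c d by (simp add: charts_at_def)

text \<open>Freezing the first component of a product chart at \<open>snd c x\<close> turns the
  local expression of \<phi>, on the image of \<open>e\<close>, into that of the partial
  map.\<close>

lemma slice_germ:
  assumes c: "is_chart c" "x \<in> fst c" and e: "is_chart e" "a \<in> fst e"
    and D: "affine_germ (loc_rep (prod_chart c e) d \<phi>) (snd (prod_chart c e) (x, a)) D"
  shows "affine_germ (loc_rep e d (\<lambda>a. \<phi> (x, a))) (snd e a) (\<lambda>k. D (0, k))"
proof -
  have "affine_germ (\<lambda>w. loc_rep (prod_chart c e) d \<phi> (snd c x, w)) (snd e a) (\<lambda>k. D (0, k))"
    using D by (intro affine_germ_slice) simp
  moreover have "\<forall>\<^sub>F w in nhds (snd e a). loc_rep (prod_chart c e) d \<phi> (snd c x, w) = loc_rep e d (\<lambda>a. \<phi> (x, a)) w"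
    using is_chart_eventually(2)[OF e]
  proof eventually_elim
    case (elim w)
    then show ?case
      using c by (simp add: loc_rep_def chart_inv_prod[unfolded fst_prod_chart snd_prod_chart, OF c(1) e(1)] chart_inv_chart)
  qed
  ultimately show ?thesis by (rule affine_germ_cong)
qed

text \<open>By \<open>MC_on_iff_locally_affine\<close> it suffices to find an affine germ at each
  point, and the germ of \<phi> in a product chart restricts to the slice.\<close>

lemma MC_map_slice:
  assumes k: "1 \<le> k" and M: "MC_manifold k \<A>" and A: "MC_manifold k \<B>"
    and \<phi>: "MC_map k (product_atlas \<A> \<B>) \<C> \<phi>"
  shows "MC_map k \<B> \<C> (\<lambda>a. \<phi> (x, a))"
proof -
  have "continuous_on UNIV \<phi>" using \<phi> by (simp add: MC_map_def)
  then have cont: "continuous_on UNIV (\<lambda>a. \<phi> (x, a))"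
    by (rule continuous_on_compose2[OF _ _ subset_UNIV]) (intro continuous_intros)
  have "MC_on k (loc_dom e d (\<lambda>a. \<phi> (x, a))) (loc_rep e d (\<lambda>a. \<phi> (x, a)))"
    if e: "e \<in> charts k \<B>" and d: "d \<in> charts k \<C>" for e d
    unfolding MC_on_iff_locally_affine[OF k] locally_affine_def
  proof (intro conjI ballI)
    have ch: "is_chart e" "is_chart d" using e d by (auto simp: charts_def)
    then show "open (loc_dom e d (\<lambda>a. \<phi> (x, a)))" by (intro open_loc_dom cont)
    fix w assume "w \<in> loc_dom e d (\<lambda>a. \<phi> (x, a))"
    then obtain a where a: "w = snd e a" "a \<in> fst e" "\<phi> (x, a) \<in> fst d" by (auto simp: loc_dom_def)
    obtain c where c: "c \<in> charts_at k \<A> x" using MC_manifold_chart_at[OF M] by metis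
    have "prod_chart c e \<in> charts_at k (product_atlas \<A> \<B>) (x, a)"
      using e a by (intro prod_chart_in_charts_at k M A c) (simp add: charts_at_def)
    moreover have "d \<in> charts_at k \<C> (\<phi> (x, a))" using d a by (simp add: charts_at_def)
    ultimately have "affine_germ (loc_rep (prod_chart c e) d \<phi>) (snd (prod_chart c e) (x, a))
        (fderiv (loc_rep (prod_chart c e) d \<phi>) (snd (prod_chart c e) (x, a)))"
      by (rule MC_map_germ[OF \<phi> k])
    then show "\<exists>L. affine_germ (loc_rep e d (\<lambda>a. \<phi> (x, a))) w L"
      unfolding a(1) using slice_germ[OF _ _ ch(1) a(2)] charts_at_is_chart[OF c] by blast
  qed
  with cont show ?thesis by (simp add: MC_map_def)
qed

subsection \<open>Meagre sets\<close>

text \<open>Z is closed only relative to W, so its closure may leave W. An open set inside the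
  closure meets W within Z, hence within the empty interior of Z; so it misses Z, and therefore also
  the closure.\<close>

lemma interior_closure_empty:
  fixes Z W :: "'m::topological_space set"
  assumes "open W" "Z \<subseteq> W" "open (W - Z)" "interior Z = {}"
  shows "interior (closure Z) = {}"
proof -
  let ?V = "interior (closure Z)"
  have "?V \<inter> W \<subseteq> Z"
  proof
    fix y assume y: "y \<in> ?V \<inter> W"
    then have "y \<in> closure Z" using interior_subset by blast
    show "y \<in> Z"
    proof (rule ccontr)
      assume "y \<notin> Z"
      then have "(W - Z) \<inter> closure Z \<noteq> {}" using y \<open>y \<in> closure Z\<close> by blast
      then show False using open_Int_closure_eq_empty[OF assms(3), of Z] by blast
    qed
  qed
  then have "?V \<inter> W \<subseteq> interior Z" using assms(1) by (intro interior_maximal) auto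
  then have "?V \<inter> Z = {}" using assms(2,4) by blast
  then have "?V \<inter> closure Z = {}" using open_Int_closure_eq_empty[of ?V Z] by simp
  then show ?thesis using interior_subset[of "closure Z"] by blast
qed

lemma residualI:
  assumes "countable \<Z>" "\<And>Z. Z \<in> \<Z> \<Longrightarrow> interior (closure Z) = {}" "- \<Union>\<Z> \<subseteq> R"
  shows "residual R"
  unfolding residual_def
proof (intro exI[of _ "(\<lambda>Z. - closure Z) ` \<Z>"] conjI ballI)
  show "countable ((\<lambda>Z. - closure Z) ` \<Z>)" using assms(1) by simp
  show "open G" "closure G = UNIV" if "G \<in> (\<lambda>Z. - closure Z) ` \<Z>" for G
    using that assms(2) by (auto simp: closure_complement)
  have "\<Inter> ((\<lambda>Z. - closure Z) ` \<Z>) \<subseteq> - \<Union>\<Z>"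
    using closure_subset by blast
  with assms(3) show "\<Inter> ((\<lambda>Z. - closure Z) ` \<Z>) \<subseteq> R" by blast
qed

text \<open>The projection onto F2 along F1 is the second component of the inverse of addition. It
  is linear because decompositions are unique, and continuous because addition is a
  homeomorphism.\<close>

lemma direct_sum_projection:
  fixes F1 F2 :: "'f::frechet_space set"
  assumes "topological_direct_sum euclidean F1 F2"
  obtains \<pi> :: "'f::frechet_space \<Rightarrow> 'f" where "linear \<pi>" "continuous_on UNIV \<pi>" "\<And>y. \<pi> y = 0 \<longleftrightarrow> y \<in> F1"
proof -
  let ?P = "prod_topology (top_of_set F1) (top_of_set F2)"
  have F: "subspace F1" "subspace F2" and "homeomorphic_map ?P euclidean (\<lambda>(w, z). w + z)"
    using assms by (auto simp: topological_direct_sum_def)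
  then obtain g where g: "homeomorphic_maps ?P euclidean (\<lambda>(w, z). w + z) g"
    unfolding homeomorphic_map_maps by blast
  have gi: "g (w + z) = (w, z)" if "w \<in> F1" "z \<in> F2" for w z
    using g that by (force simp: homeomorphic_maps_def)
  have g: "fst (g y) + snd (g y) = y" "continuous_map euclidean ?P g" for y
    using g by (auto simp: homeomorphic_maps_def case_prod_beta')
  have gF: "fst (g y) \<in> F1" "snd (g y) \<in> F2" for y
    using continuous_map_funspace[OF g(2)] by (auto simp: Pi_iff mem_Times_iff)
  show ?thesis
  proof (rule that[of "\<lambda>y. snd (g y)"])
    show "linear (\<lambda>y. snd (g y))"
    proof (rule linearI)
      fix x y and r :: real
      have "x + y = (fst (g x) + fst (g y)) + (snd (g x) + snd (g y))"
        using g(1)[of x] g(1)[of y] by (simp add: algebra_simps)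
      then have "g (x + y) = (fst (g x) + fst (g y), snd (g x) + snd (g y))"
        using gi gF F by (metis subspace_add)
      then show "snd (g (x + y)) = snd (g x) + snd (g y)" by simp
      have "r *\<^sub>R x = r *\<^sub>R fst (g x) + r *\<^sub>R snd (g x)"
        using g(1)[of x] by (simp add: scaleR_add_right[symmetric])
      then have "g (r *\<^sub>R x) = (r *\<^sub>R fst (g x), r *\<^sub>R snd (g x))"
        using gi gF F by (metis subspace_scale)
      then show "snd (g (r *\<^sub>R x)) = r *\<^sub>R snd (g x)" by simp
    qed
    have "continuous_map euclidean (top_of_set F2) (snd \<circ> g)"
      by (rule continuous_map_compose[OF g(2) continuous_map_snd])
    then have "continuous_map euclidean euclidean (\<lambda>y. snd (g y))"
      by (simp add: comp_def continuous_map_in_subtopology)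
    then show "continuous_on UNIV (\<lambda>y. snd (g y))" by simp
    show "snd (g y) = 0 \<longleftrightarrow> y \<in> F1" for y
    proof
      assume "snd (g y) = 0"
      then have "fst (g y) = y" using g(1)[of y] by simp
      then show "y \<in> F1" using gF(1)[of y] by simp
    next
      assume "y \<in> F1"
      then have "g y = (y, 0)" using gi[of y 0] subspace_0[OF F(2)] by simp
      then show "snd (g y) = 0" by simp
    qed
  qed
qed

subsection \<open>Parametric transversality\<close>

text \<open>The sum condition alone, at one point; for maps on the finite-dimensional manifold the
  splitting is established in \<open>transversal_finite_dim\<close>.\<close>

definition transversal_at ::
    "nat \<Rightarrow> ('p::topological_space, 'e::frechet_space) chart set
      \<Rightarrow> ('q::topological_space, 'f::frechet_space) chart set \<Rightarrow> 'q set \<Rightarrow> ('p \<Rightarrow> 'q) \<Rightarrow> 'p \<Rightarrow> bool"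
  where "transversal_at k \<A> \<B> S \<phi> p \<longleftrightarrow>
    {\<eta> + \<zeta> | \<eta> \<zeta>. \<eta> \<in> tangent_map k \<A> \<B> \<phi> p ` tangent_space k \<A> p \<and>
      \<zeta> \<in> sub_tangent_space k \<B> S (\<phi> p)} = tangent_space k \<B> (\<phi> p)"

text \<open>In a chart, the preimage of the tangent space of S is the preimage of \<open>F1\<close>
  under a linear map, hence a subspace, and \<open>splits_in_tangent_space\<close> applies to
  it.\<close>

lemma transversal_finite_dim:
  fixes \<A> :: "('a::{t2_space,second_countable_topology}, 'd::frechet_space) chart set"
    and \<B> :: "('n::{t2_space,second_countable_topology}, 'f::frechet_space) chart set"
  assumes A: "MC_manifold k \<A>" and B: "MC_manifold k \<B>" and k: "1 \<le> k"
    and dim: "has_dimension (UNIV :: 'd set) n" and S: "MC_submanifold k \<B> S"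
    and \<phi>: "MC_map k \<A> \<B> \<phi>" and at: "\<And>a. \<phi> a \<in> S \<Longrightarrow> transversal_at k \<A> \<B> S \<phi> a"
  shows "transversal k \<A> \<B> S \<phi>"
proof -
  have "splits_in (tangent_topology k \<A> a)
      {\<xi> \<in> tangent_space k \<A> a. tangent_map k \<A> \<B> \<phi> a \<xi> \<in> sub_tangent_space k \<B> S (\<phi> a)}"
    if a: "\<phi> a \<in> S" for a
  proof -
    obtain d F1 F2 where d: "submanifold_chart k \<B> S d F1 F2" "\<phi> a \<in> fst d"
      using S a by (auto simp: MC_submanifold_def)
    note d_at = submanifold_chart_charts_at[OF d]
    obtain c where c: "c \<in> charts_at k \<A> a" using MC_manifold_chart_at[OF A] by metis
    let ?D = "fderiv (loc_rep c d \<phi>) (snd c a)"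
    note tm = tangent_map_props[OF A B k \<phi> c d_at]
    have "{\<xi> \<in> tangent_space k \<A> a. tangent_map k \<A> \<B> \<phi> a \<xi> \<in> sub_tangent_space k \<B> S (\<phi> a)}
        = {\<xi> \<in> tangent_space k \<A> a. ?D (\<xi> c) \<in> F1}"
      unfolding sub_tangent_space_eq[OF B k d a] using tm by auto
    also have "\<dots> = tangent_lift k \<A> a c ` (?D -` F1)"
    proof (intro set_eqI iffI)
      fix \<xi> assume "\<xi> \<in> {\<xi> \<in> tangent_space k \<A> a. ?D (\<xi> c) \<in> F1}"
      then show "\<xi> \<in> tangent_lift k \<A> a c ` (?D -` F1)"
        using tangent_lift_eval[OF _ c, of \<xi>] by (intro image_eqI[of _ _ "\<xi> c"]) auto
    next
      fix \<xi> assume "\<xi> \<in> tangent_lift k \<A> a c ` (?D -` F1)"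
      then show "\<xi> \<in> {\<xi> \<in> tangent_space k \<A> a. ?D (\<xi> c) \<in> F1}"
        using tangent_lift_in[OF A k c] tangent_lift_apply[OF c] by auto
    qed
    finally show ?thesis
      using splits_in_tangent_space[OF A k c dim, of "?D -` F1"]
        linear_subspace_vimage[OF affine_germ_linear[OF MC_map_germ[OF \<phi> k c d_at]] submanifold_chart_subspace[OF d(1)]]
      by simp
  qed
  with at \<phi> show ?thesis by (simp add: transversal_def transversal_at_def)
qed

text \<open>Around an interior point one can move along any direction h in the chart. Two values
  then differ by t (L h), an element of Y, so L would map into Y. Taking the difference also removes
  \<open>u0\<close>.\<close>

lemma nowhere_dense_linear_preimage:
  fixes c :: "('m::topological_space, 'e::frechet_space) chart" and L :: "'e \<Rightarrow> 'f::frechet_space"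
  assumes c: "is_chart c" and W: "open W" "W \<subseteq> fst c"
    and L: "Lip_linear L" and Y: "closed Y" "subspace Y" and not: "\<not> range L \<subseteq> Y"
  shows "interior (closure {x \<in> W. L (snd c x - u0) \<in> Y}) = {}"
proof (rule interior_closure_empty[OF W(1)])
  interpret L: linear L using L by (rule Lip_linear_linear)
  let ?Z = "{x \<in> W. L (snd c x - u0) \<in> Y}"
  show "?Z \<subseteq> W" by blast
  have "continuous_on W (\<lambda>x. L (snd c x - u0))"
    unfolding continuous_on_def
  proof
    fix x assume "x \<in> W"
    then have "(snd c \<longlongrightarrow> snd c x) (at x within W)"
      using is_chart_tendsto(1)[OF c] W(2) by (intro tendsto_mono[OF _ is_chart_tendsto(1)[OF c]]) (auto simp: at_within_def)
    then show "((\<lambda>x. L (snd c x - u0)) \<longlongrightarrow> L (snd c x - u0)) (at x within W)"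
      by (intro Lip_linear_tendsto[OF L] tendsto_diff_frechet tendsto_const)
  qed
  then have "open (W \<inter> (\<lambda>x. L (snd c x - u0)) -` (- Y))"
    using W(1) Y(1) by (intro continuous_open_preimage) auto
  moreover have "W \<inter> (\<lambda>x. L (snd c x - u0)) -` (- Y) = W - ?Z" by blast
  ultimately show "open (W - ?Z)" by simp
  show "interior ?Z = {}"
  proof (rule ccontr)
    assume "interior ?Z \<noteq> {}"
    then obtain x where x: "x \<in> interior ?Z" by blast
    have xc: "x \<in> fst c" "L (snd c x - u0) \<in> Y" using x interior_subset[of ?Z] W(2) by auto
    let ?V = "snd c ` (fst c \<inter> interior ?Z)"
    have V: "open ?V" by (rule is_chart_open_image[OF c open_interior])
    have "L h \<in> Y" for h
    proof -
      have "\<forall>\<^sub>F u in nhds (snd c x). u \<in> ?V" using V x xc by (intro eventually_nhds_in_open) auto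
      then have "\<forall>\<^sub>F t in at 0. snd c x + t *\<^sub>R h \<in> ?V" by (rule eventually_line_zero)
      moreover have "\<forall>\<^sub>F t in at (0::real). t \<noteq> 0" by (simp add: eventually_at_filter)
      ultimately have "\<forall>\<^sub>F t in at 0. t \<noteq> 0 \<and> snd c x + t *\<^sub>R h \<in> ?V" by eventually_elim blast
      then obtain t where t: "t \<noteq> 0" "snd c x + t *\<^sub>R h \<in> ?V"
        using eventually_happens'[OF at_neq_bot] by blast
      then obtain x' where "snd c x + t *\<^sub>R h = snd c x'" "x' \<in> interior ?Z" by blast
      then have "L (snd c x + t *\<^sub>R h - u0) \<in> Y" using interior_subset[of ?Z] by auto
      then have "L (snd c x + t *\<^sub>R h - u0) - L (snd c x - u0) \<in> Y"
        using xc(2) by (rule subspace_diff[OF Y(2)])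
      also have "L (snd c x + t *\<^sub>R h - u0) - L (snd c x - u0) = t *\<^sub>R L h"
        unfolding L.diff[symmetric] L.scaleR[symmetric] by (simp add: algebra_simps)
      finally have "(1 / t) *\<^sub>R (t *\<^sub>R L h) \<in> Y" by (rule subspace_scale[OF Y(2)])
      then show ?thesis using t(1) by simp
    qed
    with not show False by blast
  qed
qed

text \<open>The exceptional set \<open>Z\<close> serves the whole box \<open>O1\<close>: affinity
  gives all points of the box the same derivative, so the single subspace \<open>Y\<close>, which is
  \<open>F1\<close> + \<open>range H\<close>, decides about every partial map there. If
  \<open>Y\<close> is everything, \<open>Z\<close> is empty.\<close>

lemma transversal_slices_locally:
  fixes \<A>\<^sub>M :: "('m::{t2_space,second_countable_topology}, 'e::frechet_space) chart set"
    and \<A>\<^sub>A :: "('a::{t2_space,second_countable_topology}, 'd::frechet_space) chart set"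
    and \<A>\<^sub>N :: "('n::{t2_space,second_countable_topology}, 'f::frechet_space) chart set"
  assumes M: "MC_manifold k \<A>\<^sub>M" and N: "MC_manifold k \<A>\<^sub>N" and A: "MC_manifold k \<A>\<^sub>A" and k: "1 \<le> k"
    and dim: "has_dimension (UNIV :: 'd set) n" and S: "MC_submanifold k \<A>\<^sub>N S"
    and \<phi>: "MC_map k (product_atlas \<A>\<^sub>M \<A>\<^sub>A) \<A>\<^sub>N \<phi>"
    and p0: "\<phi> (x0, a0) \<in> S" and trans: "transversal_at k (product_atlas \<A>\<^sub>M \<A>\<^sub>A) \<A>\<^sub>N S \<phi> (x0, a0)"
  shows "\<exists>O1 Z. open O1 \<and> (x0, a0) \<in> O1 \<and> interior (closure Z) = {} \<and>
    (\<forall>x a. (x, a) \<in> O1 \<longrightarrow> \<phi> (x, a) \<in> S \<longrightarrow> x \<notin> Z \<longrightarrow> transversal_at k \<A>\<^sub>A \<A>\<^sub>N S (\<lambda>a. \<phi> (x, a)) a)"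
proof -
  obtain d F1 F2 where d: "submanifold_chart k \<A>\<^sub>N S d F1 F2" "\<phi> (x0, a0) \<in> fst d"
    using S p0 by (auto simp: MC_submanifold_def)
  note d_at = submanifold_chart_charts_at[OF d]
  note dc = charts_at_is_chart[OF d_at, THEN conjunct1]
  obtain c where c: "c \<in> charts_at k \<A>\<^sub>M x0" using MC_manifold_chart_at[OF M] by metis
  obtain e where e: "e \<in> charts_at k \<A>\<^sub>A a0" using MC_manifold_chart_at[OF A] by metis
  note cc = charts_at_is_chart[OF c, THEN conjunct1] and ec = charts_at_is_chart[OF e, THEN conjunct1]
  define P where "P = prod_chart c e"
  have P: "P \<in> charts_at k (product_atlas \<A>\<^sub>M \<A>\<^sub>A) (x0, a0)"
    unfolding P_def by (rule prod_chart_in_charts_at[OF k M A c e])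
  have Pc: "is_chart P" "(x0, a0) \<in> fst P" using charts_at_is_chart[OF P] by auto
  define f where "f = loc_rep P d \<phi>"
  define z0 where "z0 = snd P (x0, a0)"
  define D where "D = fderiv f z0"
  have D: "affine_germ f z0 D"
    unfolding D_def f_def z0_def by (rule MC_map_germ[OF \<phi> k P d_at])
  interpret D: linear D by (rule affine_germ_linear[OF D])
  define H where "H w = D (0, w)" for w
  define L where "L h = D (h, 0)" for h
  have H: "linear H" by (rule linearI) (simp_all add: H_def D.add[symmetric] D.scaleR[symmetric])
  interpret H: linear H by (rule H)
  have DLH: "D (h, w) = L h + H w" for h w by (simp add: L_def H_def D.add[symmetric])
  have L: "Lip_linear L"
  proof -
    obtain K where K: "0 \<le> K" "\<And>z. frechet_norm (D z) \<le> K * frechet_norm z"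
      using Lip_linearE[OF affine_germ_Lip_linear[OF D]] by metis
    have "linear L" by (rule linearI) (simp_all add: L_def D.add[symmetric] D.scaleR[symmetric])
    moreover have "frechet_norm (L h) \<le> K * frechet_norm h" for h
      using K(2)[of "(h, 0)"] by (simp add: L_def frechet_norm_Pair)
    ultimately show ?thesis unfolding Lip_linear_def by blast
  qed
  have F1: "subspace F1" by (rule submanifold_chart_subspace[OF d(1)])
  obtain \<pi> :: "'f \<Rightarrow> 'f" where \<pi>: "linear \<pi>" "continuous_on UNIV \<pi>" "\<And>y. \<pi> y = 0 \<longleftrightarrow> y \<in> F1"
    using direct_sum_projection[of F1 F2] d(1) by (auto simp: submanifold_chart_def)
  interpret \<pi>: linear \<pi> by (rule \<pi>(1))
  have \<pi>H: "linear (\<pi> \<circ> H)" by (rule linear_compose[OF H \<pi>(1)])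
  define Y where "Y = {y. \<exists>v. y - H v \<in> F1}"
  \<comment> \<open>Applying \<pi>, whose kernel is \<open>F1\<close>, reduces closedness of
    \<open>Y\<close> to closedness of a finite-dimensional range.\<close>
  have Yeq: "Y = \<pi> -` range (\<pi> \<circ> H)"
    by (auto simp: Y_def \<pi>(3)[symmetric] \<pi>.diff image_iff)
  have Y: "closed Y" "subspace Y"
  proof -
    show "closed Y" unfolding Yeq
      by (rule closed_vimage[OF closed_range_finite_dim[OF dim \<pi>H] \<pi>(2)])
    show "subspace Y" unfolding Yeq
      by (rule linear_subspace_vimage[OF \<pi>(1) linear_subspace_image[OF \<pi>H subspace_UNIV]])
  qed
  have HY: "H w \<in> Y" for w unfolding Y_def by (auto intro!: exI[of _ w] subspace_0[OF F1])
  have F1Y: "y \<in> Y" if "y \<in> F1" for y unfolding Y_def using that by (auto intro!: exI[of _ 0] simp: H.zero)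
  have transD: "\<exists>h w. y - (L h + H w) \<in> F1" for y
  proof -
    have "\<forall>y. \<exists>v. y - D v \<in> F1"
      using trans tangent_sum_eq_iff[OF MC_manifold_product[OF k M A] N k \<phi> P d p0]
      unfolding transversal_at_def D_def f_def z0_def by blast
    then obtain v where "y - D v \<in> F1" by blast
    then show ?thesis using DLH by (cases v) auto
  qed
  \<comment> \<open>Both forms are kept: the germ at nearby points gives the derivatives of the
    partial maps, and the formula based at \<open>z0\<close> locates the points over S.\<close>
  have "\<forall>\<^sub>F z in nhds z0. affine_germ f z D \<and> f z = f z0 + D (z - z0)"
    using affine_germ_eventually[OF D] D by (intro eventually_conj) (simp_all add: affine_germ_def)
  then have "\<forall>\<^sub>F p in nhds (x0, a0). affine_germ f (snd P p) D \<and> f (snd P p) = f z0 + D (snd P p - z0)"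
    unfolding z0_def by (rule eventually_compose_filterlim[OF _ is_chart_tendsto(1)[OF Pc]])
  moreover have "\<forall>\<^sub>F p in nhds (x0, a0). \<phi> p \<in> fst d"
    by (rule eventually_compose_filterlim[OF is_chart_eventually(1)[OF dc d(2)] MC_map_tendsto[OF \<phi>]])
  ultimately have "\<forall>\<^sub>F p in nhds (x0, a0). p \<in> fst P \<and> \<phi> p \<in> fst d \<and>
      affine_germ f (snd P p) D \<and> f (snd P p) = f z0 + D (snd P p - z0)"
    using is_chart_eventually(1)[OF Pc] by eventually_elim blast
  then obtain Q where Q: "open Q" "(x0, a0) \<in> Q"
    "\<forall>p\<in>Q. p \<in> fst P \<and> \<phi> p \<in> fst d \<and> affine_germ f (snd P p) D \<and> f (snd P p) = f z0 + D (snd P p - z0)"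
    unfolding eventually_nhds by blast
  obtain O1 O2 where O12: "open O1" "open O2" "(x0, a0) \<in> O1 \<times> O2" "O1 \<times> O2 \<subseteq> Q"
    using Q(1)[unfolded open_prod_def, rule_format, OF Q(2)] by metis
  define W where "W = O1 \<inter> fst c"
  have W: "open W" "W \<subseteq> fst c" "x0 \<in> W"
    using O12 cc charts_at_is_chart[OF c] by (auto simp: W_def is_chart_def)
  have WQ: "(x, a) \<in> Q" if "(x, a) \<in> W \<times> O2" for x a using that O12(4) by (auto simp: W_def)
  have fS: "f (snd P (x, a)) \<in> F1" if "(x, a) \<in> Q" "\<phi> (x, a) \<in> S" for x a
    using submanifold_chart_mem[OF d(1) that(2)] Q(3) that(1) loc_rep_apply[OF Pc(1), of "(x, a)" d \<phi>]
    unfolding f_def by auto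
  show ?thesis
  proof (cases "Y = UNIV")
    case True
    have "transversal_at k \<A>\<^sub>A \<A>\<^sub>N S (\<lambda>a. \<phi> (x, a)) a" if xa: "(x, a) \<in> W \<times> O2" "\<phi> (x, a) \<in> S" for x a
    proof -
      have q: "(x, a) \<in> fst P" "\<phi> (x, a) \<in> fst d" "affine_germ f (snd P (x, a)) D"
        using Q(3) WQ[OF xa(1)] by auto
      then have xe: "x \<in> fst c" "a \<in> fst e" by (auto simp: P_def)
      have "affine_germ (loc_rep e d (\<lambda>a. \<phi> (x, a))) (snd e a) (\<lambda>w. D (0, w))"
        using q(3) unfolding f_def P_def by (rule slice_germ[OF cc xe(1) ec xe(2)])
      then have "fderiv (loc_rep e d (\<lambda>a. \<phi> (x, a))) (snd e a) = H"
        unfolding H_def by (rule affine_germ_fderiv)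
      moreover have "e \<in> charts_at k \<A>\<^sub>A a" using e xe(2) by (simp add: charts_at_def)
      ultimately show ?thesis
        unfolding transversal_at_def
        using tangent_sum_eq_iff[OF A N k MC_map_slice[OF k M A \<phi>] _ d(1) q(2) xa(2), of e] True
        unfolding Y_def by auto
    qed
    then show ?thesis
      using W O12 by (intro exI[of _ "W \<times> O2"] exI[of _ "{}"]) (auto simp: open_Times)
  next
    case False
    define Z where "Z = {x \<in> W. L (snd c x - snd c x0) \<in> Y}"
    \<comment> \<open>Otherwise transversality of \<phi> at the base point would put every vector
      into \<open>Y\<close>, as a sum of elements of \<open>F1\<close>, \<open>range L\<close> and
      \<open>range H\<close>.\<close>
    have "\<not> range L \<subseteq> Y"
    proof
      assume LY: "range L \<subseteq> Y"
      have "y \<in> Y" for y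
      proof -
        obtain h w where "y - (L h + H w) \<in> F1" using transD by blast
        then have "(y - (L h + H w)) + (L h + H w) \<in> Y"
          using LY HY F1Y by (intro subspace_add[OF Y(2)]) auto
        then show ?thesis by simp
      qed
      with False show False by blast
    qed
    then have nd: "interior (closure Z) = {}"
      unfolding Z_def by (rule nowhere_dense_linear_preimage[OF cc W(1,2) L Y])
    have "x \<in> Z" if xa: "(x, a) \<in> W \<times> O2" "\<phi> (x, a) \<in> S" for x a
    proof -
      have "snd P (x, a) - z0 = (snd c x - snd c x0, snd e a - snd e a0)"
        by (simp add: z0_def P_def)
      then have "f (snd P (x, a)) - f z0 = L (snd c x - snd c x0) + H (snd e a - snd e a0)"
        using Q(3) WQ[OF xa(1)] by (simp add: DLH)
      \<comment> \<open>The base point lies over S as well, so \<open>f z0\<close> belongs to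
        \<open>F1\<close>. It need not be 0, which is why the difference is taken.\<close>
      moreover have "f (snd P (x, a)) - f z0 \<in> F1"
        using fS[OF WQ[OF xa(1)] xa(2)] fS[OF Q(2) p0] unfolding z0_def by (rule subspace_diff[OF F1])
      ultimately have "L (snd c x - snd c x0) + H (snd e a - snd e a0) \<in> Y" using F1Y by simp
      from subspace_diff[OF Y(2) this HY[of "snd e a - snd e a0"]]
      show ?thesis using xa(1) by (simp add: Z_def)
    qed
    with nd show ?thesis
      using W O12 by (intro exI[of _ "W \<times> O2"] exI[of _ Z]) (auto simp: open_Times)
  qed
qed

theorem theorem2p4:
  fixes \<A>\<^sub>M :: "('m::{t2_space,second_countable_topology}, 'e::frechet_space) chart set"
    and \<A>\<^sub>A :: "('a::{t2_space,second_countable_topology}, 'd::frechet_space) chart set"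
    and \<A>\<^sub>N :: "('n::{t2_space,second_countable_topology}, 'f::frechet_space) chart set"
    and \<phi> :: "'m \<times> 'a \<Rightarrow> 'n" and S :: "'n set" and k n m :: nat
  assumes "MC_manifold k \<A>\<^sub>M" and "connected (UNIV :: 'm set)"
    and "MC_manifold k \<A>\<^sub>N" and "connected (UNIV :: 'n set)"
    and "MC_manifold k \<A>\<^sub>A" and "has_dimension (UNIV :: 'd set) n"
    and "MC_submanifold k \<A>\<^sub>N S" and "has_codimension k \<A>\<^sub>N S m"
    and "MC_map k (product_atlas \<A>\<^sub>M \<A>\<^sub>A) \<A>\<^sub>N \<phi>"
    and "int k \<ge> max 1 (int n - int m)"
    and "transversal k (product_atlas \<A>\<^sub>M \<A>\<^sub>A) \<A>\<^sub>N S \<phi>"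
  shows "residual {x. transversal k \<A>\<^sub>A \<A>\<^sub>N S (\<lambda>a. \<phi> (x, a))}"
proof -
  note M = assms(1) and N = assms(3) and A = assms(5) and dim = assms(6) and S = assms(7) and \<phi> = assms(9)
  have k: "1 \<le> k" using assms(10) by simp
  let ?P = "product_atlas \<A>\<^sub>M \<A>\<^sub>A"
  have "\<exists>O1 Z. open O1 \<and> p \<in> O1 \<and> interior (closure Z) = {} \<and>
      (\<forall>x a. (x, a) \<in> O1 \<longrightarrow> \<phi> (x, a) \<in> S \<longrightarrow> x \<notin> Z \<longrightarrow> transversal_at k \<A>\<^sub>A \<A>\<^sub>N S (\<lambda>a. \<phi> (x, a)) a)"
    if p: "p \<in> \<phi> -` S" for p
  proof -
    obtain x0 a0 where p_eq: "p = (x0, a0)" by (cases p)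
    have "transversal_at k ?P \<A>\<^sub>N S \<phi> p"
      using assms(11) p unfolding transversal_def transversal_at_def by blast
    then show ?thesis
      using transversal_slices_locally[OF M N A k dim S \<phi>] p unfolding p_eq by simp
  qed
  then obtain U Z where UZ: "\<And>p. p \<in> \<phi> -` S \<Longrightarrow> open (U p) \<and> p \<in> U p \<and> interior (closure (Z p)) = {} \<and>
      (\<forall>x a. (x, a) \<in> U p \<longrightarrow> \<phi> (x, a) \<in> S \<longrightarrow> x \<notin> Z p \<longrightarrow> transversal_at k \<A>\<^sub>A \<A>\<^sub>N S (\<lambda>a. \<phi> (x, a)) a)"
    by metis
  \<comment> \<open>Second countability of the product reduces the cover of the preimage of S to a
    countable one.\<close>
  obtain \<F> where \<F>: "\<F> \<subseteq> U ` (\<phi> -` S)" "countable \<F>" "\<Union>\<F> = \<Union>(U ` (\<phi> -` S))"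
    using Lindelof[of "U ` (\<phi> -` S)"] UZ by blast
  \<comment> \<open>Countably many base points are needed, not just countably many open sets,
    because the exceptional set is attached to the point.\<close>
  obtain I where I: "countable I" "I \<subseteq> \<phi> -` S" "\<F> = U ` I"
    using \<F>(1,2) by (metis countable_subset_image)
  show ?thesis
  proof (rule residualI[of "Z ` I"])
    show "countable (Z ` I)" using I(1) by simp
    show "interior (closure C) = {}" if "C \<in> Z ` I" for C using that I(2) UZ by blast
    show "- \<Union>(Z ` I) \<subseteq> {x. transversal k \<A>\<^sub>A \<A>\<^sub>N S (\<lambda>a. \<phi> (x, a))}"
    proof (intro subsetI CollectI)
      fix x assume x: "x \<in> - \<Union>(Z ` I)"
      show "transversal k \<A>\<^sub>A \<A>\<^sub>N S (\<lambda>a. \<phi> (x, a))"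
      proof (rule transversal_finite_dim[OF A N k dim S MC_map_slice[OF k M A \<phi>]])
        fix a assume a: "\<phi> (x, a) \<in> S"
        \<comment> \<open>Each point over S with first component x lies in a chosen box, and x
          avoids the exceptional set of that box.\<close>
        then have "(x, a) \<in> \<Union>\<F>" using UZ[of "(x, a)"] \<F>(3) by auto
        then obtain p where "p \<in> I" "(x, a) \<in> U p" using I(3) by blast
        then show "transversal_at k \<A>\<^sub>A \<A>\<^sub>N S (\<lambda>a. \<phi> (x, a)) a"
          using UZ[of p] I(2) x a by blast
      qed
    qed
  qed
qed

end
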